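(* For every integer $k \ge 1$ there exists $n_0 = n_0(k)$ such that for all $n \ge n_0$, $$D(n, C_{2k+1}) = 2^{\lfloor n^2/4 \rfloor}.$$
   Context: An orientation of a (simple, undirected) graph $G$ is obtained by assigning a direction to each edge of $G$. $C_{2k+1}$ denotes the directed cycle of length $2k+1$, i.e. the cycle $v_1 v_2 \cdots v_{2k+1} v_1$ with every edge oriented $v_i \to v_{i+1}$ (indices mod $2k+1$). An orientation is $C_{2k+1}$-free if it contains no directed cycle of length $2k+1$ as a subgraph. For an oriented graph $H$, $D(n,H)$ denotes the maximum, over all graphs $G$ on $n$ vertices, of the number of orientations of $G$ that contain no copy of $H$. *)

theory Defs
  imports Complex_Main "Graph_Theory.Pair_Digraph"
begin

definition simple_graph :: "'a set \<Rightarrow> 'a set set \<Rightarrow> bool" where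
  "simple_graph V E \<longleftrightarrow> (\<forall>e\<in>E. e \<subseteq> V \<and> card e = 2)"

text \<open>An orientation chooses, for every edge, exactly one of its two directions: forgetting
  directions is a bijection from the arcs onto the edges.\<close>

definition orientation :: "'a set \<Rightarrow> 'a set set \<Rightarrow> 'a pair_pre_digraph \<Rightarrow> bool" where
  "orientation V E G \<longleftrightarrow> pverts G = V \<and> bij_betw (\<lambda>(u, v). {u, v}) (parcs G) E"

text \<open>Copies are not required to be induced.\<close>

definition contains_copy :: "'a pair_pre_digraph \<Rightarrow> 'h pair_pre_digraph \<Rightarrow> bool" where
  "contains_copy G H \<longleftrightarrow>
     (\<exists>f. inj_on f (pverts H) \<and> f ` pverts H \<subseteq> pverts G \<and>
          (\<forall>(x, y)\<in>parcs H. (f x, f y) \<in> parcs G))"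

definition free_orientations ::
  "'a set \<Rightarrow> 'a set set \<Rightarrow> 'h pair_pre_digraph \<Rightarrow> 'a pair_pre_digraph set" where
  "free_orientations V E H = {G. orientation V E G \<and> \<not> contains_copy G H}"

text \<open>The number of \<open>H\<close>-free orientations is invariant under isomorphism, so the
  graphs on \<open>n\<close> vertices are taken on the vertex set \<open>{..<n}\<close>.\<close>

definition max_free_orientations :: "nat \<Rightarrow> 'h pair_pre_digraph \<Rightarrow> nat" where
  "max_free_orientations n H =
     Max {card (free_orientations {..<n} E H) | E. simple_graph {..<n} E}"

definition directed_cycle :: "nat \<Rightarrow> nat pair_pre_digraph" where
  "directed_cycle m = \<lparr>pverts = {..<m}, parcs = {(i, Suc i mod m) | i. i < m}\<rparr>"

lemma finite_simple_graphs: "finite V \<Longrightarrow> finite {E. simple_graph V E}"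
  by (rule finite_subset[of _ "Pow (Pow V)"]) (auto simp: simple_graph_def)

lemma finite_free_orientations:
  assumes "finite V" "simple_graph V E"
  shows "finite (free_orientations V E H)"
proof -
  have "free_orientations V E H \<subseteq> (\<lambda>A. \<lparr>pverts = V, parcs = A\<rparr>) ` Pow (V \<times> V)"
  proof
    fix G assume "G \<in> free_orientations V E H"
    then have G: "pverts G = V" "(\<lambda>(u, v). {u, v}) ` parcs G = E"
      by (auto simp: free_orientations_def orientation_def bij_betw_def)
    have "parcs G \<subseteq> V \<times> V"
      using G(2) assms(2) by (fastforce simp: simple_graph_def)
    moreover have "G = \<lparr>pverts = V, parcs = parcs G\<rparr>"
      using G(1) by simp
    ultimately show "G \<in> (\<lambda>A. \<lparr>pverts = V, parcs = A\<rparr>) ` Pow (V \<times> V)"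
      by blast
  qed
  then show ?thesis
    using assms(1) by (auto intro: finite_subset)
qed

lemma max_free_orientations_set:
  fixes n :: nat
  shows "finite {card (free_orientations {..<n} E H) | E. simple_graph {..<n} E}"
    and "{card (free_orientations {..<n} E H) | E. simple_graph {..<n} E} \<noteq> {}"
proof -
  have "{card (free_orientations {..<n} E H) | E. simple_graph {..<n} E}
      = (\<lambda>E. card (free_orientations {..<n} E H)) ` {E. simple_graph {..<n} E}"
    by auto
  then show "finite {card (free_orientations {..<n} E H) | E. simple_graph {..<n} E}"
    by (simp add: finite_simple_graphs)
  have "simple_graph {..<n} {}" by (simp add: simple_graph_def)
  then show "{card (free_orientations {..<n} E H) | E. simple_graph {..<n} E} \<noteq> {}"
    by blast
qed

end

theory Submission
  imports Defs "HOL-Library.FuncSet" "HOL-Library.Disjoint_Sets" "HOL-Number_Theory.Cong"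
begin

text \<open>Let \<open>d(E)\<close> be the number of \<open>C\<^sub>2\<^sub>k\<^sub>+\<^sub>1\<close>-free orientations and \<open>F(n) = \<lfloor>n\<^sup>2/4\<rfloor>\<close>. For large \<open>n\<close>, if
  \<open>d(E) > 2\<^bsup>F(n)\<^esup>\<close>, then deleting a suitable bounded set of vertices at least doubles the ratio
  \<open>d(E) / 2\<^bsup>F(n)\<^esup>\<close>; iterating down to bounded size contradicts the trivial bound \<open>d(E) \<le> 2\<^bsup>|E|\<^esup>\<close>.

  A vertex of degree less than \<open>\<lfloor>n/2\<rfloor>\<close> can be deleted. Otherwise, the Sauer--Shelah lemma bounds the
  number of orientations without a copy of a fixed orientation of \<open>K\<^bsub>2m,2m\<^esub>\<close> by the number of
  \<open>K\<^bsub>2m,2m\<^esub>\<close>-free edge sets, which is \<open>2\<^bsup>o(n\<^sup>2)\<^esup>\<close> by Kovari--Sos--Turan. So almost all orientations contain a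
  blow-up of the directed 4-cycle with parts of size \<open>m\<close>. Directed paths inside it leave each
  outside vertex at most \<open>2\<^bsup>2m\<^esup>\<close> ways to attach, with equality only if its neighbourhood is exactly one
  side, and two adjacent vertices attached to the same side lose a further option. Deleting the
  blow-up is thus a large gain unless all but few vertices split into two independent sets \<open>X\<close>, \<open>Y\<close>.

  In this nearly complete bipartite situation almost all orientations have arcs in both directions
  between any two linear-sized subsets of \<open>X\<close> and \<open>Y\<close>, hence long enough directed paths. These leave
  few options at a vertex with many neighbours on both sides, or at an edge inside a part; one of
  these is present, since a bipartite graph has at most \<open>F(n)\<close> edges.\<close>

section \<open>Shattering, small subsets and bicliques\<close>

text \<open>The bound is exact, so an error of o(n^2) in the exponent is useless by itself; such
  estimates serve only to discard at most half of the orientations, at the cost of a factor 2. Every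
  deletion has a budget in bits, the drop of F(n): floor(n/2) for one vertex, n - 1 for two, at
  least 2m(n - 4m) for a gadget. Fixing a gadget costs a factor polynomial in n, which a single bad
  vertex cannot repay: linearly many disjoint bad blocks are required, each gaining a constant
  factor. Failing that, the exceptional set Z is a small fraction of n rather than bounded, and the
  edges may exceed F(n) by n |Z|. Atypical orientations lose at least p^2/2 bits, where p is the
  size of the tested subsets. Hence two linear scales: p a small fraction of n, and |Z| much smaller
  again, at most p^2/(4n). A blow-up of the 4-cycle serves every k, because an odd cycle minus one
  vertex or minus two adjacent vertices is a path, and paths can wind round the four parts; only the
  part size depends on k.\<close>

definition shattered_by :: "'a set set \<Rightarrow> 'a set \<Rightarrow> bool" where
  "shattered_by \<F> T \<longleftrightarrow> (\<forall>U\<subseteq>T. \<exists>F\<in>\<F>. F \<inter> T = U)"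

lemma shattered_byD: "shattered_by \<F> T \<Longrightarrow> U \<subseteq> T \<Longrightarrow> \<exists>F\<in>\<F>. F \<inter> T = U"
  by (simp add: shattered_by_def)

text \<open>Pajor's form of the Sauer-Shelah lemma. Forgetting x merges the pairs of members that
  differ only in x; the lost count \<open>card (\<F>0 \<inter> \<F>1)\<close> is regained because a
  set T shattered by both traces makes \<open>insert x T\<close> shattered by \<F>.\<close>

lemma card_le_card_shattered:
  assumes "finite E" "\<F> \<subseteq> Pow E"
  shows "card \<F> \<le> card {T. T \<subseteq> E \<and> shattered_by \<F> T}"
  using assms
proof (induction E arbitrary: \<F> rule: finite_induct)
  case empty
  show ?case
  proof (cases "\<F> = {}")
    case False
    then have "\<F> = {{}}" using empty by auto
    then have "{T. T \<subseteq> {} \<and> shattered_by \<F> T} = {{}}" by (auto simp: shattered_by_def)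
    then show ?thesis using \<open>\<F> = {{}}\<close> by simp
  qed simp
next
  case (insert x E)
  define \<F>0 where "\<F>0 = {F\<in>\<F>. x \<notin> F}"
  define \<F>1 where "\<F>1 = (\<lambda>F. F - {x}) ` {F\<in>\<F>. x \<in> F}"
  have fin: "finite \<F>" using insert.hyps insert.prems finite_subset by (metis finite_Pow_iff finite_insert)
  have sub: "\<F>0 \<subseteq> Pow E" "\<F>1 \<subseteq> Pow E" using insert.prems by (auto simp: \<F>0_def \<F>1_def)
  have inj: "inj_on (\<lambda>F. F - {x}) {F\<in>\<F>. x \<in> F}" by (auto simp: inj_on_def)
  have "\<F> = \<F>0 \<union> {F\<in>\<F>. x \<in> F}" "\<F>0 \<inter> {F\<in>\<F>. x \<in> F} = {}" by (auto simp: \<F>0_def)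
  then have "card \<F> = card \<F>0 + card {F\<in>\<F>. x \<in> F}"
    using fin by (metis (no_types, lifting) card_Un_disjoint finite_Un)
  also have "\<dots> = card \<F>0 + card \<F>1" using inj by (simp add: \<F>1_def card_image)
  also have "\<dots> = card (\<F>0 \<union> \<F>1) + card (\<F>0 \<inter> \<F>1)"
    using fin by (intro card_Un_Int) (auto simp: \<F>0_def \<F>1_def)
  finally have card: "card \<F> = card (\<F>0 \<union> \<F>1) + card (\<F>0 \<inter> \<F>1)" .
  let ?S = "\<lambda>\<G>. {T. T \<subseteq> E \<and> shattered_by \<G> T}"
  have finS: "finite (?S \<G>)" for \<G> using insert.hyps by simp
  have "card \<F> \<le> card (?S (\<F>0 \<union> \<F>1)) + card (?S (\<F>0 \<inter> \<F>1))"
    unfolding card using sub by (intro add_mono insert.IH) auto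
  also have "card (?S (\<F>0 \<inter> \<F>1)) = card (insert x ` ?S (\<F>0 \<inter> \<F>1))"
    using insert.hyps by (intro card_image[symmetric]) (auto simp: inj_on_def)
  also have "card (?S (\<F>0 \<union> \<F>1)) + card (insert x ` ?S (\<F>0 \<inter> \<F>1)) =
     card (?S (\<F>0 \<union> \<F>1) \<union> insert x ` ?S (\<F>0 \<inter> \<F>1))"
    using finS insert.hyps by (intro card_Un_disjoint[symmetric]) auto
  also have "\<dots> \<le> card {T. T \<subseteq> insert x E \<and> shattered_by \<F> T}"
  proof (intro card_mono)
    show "finite {T. T \<subseteq> insert x E \<and> shattered_by \<F> T}" using insert.hyps by simp
    have 1: "shattered_by \<F> T" if T: "T \<subseteq> E" "shattered_by (\<F>0 \<union> \<F>1) T" for T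
      unfolding shattered_by_def
    proof (intro allI impI)
      fix U assume "U \<subseteq> T"
      then obtain F where F: "F \<in> \<F>0 \<union> \<F>1" "F \<inter> T = U" using shattered_byD[OF T(2)] by blast
      have xT: "x \<notin> T" using T insert.hyps by auto
      show "\<exists>F\<in>\<F>. F \<inter> T = U"
      proof (cases "F \<in> \<F>0")
        case True then show ?thesis using F by (auto simp: \<F>0_def)
      next
        case False
        then obtain F' where "F' \<in> \<F>" "F = F' - {x}" using F by (auto simp: \<F>1_def)
        then show ?thesis using F(2) xT by (intro bexI[of _ F']) auto
      qed
    qed
    have 2: "shattered_by \<F> (insert x T)" if T: "T \<subseteq> E" "shattered_by (\<F>0 \<inter> \<F>1) T" for T
      unfolding shattered_by_def
    proof (intro allI impI)
      fix U assume U: "U \<subseteq> insert x T"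
      have xT: "x \<notin> T" using T insert.hyps by auto
      obtain F where F: "F \<in> \<F>0" "F \<in> \<F>1" "F \<inter> T = U - {x}"
        using shattered_byD[OF T(2), of "U - {x}"] U by auto
      show "\<exists>F\<in>\<F>. F \<inter> insert x T = U"
      proof (cases "x \<in> U")
        case True
        obtain F' where F': "F' \<in> \<F>" "F = F' - {x}" "x \<in> F'" using F by (auto simp: \<F>1_def)
        then have "F' \<inter> insert x T = U" using F(3) xT True by auto
        then show ?thesis using F' by blast
      next
        case False
        have "F \<in> \<F>" "x \<notin> F" using F by (auto simp: \<F>0_def)
        moreover have "F \<inter> insert x T = U" using F(3) \<open>x \<notin> F\<close> False by auto
        ultimately show ?thesis by blast
      qed
    qed
    show "?S (\<F>0 \<union> \<F>1) \<union> insert x ` ?S (\<F>0 \<inter> \<F>1) \<subseteq> {T. T \<subseteq> insert x E \<and> shattered_by \<F> T}"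
      using 1 2 by auto
  qed
  finally show ?case .
qed

lemma card_le_fibres:
  assumes "finite X" "finite Y" "f ` X \<subseteq> Y" "\<And>y. y \<in> Y \<Longrightarrow> card {x\<in>X. f x = y} \<le> M"
  shows "card X \<le> M * card Y"
proof -
  have "X = (\<Union>y\<in>Y. {x\<in>X. f x = y})" using assms(3) by auto
  then have "card X \<le> (\<Sum>y\<in>Y. card {x\<in>X. f x = y})"
    using card_UN_le[OF assms(2), of "\<lambda>y. {x\<in>X. f x = y}"] by simp
  also have "\<dots> \<le> (\<Sum>y\<in>Y. M)" by (intro sum_mono assms(4))
  finally show ?thesis by (simp add: mult.commute)
qed

text \<open>The Chernoff-type bound \<open>\<Sum>\<^sub>i\<^sub>\<le>\<^sub>j (n choose i) \<le> (1 + x)\<^sup>n / x\<^sup>j\<close> with \<open>x = 1/100\<close>.\<close>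

lemma card_small_subsets_le:
  assumes "finite V" "card V \<le> n" "1000 * j \<le> n"
  shows "real (card {T. T \<subseteq> V \<and> card T \<le> j}) \<le> 2 powr (real n / 32)"
proof -
  let ?S = "{T. T \<subseteq> V \<and> card T \<le> j}"
  have finS: "finite ?S" using assms by simp
  have "real (card ?S) * (1/100)^j = (\<Sum>T\<in>?S. (1/100)^j)" by simp
  also have "\<dots> \<le> (\<Sum>T\<in>?S. (1/100)^card T)"
    by (intro sum_mono power_decreasing) auto
  also have "\<dots> \<le> (\<Sum>T\<in>Pow V. (1/100)^card T)"
    using assms(1) by (intro sum_mono2) auto
  also have "\<dots> = (\<Prod>v\<in>V. 1/100 + 1)"
    using prod_add[OF assms(1), of "\<lambda>_. 1/100" "\<lambda>_. 1::real"] by simp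
  also have "\<dots> = (101/100) ^ card V" by simp
  also have "\<dots> \<le> (101/100) ^ n" using assms(2) by (intro power_increasing) auto
  finally have 1: "real (card ?S) \<le> (101/100) ^ n * 100 ^ j"
    by (simp add: power_divide field_simps)
  \<comment> \<open>The power 64 turns the base 101/100 into at most 2^(1/64). With 100 \<le> 2^7
    and 1000 j \<le> n the total exponent is at most n/64 + 7n/1000, below n/32.\<close>
  have "(101/100::real) ^ 64 \<le> 2" by (simp add: power_divide)
  then have "((101/100::real) ^ 64) powr (1/64) \<le> 2 powr (1/64)" by (intro powr_mono2) auto
  moreover have "((101/100::real) ^ 64) powr (1/64) = 101/100"
    by (simp only: powr_realpow[symmetric] powr_powr) simp
  ultimately have "(101/100::real) \<le> 2 powr (1/64)" by simp
  then have a: "(101/100::real) ^ n \<le> (2 powr (1/64)) ^ n" by (intro power_mono) auto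
  have b: "(100::real) ^ j \<le> (2 powr 7) ^ j" by (intro power_mono) (auto simp: powr_numeral)
  have "real (card ?S) \<le> (2 powr (1/64)) ^ n * (2 powr 7) ^ j"
    by (rule order_trans[OF 1]) (intro mult_mono a b; simp)
  also have "\<dots> = 2 powr (real n / 64 + 7 * real j)"
    by (simp only: powr_add powr_power) (simp add: mult.commute)
  also have "\<dots> \<le> 2 powr (real n / 32)"
  proof (intro powr_mono)
    have "1000 * real j \<le> real n" using assms(3) by linarith
    then show "real n / 64 + 7 * real j \<le> real n / 32" by simp
  qed simp
  finally show ?thesis .
qed

section \<open>Neighbourhoods, edge counts and bicliques\<close>

definition neighbours :: "'a set set \<Rightarrow> 'a \<Rightarrow> 'a set" where
  "neighbours E v = {u. {v, u} \<in> E}"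

lemma simple_graph_finite: "finite V \<Longrightarrow> simple_graph V E \<Longrightarrow> finite E"
  by (rule finite_subset[of _ "Pow V"]) (auto simp: simple_graph_def)

lemma simple_graph_edgeD: "simple_graph V E \<Longrightarrow> {u, v} \<in> E \<Longrightarrow> u \<in> V \<and> v \<in> V \<and> u \<noteq> v"
  by (cases "u = v") (force simp: simple_graph_def)+

lemma simple_graph_edgeE:
  assumes "simple_graph V E" "e \<in> E"
  obtains u v where "e = {u, v}" "u \<noteq> v" "u \<in> V" "v \<in> V"
proof -
  have "e \<subseteq> V" "card e = 2" using assms by (auto simp: simple_graph_def)
  then obtain u v where "e = {u, v}" "u \<noteq> v" by (auto simp: card_2_iff)
  then show ?thesis using that \<open>e \<subseteq> V\<close> by auto
qed

lemma simple_graph_mono: "simple_graph V E \<Longrightarrow> F \<subseteq> E \<Longrightarrow> simple_graph V F"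
  by (auto simp: simple_graph_def)

lemma neighbours_subset: "simple_graph V E \<Longrightarrow> neighbours E v \<subseteq> V - {v}"
  by (auto simp: neighbours_def dest: simple_graph_edgeD)

lemma card_edges_le_sum_degrees:
  assumes "finite V" "simple_graph V E"
  shows "card E \<le> (\<Sum>v\<in>V. card (neighbours E v))"
proof -
  have fin: "finite (neighbours E v)" for v
    using neighbours_subset[OF assms(2)] assms(1) by (meson finite_Diff finite_subset)
  have "E \<subseteq> (\<lambda>(v, u). {v, u}) ` (SIGMA v:V. neighbours E v)"
  proof
    fix e assume "e \<in> E"
    then obtain u v where "e = {u, v}" "u \<in> V" using simple_graph_edgeE[OF assms(2)] by metis
    then show "e \<in> (\<lambda>(v, u). {v, u}) ` (SIGMA v:V. neighbours E v)"
      using \<open>e \<in> E\<close> by (intro image_eqI[of _ _ "(u, v)"]) (auto simp: neighbours_def)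
  qed
  then have "card E \<le> card (SIGMA v:V. neighbours E v)"
    using assms(1) fin by (meson finite_SigmaI surj_card_le)
  also have "\<dots> = (\<Sum>v\<in>V. card (neighbours E v))"
    using assms(1) fin by (intro card_SigmaI) auto
  finally show ?thesis .
qed

text \<open>Disjointness of L and R is automatic in a simple graph, where a common vertex would be a
  loop.\<close>

definition has_biclique :: "nat \<Rightarrow> 'a set set \<Rightarrow> bool" where
  "has_biclique t E \<longleftrightarrow> (\<exists>L R. finite L \<and> finite R \<and> card L = t \<and> card R = t \<and> (\<forall>u\<in>L. \<forall>v\<in>R. {u, v} \<in> E))"

text \<open>Double counting of the pairs of a vertex and a \<open>t\<close>-subset of its neighbourhood.\<close>

lemma has_biclique_if_many_edges:
  assumes "finite V" "card V = n" "simple_graph V E" and n0: "n > 0" and "2 * n * j \<le> card E" "t * n ^ t < j * (j choose t)"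
  shows "has_biclique t E"
proof (rule ccontr)
  assume no: "\<not> has_biclique t E"
  have fin: "finite (neighbours E v)" for v
    using neighbours_subset[OF assms(3)] assms(1) by (meson finite_Diff finite_subset)
  have degn: "card (neighbours E v) \<le> n" for v
    using neighbours_subset[OF assms(3)] assms(1,2) by (metis Diff_subset card_mono subset_trans)
  \<comment> \<open>The vertices outside H account for at most n j of the degree sum, so those in H
    account for at least n j, which forces at least j of them.\<close>
  define H where "H = {v\<in>V. j \<le> card (neighbours E v)}"
  have HV: "H \<subseteq> V" "finite H" using assms(1) by (auto simp: H_def)
  have "2 * n * j \<le> (\<Sum>v\<in>V. card (neighbours E v))"
    using card_edges_le_sum_degrees[OF assms(1,3)] assms(5) by linarith
  also have "\<dots> = (\<Sum>v\<in>H. card (neighbours E v)) + (\<Sum>v\<in>V - H. card (neighbours E v))"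
    using HV assms(1) by (metis add.commute sum.subset_diff)
  also have "\<dots> \<le> (\<Sum>v\<in>H. n) + (\<Sum>v\<in>V - H. j)"
    using degn by (intro add_mono sum_mono) (auto simp: H_def)
  also have "\<dots> \<le> card H * n + n * j"
    using assms(1,2) by (auto intro!: card_mono)
  finally have "n * j \<le> n * card H" by (simp add: mult.commute)
  then have jH: "j \<le> card H" using n0 by simp
  define T where "T = {L. L \<subseteq> V \<and> card L = t}"
  have finT: "finite T" using assms(1) by (simp add: T_def)
  have cardT: "card T = n choose t" using n_subsets[OF assms(1)] assms(2) by (simp add: T_def)
  define I where "I = (SIGMA v:H. {L. L \<subseteq> neighbours E v \<and> card L = t})"
  have "j * (j choose t) \<le> (\<Sum>v\<in>H. card (neighbours E v) choose t)"
  proof -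
    have "j * (j choose t) \<le> card H * (j choose t)" using jH by simp
    also have "\<dots> = (\<Sum>v\<in>H. j choose t)" by simp
    also have "\<dots> \<le> (\<Sum>v\<in>H. card (neighbours E v) choose t)"
      by (intro sum_mono binomial_right_mono) (auto simp: H_def)
    finally show ?thesis .
  qed
  also have "\<dots> = card I"
    unfolding I_def using HV fin n_subsets[OF fin] by (subst card_SigmaI) auto
  also have "\<dots> \<le> t * card T"
  proof (rule card_le_fibres[where f = snd])
    show "finite I" unfolding I_def using HV fin by (intro finite_SigmaI) auto
    show "finite T" by fact
    show "snd ` I \<subseteq> T" using neighbours_subset[OF assms(3)] by (fastforce simp: I_def T_def)
    fix L assume L: "L \<in> T"
    let ?W = "{v\<in>H. L \<subseteq> neighbours E v}"
    have "card {x\<in>I. snd x = L} \<le> card ?W"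
      using HV L by (intro card_inj_on_le[where f = fst]) (auto simp: I_def inj_on_def)
    also have "\<dots> \<le> t"
    proof (rule ccontr)
      assume "\<not> card ?W \<le> t"
      then obtain R where R: "R \<subseteq> ?W" "card R = t"
        by (meson nle_le obtain_subset_with_card_n)
      have "has_biclique t E"
        unfolding has_biclique_def
      proof (intro exI conjI)
        show "finite R" using R HV by (auto intro: finite_subset)
        show "finite L" using L assms(1) by (auto simp: T_def intro: finite_subset)
        show "card R = t" "card L = t" using R L by (auto simp: T_def)
        show "\<forall>u\<in>R. \<forall>v\<in>L. {u, v} \<in> E" using R by (auto simp: neighbours_def)
      qed
      then show False using no by simp
    qed
    finally show "card {x\<in>I. snd x = L} \<le> t" .
  qed
  also have "card T \<le> n ^ t"
    unfolding cardT by (cases "t \<le> n") (auto simp: binomial_le_pow binomial_eq_0)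
  finally show False using assms(6) by simp
qed

section \<open>Orientations and deletion of vertices\<close>

text \<open>The arc sets of orientations, described edge by edge so that restriction to a subgraph
  is immediate; \<open>bij_betw_iff_orients\<close> identifies them with the bijections of
  \<open>orientation\<close>.\<close>

definition orients :: "'a set set \<Rightarrow> ('a \<times> 'a) set set" where
  "orients E = {A. (\<forall>u v. (u, v) \<in> A \<longrightarrow> {u, v} \<in> E) \<and>
     (\<forall>u v. {u, v} \<in> E \<longrightarrow> ((u, v) \<in> A \<longleftrightarrow> (v, u) \<notin> A))}"

lemma orients_edge: "A \<in> orients E \<Longrightarrow> (u, v) \<in> A \<Longrightarrow> {u, v} \<in> E"
  by (simp add: orients_def)

lemma orients_iff: "A \<in> orients E \<Longrightarrow> {u, v} \<in> E \<Longrightarrow> (u, v) \<in> A \<longleftrightarrow> (v, u) \<notin> A"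
  by (simp add: orients_def)

lemma orients_asym: "A \<in> orients E \<Longrightarrow> (u, v) \<in> A \<Longrightarrow> (v, u) \<notin> A"
  using orients_edge orients_iff by metis

lemma orients_subset_Times: "A \<in> orients E \<Longrightarrow> simple_graph V E \<Longrightarrow> A \<subseteq> V \<times> V"
  by (auto dest!: orients_edge dest: simple_graph_edgeD)

lemma finite_orients:
  assumes "finite V" "simple_graph V E" shows "finite (orients E)"
proof (rule finite_subset)
  show "orients E \<subseteq> Pow (V \<times> V)" using orients_subset_Times[OF _ assms(2)] by blast
qed (use assms in auto)

text \<open>Encodes an orientation as a set of edges, relative to the linear order of the vertices.\<close>

definition ascents :: "('a::linorder \<times> 'a) set \<Rightarrow> 'a set set" where
  "ascents A = {{u, v} |u v. u < v \<and> (u, v) \<in> A}"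

lemma ascents_iff: "u < v \<Longrightarrow> {u, v} \<in> ascents A \<longleftrightarrow> (u, v) \<in> A"
  by (auto simp: ascents_def doubleton_eq_iff)

lemma ascents_subset: "A \<in> orients E \<Longrightarrow> ascents A \<subseteq> E"
  by (auto simp: ascents_def dest: orients_edge)

text \<open>An edge that is not an ascent is oriented downwards, so the ascents on T determine all
  arcs on T.\<close>

lemma orients_subset_if_ascents:
  assumes "simple_graph V E" "A \<in> orients E" "T \<subseteq> E" "B \<in> orients T" "ascents A \<inter> T = ascents B"
  shows "B \<subseteq> A"
proof (rule subrelI)
  fix u v assume uv: "(u, v) \<in> B"
  then have T: "{u, v} \<in> T" "{v, u} \<in> T" using orients_edge[OF assms(4)] by (auto simp: insert_commute)
  then have E: "{u, v} \<in> E" using assms(3) by auto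
  then have "u \<noteq> v" using simple_graph_edgeD[OF assms(1)] by blast
  then consider "u < v" | "v < u" by fastforce
  then show "(u, v) \<in> A"
  proof cases
    case 1
    then show ?thesis using ascents_iff[OF 1] uv assms(5) by blast
  next
    case 2
    have "(v, u) \<notin> B" using orients_asym[OF assms(4) uv] .
    then have "(v, u) \<notin> A" using ascents_iff[OF 2] T assms(5) by blast
    then show ?thesis using orients_iff[OF assms(2) E] by simp
  qed
qed

lemma inj_on_ascents:
  assumes "simple_graph V E" shows "inj_on ascents (orients E)"
proof (rule inj_onI)
  fix A B :: "('a \<times> 'a) set" assume AB: "A \<in> orients E" "B \<in> orients E" "ascents A = ascents B"
  have "ascents A \<inter> E = ascents B" "ascents B \<inter> E = ascents A"
    using AB(3) ascents_subset[OF AB(1)] ascents_subset[OF AB(2)] by auto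
  then show "A = B"
    using orients_subset_if_ascents[OF assms AB(1) order_refl AB(2)]
      orients_subset_if_ascents[OF assms AB(2) order_refl AB(1)] by auto
qed

lemma orients_extend:
  fixes G :: "('a::linorder \<times> 'a) set"
  assumes "simple_graph V T" "\<And>u v. (u, v) \<in> G \<Longrightarrow> {u, v} \<in> T" "\<And>u v. (u, v) \<in> G \<Longrightarrow> (v, u) \<notin> G"
  shows "\<exists>B\<in>orients T. G \<subseteq> B"
proof -
  \<comment> \<open>Edges that G leaves undirected are oriented upwards in the linear order.\<close>
  define B where "B = {(u, v). {u, v} \<in> T \<and> ((u, v) \<in> G \<or> (v, u) \<notin> G \<and> u < v)}"
  have "(u, v) \<in> B \<longleftrightarrow> (v, u) \<notin> B" if T: "{u, v} \<in> T" for u v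
  proof -
    have "u \<noteq> v" using simple_graph_edgeD[OF assms(1) T] by blast
    moreover have "{v, u} \<in> T" using T by (simp add: insert_commute)
    ultimately show ?thesis using T assms(3) by (auto simp: B_def)
  qed
  then have "B \<in> orients T" by (auto simp: orients_def B_def)
  moreover have "G \<subseteq> B" using assms by (auto simp: B_def)
  ultimately show ?thesis by blast
qed

lemma card_orients:
  fixes V :: "'a::linorder set"
  assumes "finite V" "simple_graph V E"
  shows "card (orients E) = 2 ^ card E"
proof -
  have "bij_betw ascents (orients E) (Pow E)"
    unfolding bij_betw_def
  proof (intro conjI inj_on_ascents[OF assms(2)] equalityI subsetI)
    fix U assume "U \<in> ascents ` orients E" then show "U \<in> Pow E" using ascents_subset by auto
  next
    fix U assume U: "U \<in> Pow E"
    define A where "A = {(u, v). {u, v} \<in> E \<and> (u < v \<longleftrightarrow> {u, v} \<in> U)}"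
    have "(u, v) \<in> A \<longleftrightarrow> (v, u) \<notin> A" if E: "{u, v} \<in> E" for u v
    proof -
      have "u \<noteq> v" using simple_graph_edgeD[OF assms(2) E] by blast
      then have "u < v \<longleftrightarrow> \<not> v < u" by auto
      then show ?thesis using E by (auto simp: A_def insert_commute[of v u])
    qed
    then have A: "A \<in> orients E" by (auto simp: orients_def A_def)
    have "ascents A = U"
    proof (intro equalityI subsetI)
      fix e assume "e \<in> ascents A" then show "e \<in> U" by (auto simp: ascents_def A_def)
    next
      fix e assume e: "e \<in> U"
      then have "e \<in> E" using U by auto
      then obtain u v where uv: "e = {u, v}" "u \<noteq> v" by (rule simple_graph_edgeE[OF assms(2)])
      have "u < v \<or> v < u" using uv by auto
      then show "e \<in> ascents A"
      proof
        assume "u < v"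
        then have "(u, v) \<in> A" using e \<open>e \<in> E\<close> uv by (simp add: A_def)
        then show ?thesis using ascents_iff[OF \<open>u < v\<close>] uv by simp
      next
        assume "v < u"
        then have "(v, u) \<in> A" using e \<open>e \<in> E\<close> uv by (simp add: A_def insert_commute)
        then show ?thesis using ascents_iff[OF \<open>v < u\<close>] uv by (simp add: insert_commute)
      qed
    qed
    then show "U \<in> ascents ` orients E" using A by blast
  qed
  then show ?thesis
    using bij_betw_same_card card_Pow simple_graph_finite[OF assms] by metis
qed

text \<open>The observation of Kozma and Moran: the Sauer--Shelah lemma for the family of all \<open>ascents A\<close>.\<close>

lemma card_orientations_le_card_realised:
  fixes V :: "'a::linorder set"
  assumes "finite V" "simple_graph V E" "\<A> \<subseteq> orients E"
  shows "card \<A> \<le> card {T. T \<subseteq> E \<and> (\<forall>B\<in>orients T. \<exists>A\<in>\<A>. B \<subseteq> A)}"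
proof -
  have finE: "finite E" using simple_graph_finite[OF assms(1,2)] .
  have "card \<A> = card (ascents ` \<A>)"
    using inj_on_ascents[OF assms(2)] assms(3) by (metis card_image inj_on_subset)
  also have "\<dots> \<le> card {T. T \<subseteq> E \<and> shattered_by (ascents ` \<A>) T}"
    using assms(3) ascents_subset by (intro card_le_card_shattered finE) blast
  also have "\<dots> \<le> card {T. T \<subseteq> E \<and> (\<forall>B\<in>orients T. \<exists>A\<in>\<A>. B \<subseteq> A)}"
  proof (intro card_mono)
    show "finite {T. T \<subseteq> E \<and> (\<forall>B\<in>orients T. \<exists>A\<in>\<A>. B \<subseteq> A)}" using finE by simp
    have "\<exists>A\<in>\<A>. B \<subseteq> A" if T: "T \<subseteq> E" "shattered_by (ascents ` \<A>) T" "B \<in> orients T" for T B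
    proof -
      obtain A where "A \<in> \<A>" "ascents A \<inter> T = ascents B"
        using shattered_byD[OF T(2) ascents_subset[OF T(3)]] by blast
      then show ?thesis
        using orients_subset_if_ascents[OF assms(2) _ T(1) T(3)] assms(3) by blast
    qed
    then show "{T. T \<subseteq> E \<and> shattered_by (ascents ` \<A>) T} \<subseteq> {T. T \<subseteq> E \<and> (\<forall>B\<in>orients T. \<exists>A\<in>\<A>. B \<subseteq> A)}"
      by blast
  qed
  finally show ?thesis .
qed

section \<open>Directed paths and cycles\<close>

definition has_cycle :: "nat \<Rightarrow> ('a \<times> 'a) set \<Rightarrow> bool" where
  "has_cycle L A \<longleftrightarrow> (\<exists>f. inj_on f {..<L} \<and> (\<forall>i<L. (f i, f (Suc i mod L)) \<in> A))"

text \<open>Here \<open>n\<close> counts vertices: the path runs from \<open>g 0\<close> to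
  \<open>g (n - 1)\<close> and has one arc fewer. A cycle of length 2k + 1 thus arises from 2k path
  vertices and one further vertex, or from 2k - 1 path vertices and one further edge.\<close>

definition dipath :: "('a \<times> 'a) set \<Rightarrow> nat \<Rightarrow> (nat \<Rightarrow> 'a) \<Rightarrow> bool" where
  "dipath A n g \<longleftrightarrow> inj_on g {..<n} \<and> (\<forall>l. Suc l < n \<longrightarrow> (g l, g (Suc l)) \<in> A)"

lemma dipath_snoc:
  assumes "dipath A n g" "n > 0" "w \<notin> g ` {..<n}" "(g (n - 1), w) \<in> A"
  shows "dipath A (Suc n) (g(n := w))"
  unfolding dipath_def
proof (intro conjI allI impI)
  show "inj_on (g(n := w)) {..<Suc n}"
    using assms by (auto simp: dipath_def inj_on_def less_Suc_eq)
  fix l assume l: "Suc l < Suc n"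
  show "((g(n := w)) l, (g(n := w)) (Suc l)) \<in> A"
  proof (cases "Suc l = n")
    case True
    then have "l = n - 1" by simp
    then show ?thesis using True assms(4) by auto
  next
    case False
    then show ?thesis using l assms(1) by (auto simp: dipath_def)
  qed
qed

lemma has_cycle_if_dipath:
  assumes "dipath A n g" "n > 0" "(g (n - 1), g 0) \<in> A"
  shows "has_cycle n A"
  unfolding has_cycle_def
proof (intro exI conjI allI impI)
  show "inj_on g {..<n}" using assms by (simp add: dipath_def)
  fix i assume i: "i < n"
  show "(g i, g (Suc i mod n)) \<in> A"
  proof (cases "Suc i = n")
    case True
    then have "i = n - 1" by simp
    then show ?thesis using True assms(3) by auto
  next
    case False
    then show ?thesis using i assms(1) by (auto simp: dipath_def)
  qed
qed

lemma has_cycle_through_vertex: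
  assumes "dipath A n g" "n > 0" "w \<notin> g ` {..<n}" "(g (n - 1), w) \<in> A" "(w, g 0) \<in> A"
  shows "has_cycle (Suc n) A"
  using has_cycle_if_dipath[OF dipath_snoc[OF assms(1-4)]] assms(2,5) by simp

lemma has_cycle_through_edge:
  assumes "dipath A n g" "n > 0" "u \<notin> g ` {..<n}" "v \<notin> g ` {..<n}" "u \<noteq> v"
    "(g (n - 1), u) \<in> A" "(u, v) \<in> A" "(v, g 0) \<in> A"
  shows "has_cycle (Suc (Suc n)) A"
proof (rule has_cycle_through_vertex[OF dipath_snoc])
  show "v \<notin> (g(n := u)) ` {..<Suc n}" using assms(4,5) by (auto simp: less_Suc_eq)
qed (use assms in auto)

definition free_orients :: "nat \<Rightarrow> 'a set set \<Rightarrow> ('a \<times> 'a) set set" where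
  "free_orients L E = {A\<in>orients E. \<not> has_cycle L A}"

lemma free_orients_subset: "free_orients L E \<subseteq> orients E"
  by (auto simp: free_orients_def)

lemma finite_free_orients: "finite V \<Longrightarrow> simple_graph V E \<Longrightarrow> finite (free_orients L E)"
  using finite_orients free_orients_subset finite_subset by metis

section \<open>Counting orientations over a deleted vertex set\<close>

definition del :: "'a set set \<Rightarrow> 'a set \<Rightarrow> 'a set set" where
  "del E S = {e\<in>E. e \<inter> S = {}}"

lemma simple_graph_del: "simple_graph V E \<Longrightarrow> simple_graph (V - S) (del E S)"
  by (auto simp: simple_graph_def del_def)

lemma has_cycle_mono: "has_cycle L A \<Longrightarrow> A \<subseteq> B \<Longrightarrow> has_cycle L B"
  unfolding has_cycle_def by blast

lemma free_orients_restrict: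
  assumes "A \<in> free_orients L E" shows "A \<inter> ((- S) \<times> - S) \<in> free_orients L (del E S)"
proof -
  have A: "A \<in> orients E" "\<not> has_cycle L A" using assms by (auto simp: free_orients_def)
  have "A \<inter> ((- S) \<times> - S) \<in> orients (del E S)"
    using A(1) by (auto simp: orients_def del_def)
  moreover have "\<not> has_cycle L (A \<inter> ((- S) \<times> - S))" using has_cycle_mono[of L _ A] A(2) by blast
  ultimately show ?thesis by (simp add: free_orients_def)
qed

text \<open>Between S and its complement the arcs in one direction determine those in the other, as
  both sets orient the same edges; hence the disjunction in the last hypothesis.\<close>

lemma orients_eqI:
  assumes "A \<in> orients E" "B \<in> orients E"
    "A \<inter> ((- S) \<times> - S) = B \<inter> ((- S) \<times> - S)" "A \<inter> (S \<times> S) = B \<inter> (S \<times> S)"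
    "A \<inter> ((- S) \<times> S) = B \<inter> ((- S) \<times> S) \<or> A \<inter> (S \<times> - S) = B \<inter> (S \<times> - S)"
  shows "A = B"
proof -
  have *: "(u, v) \<in> B"
    if "A \<in> orients E" "B \<in> orients E"
    "A \<inter> ((- S) \<times> - S) = B \<inter> ((- S) \<times> - S)" "A \<inter> (S \<times> S) = B \<inter> (S \<times> S)"
    "A \<inter> ((- S) \<times> S) = B \<inter> ((- S) \<times> S) \<or> A \<inter> (S \<times> - S) = B \<inter> (S \<times> - S)" "(u, v) \<in> A" for u v A B
  proof (cases "(u \<in> S \<longleftrightarrow> v \<in> S)")
    case True then show ?thesis using that by blast
  next
    case False
    have E: "{u, v} \<in> E" using that orients_edge by metis
    have "(v, u) \<notin> A" using that orients_asym by metis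
    then have "(v, u) \<in> B \<Longrightarrow> (u, v) \<in> B" using that(5,6) False by blast
    then show ?thesis using orients_iff[OF that(2) E] by blast
  qed
  show ?thesis using *[OF assms] *[OF assms(2,1)] assms(3-5) by (metis subrelI subset_antisym)
qed

text \<open>Restriction to the complement of S maps into the free orientations of the smaller graph.
  Within a fibre an orientation is determined by its arcs with tail in S, so M bounds the number of
  ways to reattach S to a fixed \<tau>.\<close>

lemma card_le_by_deletion:
  assumes "finite V" "simple_graph V E" "\<A> \<subseteq> free_orients L E"
    "\<And>\<tau>. card ((\<lambda>A. A \<inter> (S \<times> UNIV)) ` {A\<in>\<A>. A \<inter> ((- S) \<times> - S) = \<tau>}) \<le> M"
  shows "card \<A> \<le> M * card (free_orients L (del E S))"
proof (rule card_le_fibres[where f = "\<lambda>A. A \<inter> ((- S) \<times> - S)"])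
  show "finite \<A>" using finite_free_orients[OF assms(1,2)] assms(3) finite_subset by metis
  show "finite (free_orients L (del E S))"
    using finite_free_orients[OF _ simple_graph_del[OF assms(2)]] assms(1) by blast
  show "(\<lambda>A. A \<inter> ((- S) \<times> - S)) ` \<A> \<subseteq> free_orients L (del E S)"
    using free_orients_restrict assms(3) by blast
  fix \<tau>
  have "inj_on (\<lambda>A. A \<inter> (S \<times> UNIV)) {A\<in>\<A>. A \<inter> ((- S) \<times> - S) = \<tau>}"
  proof (rule inj_onI)
    fix A B assume "A \<in> {A\<in>\<A>. A \<inter> ((- S) \<times> - S) = \<tau>}" "B \<in> {A\<in>\<A>. A \<inter> ((- S) \<times> - S) = \<tau>}"
      and eq: "A \<inter> (S \<times> UNIV) = B \<inter> (S \<times> UNIV)"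
    then have "A \<in> orients E" "B \<in> orients E" "A \<inter> ((- S) \<times> - S) = B \<inter> ((- S) \<times> - S)"
      using assms(3) free_orients_subset[of L E] by auto
    moreover have "A \<inter> (S \<times> S) = B \<inter> (S \<times> S)" "A \<inter> (S \<times> - S) = B \<inter> (S \<times> - S)" using eq by blast+
    ultimately show "A = B" using orients_eqI by metis
  qed
  from card_image[OF this] show "card {A\<in>\<A>. A \<inter> ((- S) \<times> - S) = \<tau>} \<le> M" using assms(4)[of \<tau>] by simp
qed

text \<open>An orientation in a fibre is determined by its arcs inside S, for which the crude factor
  2^(|S|^2) is allowed, and by the tuple of its arcs from each block into S. The bounds for the
  blocks therefore multiply.\<close>

lemma card_le_by_block_deletion:
  assumes V: "finite V" "simple_graph V E" "\<A> \<subseteq> free_orients L E" "S \<subseteq> V" "\<Union>\<B> = V - S"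
    and c: "\<And>\<tau> B. B \<in> \<B> \<Longrightarrow> card ((\<lambda>A. A \<inter> (B \<times> S)) ` {A\<in>\<A>. A \<inter> ((- S) \<times> - S) = \<tau>}) \<le> c B"
  shows "card \<A> \<le> 2 ^ (card S * card S) * prod c \<B> * card (free_orients L (del E S))"
proof (rule card_le_fibres[where f = "\<lambda>A. A \<inter> ((- S) \<times> - S)"])
  show finA: "finite \<A>" using finite_free_orients[OF V(1,2)] V(3) finite_subset by metis
  show "finite (free_orients L (del E S))"
    using finite_free_orients[OF _ simple_graph_del[OF V(2)]] V(1) by blast
  show "(\<lambda>A. A \<inter> ((- S) \<times> - S)) ` \<A> \<subseteq> free_orients L (del E S)"
    using free_orients_restrict V(3) by blast
  fix \<tau>
  define X where "X = {A\<in>\<A>. A \<inter> ((- S) \<times> - S) = \<tau>}"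
  have finS: "finite S" using V finite_subset by metis
  have finB: "finite \<B>" using V by (metis finite_Diff finite_UnionD)
  define h where "h A = (A \<inter> (S \<times> S), restrict (\<lambda>B. A \<inter> (B \<times> S)) \<B>)" for A
  define Z where "Z = Pow (S \<times> S) \<times> PiE \<B> (\<lambda>B. (\<lambda>A. A \<inter> (B \<times> S)) ` X)"
  have finX: "finite X" using finA by (simp add: X_def)
  have "card X \<le> card Z"
  proof (rule card_inj_on_le)
    show "h ` X \<subseteq> Z" by (auto simp: h_def Z_def)
    show "finite Z" unfolding Z_def using finS finB finX by (intro finite_cartesian_product finite_PiE) auto
    show "inj_on h X"
    proof (rule inj_onI)
      fix A B assume A: "A \<in> X" and B: "B \<in> X" and eq: "h A = h B"
      have AB: "A \<in> orients E" "B \<in> orients E" "A \<inter> ((- S) \<times> - S) = B \<inter> ((- S) \<times> - S)"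
        using A B V(3) free_orients_subset[of L E] by (auto simp: X_def)
      have 1: "A \<inter> (S \<times> S) = B \<inter> (S \<times> S)" using eq by (simp add: h_def)
      have 2: "A \<inter> (W \<times> S) = B \<inter> (W \<times> S)" if "W \<in> \<B>" for W
        using eq that by (metis (no_types, lifting) h_def Pair_inject restrict_apply')
      have 3: "C \<inter> ((- S) \<times> S) = (\<Union>W\<in>\<B>. C \<inter> (W \<times> S))" if "C \<in> orients E" for C
        using orients_subset_Times[OF that V(2)] V(5) by blast
      have "A \<inter> ((- S) \<times> S) = B \<inter> ((- S) \<times> S)" unfolding 3[OF AB(1)] 3[OF AB(2)] using 2 by simp
      then show "A = B" using orients_eqI[OF AB 1] by blast
    qed
  qed
  also have "card Z = 2 ^ (card S * card S) * (\<Prod>B\<in>\<B>. card ((\<lambda>A. A \<inter> (B \<times> S)) ` X))"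
    unfolding Z_def using finS finB by (simp add: card_cartesian_product card_Pow card_PiE)
  also have "\<dots> \<le> 2 ^ (card S * card S) * prod c \<B>"
    unfolding X_def using c by (intro mult_le_mono2 prod_mono) auto
  finally show "card {A\<in>\<A>. A \<inter> ((- S) \<times> - S) = \<tau>} \<le> 2 ^ (card S * card S) * prod c \<B>"
    by (simp add: X_def)
qed

section \<open>Blow-ups of the directed 4-cycle\<close>

text \<open>A blow-up of the directed 4-cycle with parts \<open>P 0, \<dots>, P 3\<close>; values of \<open>P\<close> beyond 3 are irrelevant.\<close>

definition gadget :: "nat \<Rightarrow> (nat \<Rightarrow> 'a set) \<Rightarrow> ('a \<times> 'a) set \<Rightarrow> bool" where
  "gadget m P A \<longleftrightarrow> (\<forall>i<4. finite (P i) \<and> card (P i) = m) \<and> (\<forall>i<4. \<forall>j<4. i \<noteq> j \<longrightarrow> P i \<inter> P j = {}) \<and>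
     (\<forall>i<4. P i \<times> P (Suc i mod 4) \<subseteq> A)"

lemma less_4_cases: "(i::nat) < 4 \<Longrightarrow> i = 0 \<or> i = 1 \<or> i = 2 \<or> i = 3"
  by linarith

lemma all_less_4: "(\<forall>i<4. Q i) \<longleftrightarrow> Q 0 \<and> Q 1 \<and> Q 2 \<and> Q (3::nat)"
  by (auto dest: less_4_cases)

text \<open>Halving both sides of a biclique gives four parts, which can be oriented cyclically
  since consecutive parts lie on opposite sides. An orientation that realises this would contain a
  gadget.\<close>

lemma realised_has_no_biclique:
  fixes V :: "'a::linorder set"
  assumes "finite V" "simple_graph V T"
    and real: "\<forall>B\<in>orients T. \<exists>A\<in>{A\<in>\<A>. \<nexists>P. gadget m P A}. B \<subseteq> A"
  shows "\<not> has_biclique (2 * m) T"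
proof
  assume "has_biclique (2 * m) T"
  then obtain L R where LR: "finite L" "finite R" "card L = 2 * m" "card R = 2 * m"
    "\<And>u v. u \<in> L \<Longrightarrow> v \<in> R \<Longrightarrow> {u, v} \<in> T" by (auto simp: has_biclique_def)
  have disj: "L \<inter> R = {}" using LR(5) simple_graph_edgeD[OF assms(2)] by fastforce
  obtain L0 where L0: "L0 \<subseteq> L" "card L0 = m"
    using obtain_subset_with_card_n[of m L] LR(3) by auto
  obtain R0 where R0: "R0 \<subseteq> R" "card R0 = m"
    using obtain_subset_with_card_n[of m R] LR(4) by auto
  define P where "P i = (if i = 0 then L0 else if i = 1 then R0 else if i = 2 then L - L0 else R - R0)"
    for i :: nat
  have P: "P 0 = L0" "P 1 = R0" "P (Suc 0) = R0" "P 2 = L - L0" "P 3 = R - R0" by (simp_all add: P_def)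
  define G where "G = (\<Union>i<4. P i \<times> P (Suc i mod 4))"
  have G: "G = L0 \<times> R0 \<union> R0 \<times> (L - L0) \<union> (L - L0) \<times> (R - R0) \<union> (R - R0) \<times> L0"
  proof -
    have "{..<4::nat} = {0, 1, 2, 3}" by auto
    then show ?thesis by (simp add: G_def P numeral_2_eq_2[symmetric] Un_assoc)
  qed
  have "\<exists>B\<in>orients T. G \<subseteq> B"
  proof (rule orients_extend[OF assms(2)])
    fix u v assume "(u, v) \<in> G"
    then have "u \<in> L \<and> v \<in> R \<or> v \<in> L \<and> u \<in> R" using L0 R0 by (auto simp: G)
    then show "{u, v} \<in> T" using LR(5)[of u v] LR(5)[of v u] by (metis insert_commute)
    show "(v, u) \<notin> G" using \<open>(u, v) \<in> G\<close> disj L0 R0 unfolding G by blast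
  qed
  then obtain B where B: "B \<in> orients T" "G \<subseteq> B" by metis
  obtain A where "A \<in> {A\<in>\<A>. \<nexists>P. gadget m P A}" "B \<subseteq> A" using bspec[OF real B(1)] by metis
  then have A: "\<nexists>P. gadget m P A" "G \<subseteq> A" using B(2) by simp_all
  have fin: "finite L0" "finite R0" using LR L0 R0 finite_subset by metis+
  have cards: "card (L - L0) = m" "card (R - R0) = m"
    using LR L0 R0 fin by (simp_all add: card_Diff_subset)
  have "gadget m P A"
    unfolding gadget_def
  proof (intro conjI)
    show "\<forall>i<4. finite (P i) \<and> card (P i) = m"
      unfolding all_less_4 using P fin cards LR L0 R0 by auto
    show "\<forall>i<4. \<forall>j<4. i \<noteq> j \<longrightarrow> P i \<inter> P j = {}"
      unfolding all_less_4 using P disj L0 R0 by auto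
    show "\<forall>i<4. P i \<times> P (Suc i mod 4) \<subseteq> A" using A(2) unfolding G_def by blast
  qed
  then show False using A(1) by blast
qed

text \<open>By the shattering bound it suffices to count the realised edge sets. These are free of
  bicliques, hence have at most 2nj \<le> n^2/1000 edges by the numerical condition on j, and the
  small-subset bound applies to a ground set of at most n^2 edges.\<close>

lemma card_orients_without_gadget_le:
  fixes V :: "'a::linorder set"
  assumes V: "finite V" "card V = n" "simple_graph V E" "n > 0"
    and j: "2000 * j \<le> n" "2 * m * n ^ (2 * m) < j * (j choose (2 * m))"
  shows "real (card {A\<in>orients E. \<nexists>P. gadget m P A}) \<le> 2 powr (real (n ^ 2) / 32)"
proof -
  have finE: "finite E" using simple_graph_finite V by blast
  have "card E \<le> (\<Sum>v\<in>V. card (neighbours E v))" by (rule card_edges_le_sum_degrees[OF V(1,3)])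
  also have "\<dots> \<le> (\<Sum>v\<in>V. n)"
    using V neighbours_subset[OF V(3)] by (intro sum_mono) (metis Diff_subset card_mono subset_trans)
  finally have cardE: "card E \<le> n ^ 2" using V by (simp add: power2_eq_square)
  let ?X = "{T. T \<subseteq> E \<and> (\<forall>B\<in>orients T. \<exists>A\<in>{A\<in>orients E. \<nexists>P. gadget m P A}. B \<subseteq> A)}"
  have "card {A\<in>orients E. \<nexists>P. gadget m P A} \<le> card ?X"
    by (rule card_orientations_le_card_realised[OF V(1,3)]) auto
  also have "\<dots> \<le> card {T. T \<subseteq> E \<and> card T \<le> 2 * n * j}"
  proof (rule card_mono)
    show "finite {T. T \<subseteq> E \<and> card T \<le> 2 * n * j}" using finE by simp
    have "card T \<le> 2 * n * j" if T: "T \<in> ?X" for T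
    proof -
      have s: "simple_graph V T" using T simple_graph_mono[OF V(3)] by blast
      have "\<not> has_biclique (2 * m) T"
        by (rule realised_has_no_biclique[OF V(1) s]) (use T in blast)
      then show ?thesis
        using has_biclique_if_many_edges[OF V(1,2) s V(4) _ j(2)] by linarith
    qed
    then show "?X \<subseteq> {T. T \<subseteq> E \<and> card T \<le> 2 * n * j}" by blast
  qed
  finally have "real (card {A\<in>orients E. \<nexists>P. gadget m P A}) \<le> real (card {T. T \<subseteq> E \<and> card T \<le> 2 * n * j})"
    by simp
  also have "\<dots> \<le> 2 powr (real (n ^ 2) / 32)"
  proof (rule card_small_subsets_le[OF finE cardE])
    have "2000 * j * n \<le> n * n" using j(1) by simp
    then show "1000 * (2 * n * j) \<le> n\<^sup>2" by (simp add: power2_eq_square algebra_simps)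
  qed
  finally show ?thesis .
qed

section \<open>Directed paths inside a gadget\<close>

lemma mod_4_shift: "((i::nat) + l) mod 4 = (i + l') mod 4 \<Longrightarrow> l mod 4 = l' mod 4"
  by (metis cong_add_lcancel_nat cong_def)

text \<open>Step l visits vertex number \<open>l div 4\<close> of the part
  \<open>(i + l) mod 4\<close>: every lap round the four parts uses a fresh vertex of each, so m
  laps with 4m vertices are possible.\<close>

lemma gadget_dipath:
  fixes i :: nat
  assumes gad: "gadget m P A" and e: "\<And>r. r < 4 \<Longrightarrow> bij_betw (e r) {..<m} (P r)" and n: "n \<le> 4 * m"
  defines "g \<equiv> \<lambda>l. e ((i + l) mod 4) (l div 4)"
  shows "dipath A n g" "\<And>l. l < n \<Longrightarrow> g l \<in> P ((i + l) mod 4)"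
proof -
  show *: "g l \<in> P ((i + l) mod 4)" if "l < n" for l
  proof -
    have "l div 4 < m" using that n by linarith
    then show ?thesis using bij_betwE[OF e, of "(i + l) mod 4"] by (simp add: g_def)
  qed
  show "dipath A n g"
    unfolding dipath_def
  proof (intro conjI allI impI)
    show "inj_on g {..<n}"
    proof (rule inj_onI)
      fix l l' assume l: "l \<in> {..<n}" "l' \<in> {..<n}" and eq: "g l = g l'"
      have "(i + l) mod 4 = (i + l') mod 4"
      proof (rule ccontr)
        assume "(i + l) mod 4 \<noteq> (i + l') mod 4"
        then have "P ((i + l) mod 4) \<inter> P ((i + l') mod 4) = {}" using gad by (simp add: gadget_def)
        then show False using *[of l] *[of l'] l eq by auto
      qed
      moreover from this have "l div 4 = l' div 4"
        using eq e[of "(i + l) mod 4"] l n by (auto simp: g_def bij_betw_def inj_on_def)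
      ultimately show "l = l'" using mod_4_shift[of i l l'] by (metis div_mult_mod_eq)
    qed
    fix l assume l: "Suc l < n"
    have "P ((i + l) mod 4) \<times> P (Suc ((i + l) mod 4) mod 4) \<subseteq> A" using gad by (auto simp: gadget_def)
    moreover have "Suc ((i + l) mod 4) mod 4 = (i + Suc l) mod 4" by (simp add: mod_Suc_eq)
    ultimately show "(g l, g (Suc l)) \<in> A" using *[of l] *[of "Suc l"] l by auto
  qed
qed

lemma obtain_enumeration_with:
  assumes "finite X" "card X = m" "x \<in> X" "c < m"
  obtains e where "bij_betw e {..<m} X" "e c = x"
proof -
  have "card ({..<m} - {c}) = card (X - {x})" using assms by simp
  then obtain e where e: "bij_betw e ({..<m} - {c}) (X - {x})"
    using finite_same_card_bij[of "{..<m} - {c}" "X - {x}"] assms(1) by auto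
  have "bij_betw (e(c := x)) ({..<m} - {c}) (X - {x})" using e by (subst bij_betw_cong[where g = e]) auto
  moreover have "bij_betw (e(c := x)) {c} {x}" by (auto simp: bij_betw_def)
  ultimately have "bij_betw (e(c := x)) (({..<m} - {c}) \<union> {c}) ((X - {x}) \<union> {x})"
    by (rule bij_betw_combine) auto
  moreover have "({..<m} - {c}) \<union> {c} = {..<m}" "(X - {x}) \<union> {x} = X" using assms by auto
  ultimately show ?thesis using that[of "e(c := x)"] by simp
qed

text \<open>For even n the number of arcs is odd, so the two ends lie in different parts and their
  enumerations can be prescribed independently: a comes first in its part, and b takes position
  \<open>(n - 1) div 4\<close> in the other.\<close>

lemma gadget_dipath_between:
  assumes gad: "gadget m P A" and n: "even n" "n \<ge> 2" "n \<le> 4 * m" and i: "i < 4" "a \<in> P i" "b \<in> P ((i + n - 1) mod 4)"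
  obtains g where "dipath A n g" "g 0 = a" "g (n - 1) = b" "\<And>l. l < n \<Longrightarrow> g l \<in> (\<Union>r<4. P r)"
proof -
  have fin: "finite (P r)" "card (P r) = m" if "r < 4" for r using gad that by (auto simp: gadget_def)
  define r where "r = (i + n - 1) mod 4"
  have "r \<noteq> i"
  proof
    assume "r = i"
    then have "(i + (n - 1)) mod 4 = (i + 0) mod 4" using n i by (simp add: r_def)
    then have "(n - 1) mod 4 = 0" using mod_4_shift[of i "n - 1" 0] by simp
    then have "even (n - 1)" by presburger
    then show False using n by simp
  qed
  moreover have "r < 4" by (simp add: r_def)
  ultimately have r: "r < 4" "r \<noteq> i" by auto
  obtain e1 where e1: "bij_betw e1 {..<m} (P i)" "e1 0 = a"
    using obtain_enumeration_with[OF fin[OF i(1)] i(2), of 0] n by auto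
  have "(n - 1) div 4 < m" using n by linarith
  then obtain e2 where e2: "bij_betw e2 {..<m} (P r)" "e2 ((n - 1) div 4) = b"
    using obtain_enumeration_with[OF fin[OF r(1)] i(3)[folded r_def]] by auto
  have "\<exists>e. bij_betw e {..<m} (P s)" if "s < 4" for s
    using fin[OF that] by (metis card_lessThan finite_lessThan finite_same_card_bij)
  then obtain e3 where e3: "\<And>s. s < 4 \<Longrightarrow> bij_betw (e3 s) {..<m} (P s)" by metis
  define e where "e = e3(i := e1, r := e2)"
  have e: "bij_betw (e s) {..<m} (P s)" if "s < 4" for s using e1 e2 e3 that by (auto simp: e_def)
  let ?g = "\<lambda>l. e ((i + l) mod 4) (l div 4)"
  have "?g 0 = a" using i e1 r by (simp add: e_def)
  moreover have "?g (n - 1) = b"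
  proof -
    have "(i + (n - 1)) mod 4 = r" using n by (simp add: r_def)
    then show ?thesis using e2 by (simp add: e_def)
  qed
  ultimately show thesis
  proof (rule that[rotated])
    show "dipath A n ?g" by (rule gadget_dipath[OF gad e n(3)])
    fix l assume "l < n"
    then have "?g l \<in> P ((i + l) mod 4)" using gadget_dipath(2)[OF gad e n(3)] by blast
    then show "?g l \<in> (\<Union>r<4. P r)" by (rule UN_I[rotated]) simp
  qed
qed

text \<open>An even number of arcs returns to the same side of the gadget. The ends are not
  prescribed, because the path is closed through vertices that are attached uniformly to a whole
  side.\<close>

lemma gadget_dipath_same_side:
  assumes gad: "gadget m P A" and n: "odd n" "n \<le> 4 * m" and i: "i < 4"
  obtains g where "dipath A n g" "g 0 \<in> P i" "g (n - 1) \<in> P i \<union> P ((i + 2) mod 4)" "\<And>l. l < n \<Longrightarrow> g l \<in> (\<Union>r<4. P r)"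
proof -
  have fin: "finite (P r)" "card (P r) = m" if "r < 4" for r using gad that by (auto simp: gadget_def)
  have "\<exists>e. bij_betw e {..<m} (P s)" if "s < 4" for s
    using fin[OF that] by (metis card_lessThan finite_lessThan finite_same_card_bij)
  then obtain e where e: "\<And>s. s < 4 \<Longrightarrow> bij_betw (e s) {..<m} (P s)" by metis
  define g where "g = (\<lambda>l. e ((i + l) mod 4) (l div 4))"
  have g: "dipath A n g" "\<And>l. l < n \<Longrightarrow> g l \<in> P ((i + l) mod 4)"
    unfolding g_def using gadget_dipath[OF gad e n(2), where i = i] by blast+
  obtain c where c: "n = 2 * c + 1" using n(1) by (rule oddE)
  then have n0: "n > 0" by simp
  have "2 * c mod 4 = 0 \<or> 2 * c mod 4 = 2" by presburger
  then have "(i + 2 * c mod 4) mod 4 = i mod 4 \<or> (i + 2 * c mod 4) mod 4 = (i + 2) mod 4" by auto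
  then have "(i + (n - 1)) mod 4 = i \<or> (i + (n - 1)) mod 4 = (i + 2) mod 4"
    using c i by (simp add: mod_add_right_eq)
  then have "g (n - 1) \<in> P i \<union> P ((i + 2) mod 4)" using g(2)[of "n - 1"] n0 by auto
  moreover have "g 0 \<in> P i" using g(2)[of 0] n0 i by simp
  moreover have "g l \<in> (\<Union>r<4. P r)" if "l < n" for l using g(2)[OF that] by auto
  ultimately show ?thesis using that g(1) by blast
qed

section \<open>Attaching outside vertices to a gadget\<close>

definition gadget_orients :: "nat \<Rightarrow> nat \<Rightarrow> (nat \<Rightarrow> 'a set) \<Rightarrow> 'a set set \<Rightarrow> ('a \<times> 'a) set set" where
  "gadget_orients L m P E = {A\<in>free_orients L E. gadget m P A}"

definition out_nbrs :: "('a \<times> 'a) set \<Rightarrow> 'a \<Rightarrow> 'a set \<Rightarrow> 'a set" where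
  "out_nbrs A w S = {s\<in>S. (w, s) \<in> A}"

text \<open>If w sends an arc to a in \<open>P i\<close> and receives one from b in the part 2k - 1
  steps further on, a path on 2k vertices from a to b closes a forbidden cycle through w. So one arc
  into \<open>P i\<close> forces all edges between w and that other part to leave w.\<close>

lemma gadget_closure:
  assumes A: "A \<in> gadget_orients (2 * k + 1) m P E" and k: "k \<ge> 1" "k \<le> m" and i: "i < 4"
    and w: "w \<notin> (\<Union>r<4. P r)" and ne: "out_nbrs A w (P i) \<noteq> {}"
  shows "out_nbrs A w (P ((i + 2 * k - 1) mod 4)) = neighbours E w \<inter> P ((i + 2 * k - 1) mod 4)"
proof (intro equalityI subsetI)
  have gad: "gadget m P A" and orient: "A \<in> orients E" and free: "\<not> has_cycle (2 * k + 1) A"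
    using A by (auto simp: gadget_orients_def free_orients_def)
  fix b assume "b \<in> out_nbrs A w (P ((i + 2 * k - 1) mod 4))"
  then show "b \<in> neighbours E w \<inter> P ((i + 2 * k - 1) mod 4)"
    using orients_edge[OF orient] by (auto simp: out_nbrs_def neighbours_def)
next
  have gad: "gadget m P A" and orient: "A \<in> orients E" and free: "\<not> has_cycle (2 * k + 1) A"
    using A by (auto simp: gadget_orients_def free_orients_def)
  fix b assume b: "b \<in> neighbours E w \<inter> P ((i + 2 * k - 1) mod 4)"
  obtain a where a: "a \<in> P i" "(w, a) \<in> A" using ne by (auto simp: out_nbrs_def)
  have "even (2 * k)" "2 * k \<ge> 2" "2 * k \<le> 4 * m" using k by auto
  then obtain g where g: "dipath A (2 * k) g" "g 0 = a" "g (2 * k - 1) = b" "\<And>l. l < 2 * k \<Longrightarrow> g l \<in> (\<Union>r<4. P r)"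
    using gadget_dipath_between[OF gad _ _ _ i a(1), of "2 * k" b] b by auto
  have "w \<notin> g ` {..<2 * k}" using g(4) w by (metis imageE lessThan_iff)
  then have "(b, w) \<notin> A"
    using has_cycle_through_vertex[OF g(1)] g(2,3) a k free by auto
  then have "(w, b) \<in> A" using orients_iff[OF orient, of w b] b by (simp add: neighbours_def)
  then show "b \<in> out_nbrs A w (P ((i + 2 * k - 1) mod 4))" using b by (simp add: out_nbrs_def)
qed

lemma card_arcs_image:
  "card ((\<lambda>A. A \<inter> ({w} \<times> S)) ` \<A>) = card ((\<lambda>A. out_nbrs A w S) ` \<A>)"
proof -
  have "(\<lambda>A. A \<inter> ({w} \<times> S)) ` \<A> = (\<lambda>U. {w} \<times> U) ` (\<lambda>A. out_nbrs A w S) ` \<A>"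
    by (auto simp: image_image out_nbrs_def intro!: image_cong)
  moreover have "inj_on (\<lambda>U. {w} \<times> U) ((\<lambda>A. out_nbrs A w S) ` \<A>)" by (auto simp: inj_on_def)
  ultimately show ?thesis by (simp add: card_image)
qed

lemma gadget_parts:
  assumes "gadget m P A"
  shows "\<And>i. i < 4 \<Longrightarrow> finite (P i)" "\<And>i. i < 4 \<Longrightarrow> card (P i) = m"
    "\<And>i j. i < 4 \<Longrightarrow> j < 4 \<Longrightarrow> i \<noteq> j \<Longrightarrow> P i \<inter> P j = {}"
  using assms by (auto simp: gadget_def)

abbreviation support :: "(nat \<Rightarrow> 'a set) \<Rightarrow> 'a set" where
  "support P \<equiv> \<Union>r<4. P r"

lemma support_eq: "support P = P 0 \<union> P 1 \<union> P 2 \<union> P 3"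
proof -
  have "{..<4::nat} = {0, 1, 2, 3}" by auto
  then show ?thesis by auto
qed

lemma card_support: "gadget m P A \<Longrightarrow> finite (support P) \<and> card (support P) = 4 * m"
  using gadget_parts[of m P A] by (subst card_UN_disjoint) auto

definition sides :: "(nat \<Rightarrow> 'a set) \<Rightarrow> 'a set set" where
  "sides P = {P 0 \<union> P 2, P 1 \<union> P 3}"

lemma card_side:
  assumes "gadget m P A" "X \<in> sides P" shows "finite X \<and> card X = 2 * m"
proof -
  have "P 0 \<inter> P 2 = {}" "P 1 \<inter> P 3 = {}" using gadget_parts(3)[OF assms(1)] by auto
  then show ?thesis
    using assms(2) gadget_parts(1,2)[OF assms(1)] by (auto simp: sides_def card_Un_disjoint)
qed

lemma side_subset_support: "X \<in> sides P \<Longrightarrow> X \<subseteq> support P"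
  unfolding support_eq sides_def by auto

text \<open>Call a part mixed if w sends arcs to some but not all of its neighbours there. As 2k - 1
  is 1 or 3 modulo 4, the closure property passes from each part to the next in one of the two
  cyclic directions. Two adjacent mixed parts contradict it at once. Two opposite mixed parts force
  both parts between them to contain no neighbour of w, against \<open>N\<close>.\<close>

lemma gadget_at_most_one_mixed:
  assumes A: "A \<in> gadget_orients (2 * k + 1) m P E" and k: "k \<ge> 1" "k \<le> m"
    and w: "w \<notin> support P"
    and N: "\<not> neighbours E w \<inter> support P \<subseteq> P 0 \<union> P 2" "\<not> neighbours E w \<inter> support P \<subseteq> P 1 \<union> P 3"
  shows "\<exists>r<4. \<forall>s<4. s \<noteq> r \<longrightarrow> out_nbrs A w (P s) = {} \<or> out_nbrs A w (P s) = neighbours E w \<inter> P s"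
proof -
  define U where "U r = out_nbrs A w (P r)" for r
  define M where "M r = neighbours E w \<inter> P r" for r
  have cl: "U ((i + 2 * k - 1) mod 4) = M ((i + 2 * k - 1) mod 4)" if "i < 4" "U i \<noteq> {}" for i
    using gadget_closure[OF A k that(1) w] that(2) by (simp add: U_def M_def)
  have "A \<in> orients E" using A by (simp add: gadget_orients_def free_orients_def)
  then have UM: "U r \<subseteq> M r" for r
    by (auto simp: U_def M_def out_nbrs_def neighbours_def dest: orients_edge)
  have M: "M 1 \<noteq> {} \<or> M 3 \<noteq> {}" "M 0 \<noteq> {} \<or> M 2 \<noteq> {}"
    using N unfolding M_def support_eq by auto
  have "(\<forall>i<4. U i \<noteq> {} \<longrightarrow> U ((i + 1) mod 4) = M ((i + 1) mod 4)) \<or>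
    (\<forall>i<4. U i \<noteq> {} \<longrightarrow> U ((i + 3) mod 4) = M ((i + 3) mod 4))"
  proof -
    obtain l where l: "k = Suc l" using k by (cases k) auto
    have "2 * l mod 4 = 0 \<or> 2 * l mod 4 = 2" by presburger
    then show ?thesis
    proof
      assume "2 * l mod 4 = 0"
      have "(i + 2 * k - 1) mod 4 = (i + 1) mod 4" for i
        using mod_add_right_eq[of "i + 1" "2 * l" 4] \<open>2 * l mod 4 = 0\<close> l by simp
      then show ?thesis using cl by metis
    next
      assume "2 * l mod 4 = 2"
      have "(i + 2 * k - 1) mod 4 = (i + 3) mod 4" for i
        using mod_add_right_eq[of "i + 1" "2 * l" 4] \<open>2 * l mod 4 = 2\<close> l by (simp add: add.commute)
      then show ?thesis using cl by metis
    qed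
  qed
  moreover have mods: "(0 + 1) mod 4 = (1::nat)" "(1 + 1) mod 4 = (2::nat)" "(2 + 1) mod 4 = (3::nat)" "(3 + 1) mod 4 = (0::nat)"
    "(0 + 3) mod 4 = (3::nat)" "(1 + 3) mod 4 = (0::nat)" "(2 + 3) mod 4 = (1::nat)" "(3 + 3) mod 4 = (2::nat)" by simp_all
  ultimately have "\<exists>r<4. \<forall>s<4. s \<noteq> r \<longrightarrow> U s = {} \<or> U s = M s"
  proof (elim disjE)
    assume *: "\<forall>i<4. U i \<noteq> {} \<longrightarrow> U ((i + 1) mod 4) = M ((i + 1) mod 4)"
    have "U 0 \<noteq> {} \<longrightarrow> U 1 = M 1" "U 1 \<noteq> {} \<longrightarrow> U 2 = M 2" "U 2 \<noteq> {} \<longrightarrow> U 3 = M 3" "U 3 \<noteq> {} \<longrightarrow> U 0 = M 0"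
      using *[unfolded all_less_4 mods] by blast+
    then have "(\<forall>s<4. s \<noteq> 0 \<longrightarrow> U s = {} \<or> U s = M s) \<or> (\<forall>s<4. s \<noteq> 1 \<longrightarrow> U s = {} \<or> U s = M s) \<or>
      (\<forall>s<4. s \<noteq> 2 \<longrightarrow> U s = {} \<or> U s = M s) \<or> (\<forall>s<4. s \<noteq> 3 \<longrightarrow> U s = {} \<or> U s = M s)"
      unfolding all_less_4 using M by (simp; metis)
    then show ?thesis by (metis numeral_less_iff one_less_numeral_iff semiring_norm(76,77,78,81) zero_less_numeral)
  next
    assume *: "\<forall>i<4. U i \<noteq> {} \<longrightarrow> U ((i + 3) mod 4) = M ((i + 3) mod 4)"
    have "U 0 \<noteq> {} \<longrightarrow> U 3 = M 3" "U 1 \<noteq> {} \<longrightarrow> U 0 = M 0" "U 2 \<noteq> {} \<longrightarrow> U 1 = M 1" "U 3 \<noteq> {} \<longrightarrow> U 2 = M 2"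
      using *[unfolded all_less_4 mods] by blast+
    then have "(\<forall>s<4. s \<noteq> 0 \<longrightarrow> U s = {} \<or> U s = M s) \<or> (\<forall>s<4. s \<noteq> 1 \<longrightarrow> U s = {} \<or> U s = M s) \<or>
      (\<forall>s<4. s \<noteq> 2 \<longrightarrow> U s = {} \<or> U s = M s) \<or> (\<forall>s<4. s \<noteq> 3 \<longrightarrow> U s = {} \<or> U s = M s)"
      unfolding all_less_4 using M by (simp; metis)
    then show ?thesis by (metis numeral_less_iff one_less_numeral_iff semiring_norm(76,77,78,81) zero_less_numeral)
  qed
  then show ?thesis by (simp add: U_def M_def)
qed

lemma out_nbrs_subset: "A \<in> orients E \<Longrightarrow> out_nbrs A w S \<subseteq> neighbours E w \<inter> S"
  by (auto simp: out_nbrs_def neighbours_def dest: orients_edge)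

text \<open>The exponent m + 6 counts 2 bits to choose the part r that may be mixed, 4 bits for the
  set b of parts where all edges leave w, and m bits for the out-neighbours inside
  \<open>P r\<close>.\<close>

lemma card_out_nbrs_both_sides:
  assumes gad: "gadget m P A\<^sub>0" and X: "X \<subseteq> gadget_orients (2 * k + 1) m P E" and k: "k \<ge> 1" "k \<le> m"
    and w: "w \<notin> support P"
    and N: "\<not> neighbours E w \<inter> support P \<subseteq> P 0 \<union> P 2" "\<not> neighbours E w \<inter> support P \<subseteq> P 1 \<union> P 3"
  shows "card ((\<lambda>A. out_nbrs A w (support P)) ` X) \<le> 2 ^ (m + 6)"
proof -
  note parts = gadget_parts[OF gad]
  define I where "I = (SIGMA r:{..<4::nat}. Pow {..<4::nat} \<times> Pow (P r))"
  define h where "h = (\<lambda>(r::nat, b, T). T \<union> (\<Union>s\<in>b. neighbours E w \<inter> P s))"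
  have finI: "finite I" unfolding I_def using parts by (intro finite_SigmaI finite_cartesian_product) auto
  have cardI: "card I = 2 ^ (m + 6)"
    unfolding I_def using parts
    by (subst card_SigmaI) (auto simp: card_cartesian_product card_Pow power_add)
  have "(\<lambda>A. out_nbrs A w (support P)) ` X \<subseteq> h ` I"
  proof (rule image_subsetI)
    fix A assume "A \<in> X"
    then have A: "A \<in> gadget_orients (2 * k + 1) m P E" using X by auto
    obtain r where r: "r < 4" "\<And>s. s < 4 \<Longrightarrow> s \<noteq> r \<Longrightarrow> out_nbrs A w (P s) = {} \<or> out_nbrs A w (P s) = neighbours E w \<inter> P s"
      using gadget_at_most_one_mixed[OF A k w N] by metis
    define b where "b = {s. s < 4 \<and> s \<noteq> r \<and> out_nbrs A w (P s) \<noteq> {}}"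
    have "out_nbrs A w (support P) = (\<Union>s<4. out_nbrs A w (P s))" by (auto simp: out_nbrs_def)
    also have "\<dots> = out_nbrs A w (P r) \<union> (\<Union>s\<in>b. out_nbrs A w (P s))" using r(1) by (auto simp: b_def)
    also have "(\<Union>s\<in>b. out_nbrs A w (P s)) = (\<Union>s\<in>b. neighbours E w \<inter> P s)"
      using r(2) by (intro SUP_cong) (auto simp: b_def)
    finally have "out_nbrs A w (support P) = h (r, b, out_nbrs A w (P r))" by (simp add: h_def)
    moreover have "(r, b, out_nbrs A w (P r)) \<in> I" using r(1) by (auto simp: I_def b_def out_nbrs_def)
    ultimately show "out_nbrs A w (support P) \<in> h ` I" by blast
  qed
  then show ?thesis using surj_card_le[OF finI] cardI by metis
qed

text \<open>If all neighbours lie on one side, the trivial bound 2^|N| is below 2^(2m) unless the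
  whole side is adjacent. Otherwise 2^(m + 6) applies, and \<open>m \<ge> 7\<close> makes this
  smaller than 2^(2m).\<close>

lemma card_out_nbrs:
  assumes gad: "gadget m P A\<^sub>0" and X: "X \<subseteq> gadget_orients (2 * k + 1) m P E" and k: "k \<ge> 1" "k \<le> m" "m \<ge> 7"
    and w: "w \<notin> support P"
  shows "card ((\<lambda>A. out_nbrs A w (support P)) ` X) \<le> 2 ^ (2 * m)"
    and "neighbours E w \<inter> support P \<notin> sides P \<Longrightarrow> card ((\<lambda>A. out_nbrs A w (support P)) ` X) \<le> 2 ^ (2 * m) - 1"
proof -
  let ?I = "(\<lambda>A. out_nbrs A w (support P)) ` X" and ?N = "neighbours E w \<inter> support P"
  have main: "card ?I \<le> 2 ^ (2 * m) \<and> (?N \<notin> sides P \<longrightarrow> card ?I \<le> 2 ^ (2 * m) - 1)"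
  proof (cases "\<exists>Y\<in>sides P. ?N \<subseteq> Y")
    case True
    then obtain Y where Y: "Y \<in> sides P" "?N \<subseteq> Y" by blast
    have cY: "finite Y" "card Y = 2 * m" using card_side[OF gad Y(1)] by auto
    have finN: "finite ?N" using Y cY finite_subset by metis
    have "?I \<subseteq> Pow ?N"
      using X out_nbrs_subset[of _ E] by (fastforce simp: gadget_orients_def free_orients_def)
    then have I: "card ?I \<le> 2 ^ card ?N" using finN by (metis card_Pow card_mono finite_Pow_iff)
    have "card ?N \<le> 2 * m" using card_mono[OF cY(1) Y(2)] cY by simp
    then have 1: "card ?I \<le> 2 ^ (2 * m)" using I by (meson le_trans one_le_numeral power_increasing)
    have "card ?I \<le> 2 ^ (2 * m) - 1" if "?N \<notin> sides P"
    proof -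
      have "?N \<subset> Y" using Y that by auto
      then have "card ?N < 2 * m" using psubset_card_mono[OF cY(1)] cY by simp
      then have "(2::nat) ^ card ?N < 2 ^ (2 * m)" by simp
      then show ?thesis using I by linarith
    qed
    then show ?thesis using 1 by simp
  next
    case False
    then have "\<not> ?N \<subseteq> P 0 \<union> P 2" "\<not> ?N \<subseteq> P 1 \<union> P 3" by (auto simp: sides_def)
    from card_out_nbrs_both_sides[OF gad X k(1,2) w this] have "card ?I \<le> 2 ^ (m + 6)" .
    also have "(2::nat) ^ (m + 6) < 2 ^ (2 * m)" using k by (intro power_strict_increasing) auto
    finally show ?thesis by linarith
  qed
  then show "card ?I \<le> 2 ^ (2 * m)" "?N \<notin> sides P \<Longrightarrow> card ?I \<le> 2 ^ (2 * m) - 1" by blast+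
qed

text \<open>For an arc from x to y the pattern in which y sends arcs to all of Y and x receives arcs
  from all of Y is impossible: a path on 2k - 1 vertices from Y to Y closes a forbidden cycle
  through x and y. This excludes one of the 2^(4m) patterns.\<close>

lemma card_arcs_of_edge:
  assumes gad: "gadget m P A\<^sub>0" and X: "X \<subseteq> gadget_orients (2 * k + 1) m P E" and k: "k \<ge> 1" "k \<le> m"
    and x: "x \<notin> support P" "y \<notin> support P" "x \<noteq> y"
    and side: "Y \<in> sides P" "neighbours E x \<inter> support P = Y" "neighbours E y \<inter> support P = Y"
    and arc: "\<And>A. A \<in> X \<Longrightarrow> (x, y) \<in> A"
  shows "card ((\<lambda>A. A \<inter> ({x, y} \<times> support P)) ` X) \<le> 2 ^ (4 * m) - 1"
proof -
  have "(0 + 2) mod 4 = (2::nat)" "(1 + 2) mod 4 = (3::nat)" by simp_all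
  then have "\<exists>i<4. Y = P i \<union> P ((i + 2) mod 4)"
    using side(1) unfolding sides_def by (metis insertE one_less_numeral_iff semiring_norm(76) singletonD zero_less_numeral)
  then obtain i where i: "i < 4" "Y = P i \<union> P ((i + 2) mod 4)" by metis
  have cY: "finite Y" "card Y = 2 * m" using card_side[OF gad side(1)] by auto
  have sub: "(\<lambda>A. A \<inter> ({x, y} \<times> support P)) ` X \<subseteq> Pow ({x, y} \<times> Y) - {{y} \<times> Y}"
  proof (rule image_subsetI)
    fix A assume AX: "A \<in> X"
    then have A: "gadget m P A" "A \<in> orients E" "\<not> has_cycle (2 * k + 1) A"
      using X by (auto simp: gadget_orients_def free_orients_def)
    have "A \<inter> ({x, y} \<times> support P) \<subseteq> {x, y} \<times> Y"
      using orients_edge[OF A(2)] side(2,3) by (fastforce simp: neighbours_def)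
    moreover have "A \<inter> ({x, y} \<times> support P) \<noteq> {y} \<times> Y"
    proof
      assume eq: "A \<inter> ({x, y} \<times> support P) = {y} \<times> Y"
      have yY: "(y, a) \<in> A" if "a \<in> Y" for a using eq that by auto
      have Yx: "(a, x) \<in> A" if "a \<in> Y" for a
      proof -
        have "a \<in> support P" using that side_subset_support[OF side(1)] by auto
        then have "(x, a) \<notin> A" using eq x(3) by auto
        moreover have "{x, a} \<in> E" using that side(2) by (auto simp: neighbours_def)
        ultimately show ?thesis using orients_iff[OF A(2), of x a] by simp
      qed
      have "odd (2 * k - 1)" "2 * k - 1 \<le> 4 * m" using k by auto
      then obtain g where g: "dipath A (2 * k - 1) g" "g 0 \<in> P i" "g (2 * k - 1 - 1) \<in> P i \<union> P ((i + 2) mod 4)"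
        "\<And>l. l < 2 * k - 1 \<Longrightarrow> g l \<in> support P"
        using gadget_dipath_same_side[OF A(1) _ _ i(1)] by metis
      have "x \<notin> g ` {..<2 * k - 1}" "y \<notin> g ` {..<2 * k - 1}" using g(4) x(1,2) by (metis imageE lessThan_iff)+
      then have "has_cycle (Suc (Suc (2 * k - 1))) A"
        using has_cycle_through_edge[OF g(1)] k x(3) Yx[of "g (2 * k - 1 - 1)"] yY[of "g 0"] arc[OF AX] g(2,3) i(2) by auto
      then show False using A(3) k by simp
    qed
    ultimately show "A \<inter> ({x, y} \<times> support P) \<in> Pow ({x, y} \<times> Y) - {{y} \<times> Y}" by blast
  qed
  have "card (Pow ({x, y} \<times> Y) - {{y} \<times> Y}) = card (Pow ({x, y} \<times> Y)) - 1"
    by (rule card_Diff_singleton) auto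
  also have "\<dots> = 2 ^ (4 * m) - 1"
    using cY x(3) by (simp add: card_Pow card_cartesian_product)
  finally have "card (Pow ({x, y} \<times> Y) - {{y} \<times> Y}) = 2 ^ (4 * m) - 1" .
  moreover have "finite (Pow ({x, y} \<times> Y) - {{y} \<times> Y})" using cY by simp
  ultimately show ?thesis using card_mono[OF _ sub] by metis
qed

text \<open>A bad block has strictly fewer than \<open>2\<^bsup>2m |B|\<^esup>\<close> ways to attach to the gadget.\<close>

definition bad_block :: "'a set \<Rightarrow> 'a set set \<Rightarrow> (nat \<Rightarrow> 'a set) \<Rightarrow> 'a set \<Rightarrow> bool" where
  "bad_block V E P B \<longleftrightarrow> B \<subseteq> V - support P \<and>
     ((\<exists>w. B = {w} \<and> neighbours E w \<inter> support P \<notin> sides P) \<or>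
      (\<exists>x y. B = {x, y} \<and> {x, y} \<in> E \<and> x \<noteq> y \<and> neighbours E x \<inter> support P \<in> sides P \<and>
          neighbours E y \<inter> support P = neighbours E x \<inter> support P))"

lemma card_arcs_bad_block:
  assumes gad: "gadget m P A\<^sub>0" and k: "k \<ge> 1" "k \<le> m" "m \<ge> 7" and bad: "bad_block V E P B"
  shows "card ((\<lambda>A. A \<inter> (B \<times> support P)) ` {A\<in>gadget_orients (2 * k + 1) m P E. A \<inter> ((- support P) \<times> - support P) = \<tau>})
      \<le> 2 ^ (2 * m * card B) - 1"
proof -
  let ?X = "{A\<in>gadget_orients (2 * k + 1) m P E. A \<inter> ((- support P) \<times> - support P) = \<tau>}"
  have X: "?X \<subseteq> gadget_orients (2 * k + 1) m P E" by blast
  have B: "B \<inter> support P = {}" using bad by (auto simp: bad_block_def)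
  from bad consider (vertex) w where "B = {w}" "neighbours E w \<inter> support P \<notin> sides P" |
    (edge) x y where "B = {x, y}" "{x, y} \<in> E" "x \<noteq> y" "neighbours E x \<inter> support P \<in> sides P"
      "neighbours E y \<inter> support P = neighbours E x \<inter> support P"
    unfolding bad_block_def by metis
  then show ?thesis
  proof cases
    case vertex
    have "w \<notin> support P" using vertex B by blast
    then show ?thesis
      using card_out_nbrs(2)[OF gad X k _ vertex(2)] vertex(1) by (simp add: card_arcs_image)
  next
    case edge
    have xy: "x \<notin> support P" "y \<notin> support P" using edge B by blast+
    have card: "2 * m * card B = 4 * m" using edge by simp
    show ?thesis
    \<comment> \<open>Both ends of the edge lie outside the gadget, so its direction is the same
      throughout the fibre of \<tau>.\<close>
    proof (cases "(x, y) \<in> \<tau>")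
      case True
      then have "(x, y) \<in> A" if "A \<in> ?X" for A using that by blast
      then show ?thesis
        unfolding card using card_arcs_of_edge[OF gad X k(1,2) xy edge(3,4) refl edge(5)] edge(1) by simp
    next
      case False
      have "(y, x) \<in> A" if "A \<in> ?X" for A
      proof -
        have "A \<in> orients E" using that by (auto simp: gadget_orients_def free_orients_def)
        moreover have "(x, y) \<notin> A" using that False xy by blast
        ultimately show ?thesis using orients_iff[OF _ edge(2)] by blast
      qed
      moreover have "B = {y, x}" using edge by auto
      ultimately show ?thesis
        unfolding card using card_arcs_of_edge[OF gad X k(1,2) xy(2,1) edge(3)[symmetric] edge(4,5) refl] by simp
    qed
  qed
qed

lemma card_bad_block: "bad_block V E P B \<Longrightarrow> card B \<in> {1, 2}"
  by (auto simp: bad_block_def)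

text \<open>Singletons complete the bad blocks to a partition of the vertices outside the gadget. A
  block B contributes 2^(2m|B|); a bad one contributes at least 1 less, a relative loss of at least
  2^(-4m) because |B| \<le> 2. The factor 2^(16 m^2) pays for the arcs inside the gadget.\<close>

lemma card_gadget_orients_le:
  assumes V: "finite V" "simple_graph V E" and gad: "gadget m P A\<^sub>0" "support P \<subseteq> V"
    and k: "k \<ge> 1" "k \<le> m" "m \<ge> 7"
    and bad: "\<And>B. B \<in> \<B> \<Longrightarrow> bad_block V E P B" and disj: "disjoint \<B>"
  shows "real (card (gadget_orients (2 * k + 1) m P E)) \<le>
    2 ^ (16 * m * m) * 2 ^ (2 * m * (card V - 4 * m)) * (1 - 1 / 2 ^ (4 * m)) ^ card \<B> *
    real (card (free_orients (2 * k + 1) (del E (support P))))"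
proof -
  let ?S = "support P" and ?G = "gadget_orients (2 * k + 1) m P E"
  define q :: real where "q = 1 - 1 / 2 ^ (4 * m)"
  have q: "0 \<le> q" by (simp add: q_def)
  have S: "finite ?S" "card ?S = 4 * m" using card_support[OF gad(1)] by auto
  have BV: "B \<subseteq> V - ?S" if "B \<in> \<B>" for B using bad[OF that] by (simp add: bad_block_def)
  define R where "R = (\<lambda>w. {w}) ` (V - ?S - \<Union>\<B>)"
  define \<C> where "\<C> = \<B> \<union> R"
  define c where "c B = (if B \<in> \<B> then 2 ^ (2 * m * card B) - 1 else 2 ^ (2 * m * card B) :: nat)" for B :: "'a set"
  have U: "\<Union>\<C> = V - ?S" using BV by (auto simp: \<C>_def R_def)
  have finC: "finite \<C>" using U V(1) by (metis finite_Diff finite_UnionD)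
  have disjC: "disjoint \<C>"
    using disj unfolding \<C>_def R_def disjoint_def by blast
  have "card ?G \<le> 2 ^ (card ?S * card ?S) * prod c \<C> * card (free_orients (2 * k + 1) (del E ?S))"
  proof (rule card_le_by_block_deletion[OF V _ gad(2) U])
    show "?G \<subseteq> free_orients (2 * k + 1) E" by (auto simp: gadget_orients_def)
    fix \<tau> B assume B: "B \<in> \<C>"
    show "card ((\<lambda>A. A \<inter> (B \<times> ?S)) ` {A\<in>?G. A \<inter> ((- ?S) \<times> - ?S) = \<tau>}) \<le> c B"
    proof (cases "B \<in> \<B>")
      case True
      then show ?thesis using card_arcs_bad_block[OF gad(1) k bad] by (simp add: c_def)
    next
      case False
      then obtain w where w: "B = {w}" "w \<notin> ?S" using B by (auto simp: \<C>_def R_def)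
      have X: "{A\<in>?G. A \<inter> ((- ?S) \<times> - ?S) = \<tau>} \<subseteq> ?G" by blast
      show ?thesis using card_out_nbrs(1)[OF gad(1) X k w(2)] False w(1) by (simp add: c_def card_arcs_image)
    qed
  qed
  then have "real (card ?G) \<le> real (2 ^ (card ?S * card ?S) * prod c \<C> * card (free_orients (2 * k + 1) (del E ?S)))"
    by (rule of_nat_mono)
  also have "\<dots> = 2 ^ (16 * m * m) * (\<Prod>B\<in>\<C>. real (c B)) * real (card (free_orients (2 * k + 1) (del E ?S)))"
    using S by (simp add: algebra_simps)
  also have "\<dots> \<le> 2 ^ (16 * m * m) * (2 ^ (2 * m * (card V - 4 * m)) * q ^ card \<B>) *
      real (card (free_orients (2 * k + 1) (del E ?S)))"
  proof (intro mult_right_mono mult_left_mono)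
    have "(\<Prod>B\<in>\<C>. real (c B)) \<le> (\<Prod>B\<in>\<C>. 2 ^ (2 * m * card B) * (if B \<in> \<B> then q else 1))"
    proof (intro prod_mono conjI)
      fix B assume "B \<in> \<C>"
      show "real (c B) \<le> 2 ^ (2 * m * card B) * (if B \<in> \<B> then q else 1)"
      proof (cases "B \<in> \<B>")
        case True
        have "2 * m * card B \<le> 4 * m" using card_bad_block[OF bad[OF True]] by auto
        then have "(2::real) ^ (2 * m * card B) \<le> 2 ^ (4 * m)" by (intro power_increasing) auto
        then have "2 ^ (2 * m * card B) * (1 / 2 ^ (4 * m)) \<le> (1::real)" by simp
        then show ?thesis using True by (simp add: c_def q_def of_nat_diff right_diff_distrib)
      qed (simp add: c_def)
    qed simp
    also have "\<dots> = (\<Prod>B\<in>\<C>. 2 ^ (2 * m * card B)) * (\<Prod>B\<in>\<C>. if B \<in> \<B> then q else 1)"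
      by (rule prod.distrib)
    also have "(\<Prod>B\<in>\<C>. if B \<in> \<B> then q else 1) = (\<Prod>B\<in>\<C> \<inter> \<B>. q)"
      using finC by (rule prod.inter_restrict[symmetric])
    also have "\<C> \<inter> \<B> = \<B>" by (auto simp: \<C>_def)
    also have "(\<Prod>B\<in>\<C>. (2::real) ^ (2 * m * card B)) = 2 ^ (\<Sum>B\<in>\<C>. 2 * m * card B)"
      by (simp add: power_sum)
    also have "(\<Sum>B\<in>\<C>. 2 * m * card B) = 2 * m * (card V - 4 * m)"
    proof -
      have "(\<Sum>B\<in>\<C>. card B) = card (\<Union>\<C>)"
        using disjC U V(1) by (intro card_Union_disjoint[symmetric]) (auto simp: disjoint_def pairwise_def disjnt_def intro: finite_subset)
      also have "\<dots> = card V - 4 * m" using U S gad(2) by (simp add: card_Diff_subset)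
      finally show ?thesis by (simp add: sum_distrib_left[symmetric])
    qed
    finally show "(\<Prod>B\<in>\<C>. real (c B)) \<le> 2 ^ (2 * m * (card V - 4 * m)) * q ^ card \<B>" by simp
  qed auto
  finally show ?thesis by (simp add: q_def algebra_simps)
qed

section \<open>Typical orientations of nearly bipartite graphs\<close>

text \<open>Pseudorandomness at scale p. Arcs in both directions are demanded because the paths
  built from it alternate between X and Y.\<close>

definition typical :: "nat \<Rightarrow> 'a set \<Rightarrow> 'a set \<Rightarrow> ('a \<times> 'a) set \<Rightarrow> bool" where
  "typical p X Y A \<longleftrightarrow> (\<forall>X'\<subseteq>X. \<forall>Y'\<subseteq>Y. p \<le> card X' \<longrightarrow> p \<le> card Y' \<longrightarrow>
     A \<inter> (X' \<times> Y') \<noteq> {} \<and> A \<inter> (Y' \<times> X') \<noteq> {})"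

lemma typical_commute: "typical p X Y A \<longleftrightarrow> typical p Y X A"
  unfolding typical_def by blast

definition edges_between :: "'a set set \<Rightarrow> 'a set \<Rightarrow> 'a set \<Rightarrow> 'a set set" where
  "edges_between E S T = {e\<in>E. \<exists>s\<in>S. \<exists>t\<in>T. e = {s, t}}"

lemma edges_between_commute: "edges_between E S T = edges_between E T S"
  unfolding edges_between_def by (auto simp: insert_commute)

text \<open>Every edge between S and T is forced to point from T to S, so such an orientation is
  determined by its restriction to the remaining edges.\<close>

lemma card_orients_no_arcs_le:
  fixes V :: "'a::linorder set"
  assumes V: "finite V" "simple_graph V E"
  shows "card {A\<in>orients E. A \<inter> (S \<times> T) = {}} \<le> 2 ^ (card E - card (edges_between E S T))"
proof -
  define F where "F = E - edges_between E S T"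
  have F: "simple_graph V F" using V(2) by (rule simple_graph_mono) (auto simp: F_def)
  define r where "r A = {(u, v)\<in>A. {u, v} \<in> F}" for A :: "('a \<times> 'a) set"
  have rF: "r A \<in> orients F" if "A \<in> orients E" for A
    unfolding orients_def
  proof (intro CollectI conjI allI impI)
    fix u v
    show "(u, v) \<in> r A \<Longrightarrow> {u, v} \<in> F" by (simp add: r_def)
    assume uv: "{u, v} \<in> F"
    then have "{v, u} \<in> F" "{u, v} \<in> E" by (simp_all add: insert_commute F_def)
    then show "(u, v) \<in> r A \<longleftrightarrow> (v, u) \<notin> r A" using uv orients_iff[OF that, of u v] by (simp add: r_def)
  qed
  have "card {A\<in>orients E. A \<inter> (S \<times> T) = {}} \<le> card (orients F)"
  proof (rule card_inj_on_le)
    show "finite (orients F)" using finite_orients[OF V(1) F] .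
    show "r ` {A\<in>orients E. A \<inter> (S \<times> T) = {}} \<subseteq> orients F" using rF by auto
    have sub: "A \<subseteq> B" if A: "A \<in> orients E" "A \<inter> (S \<times> T) = {}" and B: "B \<in> orients E" "B \<inter> (S \<times> T) = {}"
      and eq: "r A = r B" for A B
    proof (rule subrelI)
      fix u v assume uv: "(u, v) \<in> A"
      then have E: "{u, v} \<in> E" using orients_edge[OF A(1)] by simp
      show "(u, v) \<in> B"
      proof (cases "{u, v} \<in> F")
        case True
        then have "(u, v) \<in> r A" using uv by (simp add: r_def)
        then show ?thesis unfolding eq by (simp add: r_def)
      next
        case False
        then obtain s t where st: "s \<in> S" "t \<in> T" "{u, v} = {s, t}" using E by (auto simp: F_def edges_between_def)
        then have "u = s \<and> v = t \<or> u = t \<and> v = s" by (auto simp: doubleton_eq_iff)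
        then have "u = t" "v = s" using st A(2) uv by blast+
        then have "(v, u) \<notin> B" using st B(2) by blast
        then show ?thesis using orients_iff[OF B(1) E] by simp
      qed
    qed
    show "inj_on r {A\<in>orients E. A \<inter> (S \<times> T) = {}}"
    proof (rule inj_onI)
      fix A B assume "A \<in> {A\<in>orients E. A \<inter> (S \<times> T) = {}}" "B \<in> {A\<in>orients E. A \<inter> (S \<times> T) = {}}" "r A = r B"
      then show "A = B" using sub[of A B] sub[of B A] by auto
    qed
  qed
  also have "card (orients F) = 2 ^ card F" by (rule card_orients[OF V(1) F])
  also have "card F = card E - card (edges_between E S T)"
    unfolding F_def using simple_graph_finite[OF V] by (intro card_Diff_subset) (auto simp: edges_between_def)
  finally show ?thesis .
qed

lemma card_edges_between_ge:
  assumes V: "finite V" "simple_graph V E" and X: "X' \<subseteq> V" "Y' \<subseteq> V" "X' \<inter> Y' = {}"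
    and p: "p \<le> card X'" "p \<le> card Y'" and c: "\<And>x. x \<in> X' \<Longrightarrow> card (Y' - neighbours E x) \<le> c"
  shows "p * (p - c) \<le> card (edges_between E X' Y')"
proof -
  have fin: "finite X'" "finite Y'" using X V finite_subset by metis+
  have "p * (p - c) \<le> card X' * (p - c)" using p by simp
  also have "\<dots> = (\<Sum>x\<in>X'. p - c)" by simp
  also have "\<dots> \<le> (\<Sum>x\<in>X'. card (Y' \<inter> neighbours E x))"
  proof (rule sum_mono)
    fix x assume "x \<in> X'"
    have "card Y' = card (Y' \<inter> neighbours E x) + card (Y' - neighbours E x)"
      using fin by (metis card_Diff_subset_Int card_mono finite_Int inf_le1 le_add_diff_inverse)
    then show "p - c \<le> card (Y' \<inter> neighbours E x)" using c[OF \<open>x \<in> X'\<close>] p(2) by linarith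
  qed
  also have "\<dots> = card (SIGMA x:X'. Y' \<inter> neighbours E x)" using fin by simp
  also have "\<dots> \<le> card (edges_between E X' Y')"
  proof (rule card_inj_on_le)
    show "inj_on (\<lambda>(x, y). {x, y}) (SIGMA x:X'. Y' \<inter> neighbours E x)"
      using X(3) by (auto simp: inj_on_def doubleton_eq_iff)
    show "(\<lambda>(x, y). {x, y}) ` (SIGMA x:X'. Y' \<inter> neighbours E x) \<subseteq> edges_between E X' Y'"
      by (auto simp: edges_between_def neighbours_def)
    show "finite (edges_between E X' Y')" using simple_graph_finite[OF V] by (simp add: edges_between_def)
  qed
  finally show ?thesis .
qed

text \<open>A union bound over the pairs of subsets of X and Y and the two directions: each pair of
  large subsets spans at least p (p - c) edges, whose directions are then forced.\<close>

lemma card_atypical_le: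
  fixes V :: "'a::linorder set"
  assumes V: "finite V" "simple_graph V E" and X: "X \<subseteq> V" "Y \<subseteq> V" "X \<inter> Y = {}"
    and c: "\<And>x. x \<in> X \<Longrightarrow> card (Y - neighbours E x) \<le> c"
  shows "card {A\<in>orients E. \<not> typical p X Y A} \<le> 2 ^ (card X + card Y + 1) * 2 ^ (card E - p * (p - c))"
proof -
  have fin: "finite X" "finite Y" using X V finite_subset by metis+
  define I where "I = {X'. X' \<subseteq> X \<and> p \<le> card X'} \<times> {Y'. Y' \<subseteq> Y \<and> p \<le> card Y'}"
  have I: "finite I" "card I \<le> 2 ^ (card X + card Y)"
  proof -
    have sub: "I \<subseteq> Pow X \<times> Pow Y" by (auto simp: I_def)
    moreover have "finite (Pow X \<times> Pow Y)" using fin by simp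
    ultimately show "finite I" by (rule finite_subset)
    have "card I \<le> card (Pow X \<times> Pow Y)" using sub fin by (intro card_mono) auto
    then show "card I \<le> 2 ^ (card X + card Y)" using fin by (simp add: card_cartesian_product card_Pow power_add)
  qed
  define K where "K = (2::nat) ^ (card E - p * (p - c))"
  define D where "D S T = {A\<in>orients E. A \<inter> (S \<times> T) = {}}" for S T
  have D: "card (D X' Y') \<le> K \<and> card (D Y' X') \<le> K" if "(X', Y') \<in> I" for X' Y'
  proof -
    have "card (Y' - neighbours E x) \<le> c" if "x \<in> X'" for x
    proof -
      have "card (Y' - neighbours E x) \<le> card (Y - neighbours E x)"
        using \<open>(X', Y') \<in> I\<close> fin by (intro card_mono) (auto simp: I_def)
      also have "\<dots> \<le> c" using c \<open>(X', Y') \<in> I\<close> that by (auto simp: I_def)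
      finally show ?thesis .
    qed
    then have "p * (p - c) \<le> card (edges_between E X' Y')"
      using that X by (intro card_edges_between_ge[OF V]) (auto simp: I_def)
    then have "(2::nat) ^ (card E - card (edges_between E X' Y')) \<le> K"
      unfolding K_def by (intro power_increasing) auto
    then show ?thesis
      using card_orients_no_arcs_le[OF V, of X' Y'] card_orients_no_arcs_le[OF V, of Y' X']
      unfolding D_def edges_between_commute[of E Y' X'] by linarith
  qed
  have "{A\<in>orients E. \<not> typical p X Y A} \<subseteq> (\<Union>(X', Y')\<in>I. D X' Y' \<union> D Y' X')"
    unfolding typical_def I_def D_def by auto
  moreover have finD: "finite (D S T)" for S T using finite_orients[OF V] by (simp add: D_def)
  ultimately have "card {A\<in>orients E. \<not> typical p X Y A} \<le> card (\<Union>(X', Y')\<in>I. D X' Y' \<union> D Y' X')"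
    using I(1) by (intro card_mono) auto
  also have "\<dots> \<le> (\<Sum>i\<in>I. card (case i of (X', Y') \<Rightarrow> D X' Y' \<union> D Y' X'))"
    by (rule card_UN_le[OF I(1)])
  also have "\<dots> \<le> (\<Sum>i\<in>I. 2 * K)"
  proof (rule sum_mono)
    fix i assume i: "i \<in> I"
    obtain X' Y' where XY: "i = (X', Y')" by (cases i)
    have "card (D X' Y' \<union> D Y' X') \<le> card (D X' Y') + card (D Y' X')" by (rule card_Un_le)
    then show "card (case i of (X', Y') \<Rightarrow> D X' Y' \<union> D Y' X') \<le> 2 * K"
      using D[of X' Y'] i XY by simp
  qed
  also have "\<dots> \<le> 2 ^ (card X + card Y) * (2 * K)" using I(2) by simp
  finally show ?thesis by (simp add: K_def)
qed

text \<open>The part of layer i + 1 that is not reached receives no arc from the reached part of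
  layer i, hence has fewer than p vertices. Inner layers of size 2p thus keep at least p reached
  vertices, while p vertices suffice in the first and last layer. Disjointness of the layers makes
  the walk a path.\<close>

lemma layered_dipath:
  assumes L: "L \<ge> 1" and fin: "\<And>i. i \<le> L \<Longrightarrow> finite (W i)"
    and disj: "\<And>i j. i \<le> L \<Longrightarrow> j \<le> L \<Longrightarrow> i \<noteq> j \<Longrightarrow> W i \<inter> W j = {}"
    and big: "p \<le> card (W 0)" "p \<le> card (W L)" "\<And>i. 0 < i \<Longrightarrow> i < L \<Longrightarrow> 2 * p \<le> card (W i)"
    and arcs: "\<And>i S T. i < L \<Longrightarrow> S \<subseteq> W i \<Longrightarrow> T \<subseteq> W (Suc i) \<Longrightarrow> p \<le> card S \<Longrightarrow> p \<le> card T \<Longrightarrow> A \<inter> (S \<times> T) \<noteq> {}"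
  obtains g where "dipath A (Suc L) g" "\<And>i. i \<le> L \<Longrightarrow> g i \<in> W i"
proof -
  define R where "R i = {v. \<exists>g. (\<forall>j\<le>i. g j \<in> W j) \<and> (\<forall>j<i. (g j, g (Suc j)) \<in> A) \<and> g i = v}" for i
  have RW: "R i \<subseteq> W i" for i by (auto simp: R_def)
  have step: "v \<in> R (Suc i)" if u: "u \<in> R i" and v: "v \<in> W (Suc i)" "(u, v) \<in> A" for i u v
  proof -
    obtain g where g: "\<forall>j\<le>i. g j \<in> W j" "\<forall>j<i. (g j, g (Suc j)) \<in> A" "g i = u" using u by (auto simp: R_def)
    let ?h = "g(Suc i := v)"
    have "\<forall>j\<le>Suc i. ?h j \<in> W j" using g v by (auto simp: le_Suc_eq)
    moreover have "\<forall>j<Suc i. (?h j, ?h (Suc j)) \<in> A" using g v by (auto simp: less_Suc_eq)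
    ultimately show ?thesis unfolding R_def by (auto intro!: exI[of _ ?h])
  qed
  have R: "p \<le> card (R i)" if "i < L" for i
    using that
  proof (induction i)
    case 0
    have "R 0 = W 0" by (auto simp: R_def)
    then show ?case using big by simp
  next
    case (Suc i)
    have "card (W (Suc i) - R (Suc i)) < p"
    proof (rule ccontr)
      assume "\<not> card (W (Suc i) - R (Suc i)) < p"
      then have "A \<inter> (R i \<times> (W (Suc i) - R (Suc i))) \<noteq> {}"
        using Suc RW[of i] by (intro arcs[of i]) auto
      then show False using step by blast
    qed
    moreover have "card (W (Suc i)) = card (R (Suc i)) + card (W (Suc i) - R (Suc i))"
      using RW[of "Suc i"] fin[of "Suc i"] Suc.prems
      by (metis card_Diff_subset card_mono finite_subset le_add_diff_inverse less_imp_le)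
    ultimately show ?case using big(3)[of "Suc i"] Suc.prems by simp
  qed
  obtain l where l: "L = Suc l" using L by (cases L) auto
  have "A \<inter> (R l \<times> W L) \<noteq> {}"
    using l RW[of l] R[of l] big(2) arcs[of l "R l" "W L"] by auto
  then obtain v where "v \<in> R L" using step l by blast
  then obtain g where g: "\<forall>j\<le>L. g j \<in> W j" "\<forall>j<L. (g j, g (Suc j)) \<in> A" by (auto simp: R_def)
  have "inj_on g {..<Suc L}"
  proof (rule inj_onI)
    fix i j assume "i \<in> {..<Suc L}" "j \<in> {..<Suc L}" "g i = g j"
    then show "i = j" using g(1) disj[of i j] by (metis disjoint_iff less_Suc_eq_le lessThan_iff)
  qed
  then have "dipath A (Suc L) g" using g(2) by (simp add: dipath_def)
  then show ?thesis using that g(1) by blast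
qed

lemma obtain_disjoint_pieces:
  fixes X :: "'a set"
  assumes "finite X" "q * K \<le> card X"
  obtains U where "\<And>j::nat. j < K \<Longrightarrow> U j \<subseteq> X" "\<And>j. j < K \<Longrightarrow> card (U j) = q"
    "\<And>i j. i < K \<Longrightarrow> j < K \<Longrightarrow> i \<noteq> j \<Longrightarrow> U i \<inter> U j = {}"
proof -
  have "\<exists>U. (\<forall>j<K. U j \<subseteq> X \<and> card (U j) = q) \<and> (\<forall>i<K. \<forall>j<K. i \<noteq> j \<longrightarrow> U i \<inter> U j = {})"
    using assms
  proof (induction K arbitrary: X)
    case 0
    then show ?case by simp
  next
    case (Suc K)
    obtain T where T: "T \<subseteq> X" "card T = q"
      using obtain_subset_with_card_n[of q X] Suc.prems(2) by auto
    have "finite T" using T Suc.prems finite_subset by metis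
    then have "q * K \<le> card (X - T)" using T Suc.prems by (simp add: card_Diff_subset)
    from Suc.IH[OF _ this] Suc.prems(1)
    obtain U where "\<forall>j<K. U j \<subseteq> X - T \<and> card (U j) = q" "\<forall>i<K. \<forall>j<K. i \<noteq> j \<longrightarrow> U i \<inter> U j = {}"
      by (metis finite_Diff)
    then have U: "\<And>j. j < K \<Longrightarrow> U j \<subseteq> X - T \<and> card (U j) = q" "\<And>i j. i < K \<Longrightarrow> j < K \<Longrightarrow> i \<noteq> j \<Longrightarrow> U i \<inter> U j = {}"
      by simp_all
    have "\<forall>j<Suc K. (U(K := T)) j \<subseteq> X \<and> card ((U(K := T)) j) = q"
      using U(1) T by (auto simp: less_Suc_eq)
    moreover have "\<forall>i<Suc K. \<forall>j<Suc K. i \<noteq> j \<longrightarrow> (U(K := T)) i \<inter> (U(K := T)) j = {}"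
    proof (intro allI impI)
      fix i j assume "i < Suc K" "j < Suc K" "i \<noteq> j"
      then show "(U(K := T)) i \<inter> (U(K := T)) j = {}"
        using U(1)[of i] U(1)[of j] U(2)[of i j] by (auto simp: less_Suc_eq)
    qed
    ultimately show ?case by (intro exI[of _ "U(K := T)"] conjI)
  qed
  then show ?thesis using that by metis
qed

text \<open>The inner layers are pieces of size 2p taken alternately from Y and X, avoiding the two
  end sets (trimmed to p vertices each) and F, which is reserved for the vertices that close the
  cycle. Setting aside 2p + 2 vertices and cutting L + 1 pieces from each side explains the size
  condition.\<close>

lemma typical_dipath:
  assumes tpc: "typical p X Y A" and XY: "finite X" "finite Y" "X \<inter> Y = {}"
    and big: "2 * p * (L + 2) + 2 \<le> card X" "2 * p * (L + 2) + 2 \<le> card Y" and L: "L \<ge> 1"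
    and P: "P \<subseteq> X" "p \<le> card P" and Q: "Q \<subseteq> (if even L then X else Y)" "p \<le> card Q" "P \<inter> Q = {}"
    and F: "finite F" "card F \<le> 2" "P \<inter> F = {}" "Q \<inter> F = {}"
  obtains g where "dipath A (Suc L) g" "g 0 \<in> P" "g L \<in> Q" "g ` {..<Suc L} \<inter> F = {}"
proof -
  obtain P0 where P0: "P0 \<subseteq> P" "card P0 = p" using obtain_subset_with_card_n[OF P(2)] by metis
  obtain Q0 where Q0: "Q0 \<subseteq> Q" "card Q0 = p" using obtain_subset_with_card_n[OF Q(2)] by metis
  have "P0 \<subseteq> X" "Q0 \<subseteq> X \<union> Y" using P0 Q0 P Q by (auto split: if_splits)
  then have finPQ: "finite P0" "finite Q0" using XY(1,2) by (meson finite_UnI finite_subset)+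
  let ?D = "P0 \<union> Q0 \<union> F"
  have finD: "finite ?D" using finPQ F by simp
  have cardD: "card ?D \<le> 2 * p + 2"
    using card_Un_le[of "P0 \<union> Q0" F] card_Un_le[of P0 Q0] P0(2) Q0(2) F(2) by linarith
  have remain: "2 * p * (L + 1) \<le> card (C - ?D)" if "2 * p * (L + 2) + 2 \<le> card C" for C :: "'a set"
    using diff_card_le_card_Diff[OF finD, of C] cardD that by simp
  obtain U1 where U1: "\<And>j. j < L + 1 \<Longrightarrow> U1 j \<subseteq> X - ?D" "\<And>j. j < L + 1 \<Longrightarrow> card (U1 j) = 2 * p"
    "\<And>i j. i < L + 1 \<Longrightarrow> j < L + 1 \<Longrightarrow> i \<noteq> j \<Longrightarrow> U1 i \<inter> U1 j = {}"
    using obtain_disjoint_pieces[OF _ remain[OF big(1)]] XY(1) by (metis finite_Diff)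
  obtain U2 where U2: "\<And>j. j < L + 1 \<Longrightarrow> U2 j \<subseteq> Y - ?D" "\<And>j. j < L + 1 \<Longrightarrow> card (U2 j) = 2 * p"
    "\<And>i j. i < L + 1 \<Longrightarrow> j < L + 1 \<Longrightarrow> i \<noteq> j \<Longrightarrow> U2 i \<inter> U2 j = {}"
    using obtain_disjoint_pieces[OF _ remain[OF big(2)]] XY(2) by (metis finite_Diff)
  define W where "W i = (if i = 0 then P0 else if i = L then Q0 else if even i then U1 i else U2 i)" for i
  have side: "W i \<subseteq> (if even i then X else Y)" if "i \<le> L" for i
    using that P0 P Q0 Q U1(1)[of i] U2(1)[of i] by (auto simp: W_def split: if_splits)
  have "\<exists>g. dipath A (Suc L) g \<and> (\<forall>i\<le>L. g i \<in> W i)"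
  proof (rule layered_dipath[OF L])
    fix i assume i: "i \<le> L"
    show "finite (W i)" using side[OF i] XY finite_subset by (metis (full_types))
  next
    have mid: "W i \<inter> W j = {}" if "i \<le> L" "j \<le> L" "i < j" for i j
    proof (cases "even i = even j")
      case True
      then show ?thesis
        using that Q(3) P0 Q0 U1(1)[of i] U1(1)[of j] U2(1)[of i] U2(1)[of j] U1(3)[of i j] U2(3)[of i j] L
        by (auto simp: W_def)
    next
      case False
      then show ?thesis using side[OF that(1)] side[OF that(2)] XY(3) by (auto split: if_splits)
    qed
    fix i j assume "i \<le> L" "j \<le> L" "i \<noteq> j"
    then show "W i \<inter> W j = {}" using mid[of i j] mid[of j i] by (cases "i < j") auto
  next
    show "p \<le> card (W 0)" "p \<le> card (W L)" using P0 Q0 by (auto simp: W_def)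
    fix i assume "0 < i" "i < L"
    then show "2 * p \<le> card (W i)" using U1(2)[of i] U2(2)[of i] by (simp add: W_def)
  next
    fix i S T assume i: "i < L" and ST: "S \<subseteq> W i" "T \<subseteq> W (Suc i)" "p \<le> card S" "p \<le> card T"
    have "S \<subseteq> (if even i then X else Y)" "T \<subseteq> (if even (Suc i) then X else Y)"
      using side[of i] side[of "Suc i"] i ST by auto
    then show "A \<inter> (S \<times> T) \<noteq> {}"
      using tpc ST(3,4) unfolding typical_def by (cases "even i") auto
  qed blast
  then obtain g where g: "dipath A (Suc L) g" "\<And>i. i \<le> L \<Longrightarrow> g i \<in> W i" by blast
  have "W i \<inter> F = {}" if "i \<le> L" for i
    using that F P0 Q0 U1(1)[of i] U2(1)[of i] by (auto simp: W_def)
  then have "g ` {..<Suc L} \<inter> F = {}" using g(2) by (fastforce simp: less_Suc_eq_le)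
  moreover have "g 0 \<in> P" "g L \<in> Q" using g(2)[of 0] g(2)[of L] P0 Q0 L by (auto simp: W_def)
  ultimately show ?thesis using that g(1) by blast
qed

section \<open>Vertices and edges in typical orientations\<close>

definition in_nbrs :: "('a \<times> 'a) set \<Rightarrow> 'a \<Rightarrow> 'a set \<Rightarrow> 'a set" where
  "in_nbrs A w S = {s\<in>S. (s, w) \<in> A}"

lemma out_in_nbrs:
  assumes "A \<in> orients E"
  shows "out_nbrs A w S \<union> in_nbrs A w S = neighbours E w \<inter> S" "out_nbrs A w S \<inter> in_nbrs A w S = {}"
proof -
  have "{w, s} \<in> E \<longleftrightarrow> (w, s) \<in> A \<or> (s, w) \<in> A" for s
    using orients_edge[OF assms, of w s] orients_edge[OF assms, of s w] orients_iff[OF assms, of w s]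
    by (auto simp: insert_commute)
  then show "out_nbrs A w S \<union> in_nbrs A w S = neighbours E w \<inter> S"
    by (auto simp: out_nbrs_def in_nbrs_def neighbours_def)
  show "out_nbrs A w S \<inter> in_nbrs A w S = {}"
    using orients_asym[OF assms] by (auto simp: out_nbrs_def in_nbrs_def)
qed

text \<open>If both sets were large, a path of odd length 2k - 1 would lead from an out-neighbour of
  z in X to an in-neighbour in Y and close a forbidden cycle through z.\<close>

lemma typical_free_vertex:
  assumes A: "A \<in> free_orients (2 * k + 1) E" and k: "k \<ge> 1" and tpc: "typical p X Y A"
    and XY: "finite X" "finite Y" "X \<inter> Y = {}" "z \<notin> X" "z \<notin> Y"
    and big: "2 * p * (2 * k + 1) + 2 \<le> card X" "2 * p * (2 * k + 1) + 2 \<le> card Y"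
  shows "card (out_nbrs A z X) < p \<or> card (in_nbrs A z Y) < p"
proof (rule ccontr)
  assume "\<not> ?thesis"
  then have large: "p \<le> card (out_nbrs A z X)" "p \<le> card (in_nbrs A z Y)" by auto
  have L: "odd (2 * k - 1)" "2 * k - 1 + 2 = 2 * k + 1" "2 * k - 1 \<ge> 1" "Suc (2 * k - 1) = 2 * k" using k by auto
  obtain g where g: "dipath A (2 * k) g" "g 0 \<in> out_nbrs A z X" "g (2 * k - 1) \<in> in_nbrs A z Y" "g ` {..<2 * k} \<inter> {z} = {}"
  proof (rule typical_dipath[OF tpc XY(1-3) _ _ L(3), of "out_nbrs A z X" "in_nbrs A z Y" "{z}"])
    show "in_nbrs A z Y \<subseteq> (if even (2 * k - 1) then X else Y)" using L(1) by (auto simp: in_nbrs_def)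
  qed (use L large big XY in \<open>auto simp: out_nbrs_def in_nbrs_def\<close>)
  have "has_cycle (Suc (2 * k)) A"
    using has_cycle_through_vertex[OF g(1), of z] g(2-4) k by (auto simp: out_nbrs_def in_nbrs_def)
  then show False using A by (simp add: free_orients_def)
qed

text \<open>The vertex lemma applied in both orders of X and Y, together with at least 2p neighbours
  on each side, leaves two possibilities: fewer than p out-neighbours on both sides, or fewer than p
  in-neighbours on both sides. The edges from z to Z are free.\<close>

lemma card_typical_le_delete_vertex:
  assumes V: "finite V" "simple_graph V E" "V = X \<union> Y \<union> Z" and k: "k \<ge> 1"
    and XY: "X \<inter> Y = {}" "z \<notin> X" "z \<notin> Y"
    and big: "2 * p * (2 * k + 1) + 2 \<le> card X" "2 * p * (2 * k + 1) + 2 \<le> card Y"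
    and N: "2 * p \<le> card (neighbours E z \<inter> X)" "2 * p \<le> card (neighbours E z \<inter> Y)"
  shows "card {A\<in>free_orients (2 * k + 1) E. typical p X Y A} \<le>
    2 * (card {T. T \<subseteq> X \<and> card T \<le> p} * card {T. T \<subseteq> Y \<and> card T \<le> p} * 2 ^ card Z) *
      card (free_orients (2 * k + 1) (del E {z}))"
proof (rule card_le_by_deletion[OF V(1,2)])
  let ?A = "{A\<in>free_orients (2 * k + 1) E. typical p X Y A}"
  show "?A \<subseteq> free_orients (2 * k + 1) E" by blast
  fix \<tau>
  let ?X = "{A\<in>?A. A \<inter> ((- {z}) \<times> - {z}) = \<tau>}"
  have fin: "finite X" "finite Y" "finite Z" using V by auto
  define I where "I = {T. T \<subseteq> X \<and> card T \<le> p} \<times> {T. T \<subseteq> Y \<and> card T \<le> p} \<times> Pow Z"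
  have finI: "finite I" using fin by (simp add: I_def)
  \<comment> \<open>\<open>h1\<close> reassembles the out-neighbourhood from small pieces, and
    \<open>h2\<close> does so from the small in-neighbourhoods by complementing within X and
    Y.\<close>
  define h1 where "h1 = (\<lambda>(a::'a set, b, c). a \<union> b \<union> c)"
  define h2 where "h2 = (\<lambda>(a, b, c). (neighbours E z \<inter> X - a) \<union> (neighbours E z \<inter> Y - b) \<union> c)"
  have cover: "out_nbrs A z UNIV \<in> h1 ` I \<union> h2 ` I" if "A \<in> ?X" for A
  proof -
    have A: "A \<in> free_orients (2 * k + 1) E" "typical p X Y A" "A \<in> orients E"
      using that by (auto simp: free_orients_def)
    have split: "out_nbrs A z UNIV = out_nbrs A z X \<union> out_nbrs A z Y \<union> out_nbrs A z Z"
      using orients_subset_Times[OF A(3) V(2)] V(3) by (auto simp: out_nbrs_def)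
    have finO: "finite (out_nbrs A z S)" "finite (in_nbrs A z S)" if "finite S" for S
      using that by (simp_all add: out_nbrs_def in_nbrs_def)
    have sum: "card (out_nbrs A z S) + card (in_nbrs A z S) = card (neighbours E z \<inter> S)" if "finite S" for S
      using card_Un_disjoint[OF finO(1)[OF that] finO(2)[OF that] out_in_nbrs(2)[OF A(3)]] out_in_nbrs(1)[OF A(3), of z S] by simp
    have 1: "card (out_nbrs A z X) < p \<or> card (in_nbrs A z Y) < p"
      using typical_free_vertex[OF A(1) k A(2) fin(1,2) XY big] .
    have 2: "card (out_nbrs A z Y) < p \<or> card (in_nbrs A z X) < p"
      using typical_free_vertex[OF A(1) k A(2)[unfolded typical_commute[of p X]] fin(2,1) _ XY(3,2) big(2,1)] XY(1) by blast
    consider "card (out_nbrs A z X) \<le> p" "card (out_nbrs A z Y) \<le> p" |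
      "card (in_nbrs A z X) \<le> p" "card (in_nbrs A z Y) \<le> p"
      using 1 2 sum[OF fin(1)] sum[OF fin(2)] N by linarith
    then show ?thesis
    proof cases
      case 1
      have "(out_nbrs A z X, out_nbrs A z Y, out_nbrs A z Z) \<in> I"
        using 1 by (auto simp: I_def out_nbrs_def)
      then have "h1 (out_nbrs A z X, out_nbrs A z Y, out_nbrs A z Z) \<in> h1 ` I" by (rule imageI)
      then show ?thesis by (simp add: h1_def split)
    next
      case 2
      have "(in_nbrs A z X, in_nbrs A z Y, out_nbrs A z Z) \<in> I"
        using 2 by (auto simp: I_def out_nbrs_def in_nbrs_def)
      then have "h2 (in_nbrs A z X, in_nbrs A z Y, out_nbrs A z Z) \<in> h2 ` I" by (rule imageI)
      moreover have "neighbours E z \<inter> S - in_nbrs A z S = out_nbrs A z S" for S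
        using out_in_nbrs[OF A(3), of z S] by blast
      ultimately have "out_nbrs A z X \<union> out_nbrs A z Y \<union> out_nbrs A z Z \<in> h2 ` I" by (simp add: h2_def)
      then show ?thesis unfolding split by blast
    qed
  qed
  have "card ((\<lambda>A. A \<inter> ({z} \<times> UNIV)) ` ?X) = card ((\<lambda>A. out_nbrs A z UNIV) ` ?X)" by (rule card_arcs_image)
  also have "\<dots> \<le> card (h1 ` I \<union> h2 ` I)"
  proof (rule card_mono)
    show "finite (h1 ` I \<union> h2 ` I)" using finI by simp
    show "(\<lambda>A. out_nbrs A z UNIV) ` ?X \<subseteq> h1 ` I \<union> h2 ` I" using cover by (rule image_subsetI)
  qed
  also have "\<dots> \<le> card (h1 ` I) + card (h2 ` I)" by (rule card_Un_le)
  also have "\<dots> \<le> card I + card I" by (intro add_mono card_image_le finI)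
  also have "card I = card {T. T \<subseteq> X \<and> card T \<le> p} * card {T. T \<subseteq> Y \<and> card T \<le> p} * 2 ^ card Z"
    using fin by (simp add: I_def card_cartesian_product card_Pow)
  finally show "card ((\<lambda>A. A \<inter> ({z} \<times> UNIV)) ` ?X) \<le>
      2 * (card {T. T \<subseteq> X \<and> card T \<le> p} * card {T. T \<subseteq> Y \<and> card T \<le> p} * 2 ^ card Z)" by simp
qed

text \<open>The possible pairs (out-neighbours of \<open>v\<close>, in-neighbours of \<open>u\<close>) in \<open>Y\<close> for an arc \<open>u \<rightarrow> v\<close> outside \<open>Y\<close>: a
  directed path of length \<open>2k - 2\<close> from the first to the second closes a forbidden cycle, and for
  \<open>k = 1\<close> such a path is a common vertex.\<close>

definition compatible_pairs :: "nat \<Rightarrow> nat \<Rightarrow> 'a set \<Rightarrow> ('a set \<times> 'a set) set" where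
  "compatible_pairs k p Y = {(P, Q). P \<subseteq> Y \<and> Q \<subseteq> Y \<and> (if k = 1 then P \<inter> Q = {} else card P < 2 * p \<or> card Q < 2 * p)}"

lemma finite_compatible_pairs: "finite Y \<Longrightarrow> finite (compatible_pairs k p Y)"
  by (rule finite_subset[of _ "Pow Y \<times> Pow Y"]) (auto simp: compatible_pairs_def)

lemma typical_free_edge:
  assumes A: "A \<in> free_orients (2 * k + 1) E" and k: "k \<ge> 1" and tpc: "typical p X Y A"
    and XY: "finite X" "finite Y" "X \<inter> Y = {}" "u \<notin> Y" "v \<notin> Y" "u \<noteq> v" and uv: "(u, v) \<in> A"
    and big: "2 * p * (2 * k + 1) + 2 \<le> card X" "2 * p * (2 * k + 1) + 2 \<le> card Y"
  shows "(out_nbrs A v Y, in_nbrs A u Y) \<in> compatible_pairs k p Y"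
proof -
  have free: "\<not> has_cycle (2 * k + 1) A" using A by (simp add: free_orients_def)
  have sub: "out_nbrs A v Y \<subseteq> Y" "in_nbrs A u Y \<subseteq> Y" by (auto simp: out_nbrs_def in_nbrs_def)
  show ?thesis
  proof (cases "k = 1")
    case True
    have "out_nbrs A v Y \<inter> in_nbrs A u Y = {}"
    proof (rule ccontr)
      assume "out_nbrs A v Y \<inter> in_nbrs A u Y \<noteq> {}"
      then obtain a where a: "a \<in> Y" "(v, a) \<in> A" "(a, u) \<in> A" by (auto simp: out_nbrs_def in_nbrs_def)
      have "dipath A 1 (\<lambda>_. a)" by (simp add: dipath_def inj_on_def)
      then have "has_cycle (Suc (Suc 1)) A"
        by (rule has_cycle_through_edge[where u = u and v = v]) (use a uv XY in auto)
      then show False using free True by (simp add: numeral_3_eq_3)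
    qed
    then show ?thesis using sub True by (simp add: compatible_pairs_def)
  next
    case False
    have "card (out_nbrs A v Y) < 2 * p \<or> card (in_nbrs A u Y) < 2 * p"
    proof (rule ccontr)
      assume "\<not> ?thesis"
      then have large: "2 * p \<le> card (out_nbrs A v Y)" "2 * p \<le> card (in_nbrs A u Y)" by auto
      obtain P where P: "P \<subseteq> out_nbrs A v Y" "card P = p"
        using obtain_subset_with_card_n[of p "out_nbrs A v Y"] large by auto
      have finP: "finite P" using P sub XY(2) by (meson finite_subset)
      \<comment> \<open>A path of even length has both ends in Y. The threshold 2p rather than p
        leaves room for two disjoint end sets of size p, even if the two neighbourhoods
        coincide.\<close>
      define Q where "Q = in_nbrs A u Y - P"
      have Q: "Q \<subseteq> Y" "p \<le> card Q"
        using sub diff_card_le_card_Diff[OF finP, of "in_nbrs A u Y"] P(2) large by (auto simp: Q_def)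
      have L: "even (2 * k - 2)" "2 * k - 2 \<ge> 1" "Suc (2 * k - 2) = 2 * k - 1" using k False by auto
      have "2 * p * (2 * k - 2 + 2) \<le> 2 * p * (2 * k + 1)" using k by (intro mult_le_mono2) linarith
      then have big': "2 * p * (2 * k - 2 + 2) + 2 \<le> card X" "2 * p * (2 * k - 2 + 2) + 2 \<le> card Y" using big by linarith+
      have YX: "Y \<inter> X = {}" using XY(3) by blast
      obtain g where g: "dipath A (2 * k - 1) g" "g 0 \<in> P" "g (2 * k - 2) \<in> Q" "g ` {..<2 * k - 1} \<inter> {u, v} = {}"
      proof (rule typical_dipath[OF tpc[unfolded typical_commute[of p X]] XY(2,1) YX big'(2,1) L(2), of P Q "{u, v}"])
        show "Q \<subseteq> (if even (2 * k - 2) then Y else X)" using L Q by simp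
        show "P \<inter> Q = {}" by (auto simp: Q_def)
        show "P \<subseteq> Y" "p \<le> card P" using P sub by auto
        show "P \<inter> {u, v} = {}" "Q \<inter> {u, v} = {}" using P sub Q XY by auto
        show "card {u, v} \<le> 2" by (simp add: card_insert_if)
      qed (use L Q in auto)
      have "2 * k - 1 - 1 = 2 * k - 2" "2 * k - 1 > 0" using k by auto
      then have "has_cycle (Suc (Suc (2 * k - 1))) A"
        using has_cycle_through_edge[OF g(1), of u v] g(2-4) P uv XY(6) by (auto simp: Q_def out_nbrs_def in_nbrs_def)
      then show False using free k by simp
    qed
    then show ?thesis using sub False by (simp add: compatible_pairs_def)
  qed
qed

lemma card_typical_le_delete_edge:
  assumes V: "finite V" "simple_graph V E" "X \<subseteq> V" "Y \<subseteq> V" and k: "k \<ge> 1"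
    and XY: "X \<inter> Y = {}" "u \<notin> Y" "v \<notin> Y" "u \<noteq> v"
    and big: "2 * p * (2 * k + 1) + 2 \<le> card X" "2 * p * (2 * k + 1) + 2 \<le> card Y"
    and r: "card (neighbours E u - Y) \<le> r" "card (neighbours E v - Y) \<le> r"
  shows "card {A\<in>free_orients (2 * k + 1) E. typical p X Y A \<and> (u, v) \<in> A} \<le>
    card (compatible_pairs k p Y) * 2 ^ (2 * r) * card (free_orients (2 * k + 1) (del E {u, v}))"
proof (rule card_le_by_deletion[OF V(1,2)])
  let ?A = "{A\<in>free_orients (2 * k + 1) E. typical p X Y A \<and> (u, v) \<in> A}"
  show "?A \<subseteq> free_orients (2 * k + 1) E" by blast
  fix \<tau>
  let ?X = "{A\<in>?A. A \<inter> ((- {u, v}) \<times> - {u, v}) = \<tau>}"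
  have fin: "finite X" "finite Y" using V finite_subset by metis+
  have finN: "finite (neighbours E w)" for w
    using neighbours_subset[OF V(2)] V(1) by (meson finite_Diff finite_subset)
  define I where "I = compatible_pairs k p Y \<times> Pow (neighbours E u - Y) \<times> Pow (neighbours E v - Y)"
  have finI: "finite I" unfolding I_def using finN
    by (intro finite_cartesian_product finite_compatible_pairs fin) auto
  \<comment> \<open>The compatible pair records the in-neighbours of u, whereas the arcs to be
    encoded leave u; complementing within the neighbourhood of u in Y converts one into the
    other.\<close>
  define h where "h = (\<lambda>((P, Q), c, d). {u} \<times> ((neighbours E u \<inter> Y - Q) \<union> c) \<union> {v} \<times> (P \<union> d))"
  have "(\<lambda>A. A \<inter> ({u, v} \<times> UNIV)) ` ?X \<subseteq> h ` I"
  proof (rule image_subsetI)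
    fix A assume "A \<in> ?X"
    then have A: "A \<in> free_orients (2 * k + 1) E" "typical p X Y A" "(u, v) \<in> A" "A \<in> orients E"
      by (auto simp: free_orients_def)
    let ?i = "((out_nbrs A v Y, in_nbrs A u Y), out_nbrs A u (- Y), out_nbrs A v (- Y))"
    have "out_nbrs A w (- Y) \<subseteq> neighbours E w - Y" for w
      using orients_edge[OF A(4)] by (auto simp: out_nbrs_def neighbours_def)
    then have "?i \<in> I"
      using typical_free_edge[OF A(1) k A(2) fin XY A(3) big] by (simp add: I_def)
    moreover have "A \<inter> ({u, v} \<times> UNIV) = h ?i"
    proof -
      have "neighbours E u \<inter> Y - in_nbrs A u Y = out_nbrs A u Y" using out_in_nbrs[OF A(4), of u Y] by blast
      then show ?thesis by (auto simp: h_def out_nbrs_def)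
    qed
    ultimately show "A \<inter> ({u, v} \<times> UNIV) \<in> h ` I" by blast
  qed
  then have "card ((\<lambda>A. A \<inter> ({u, v} \<times> UNIV)) ` ?X) \<le> card I" by (rule surj_card_le[OF finI])
  also have "card I = card (compatible_pairs k p Y) * (2 ^ card (neighbours E u - Y) * 2 ^ card (neighbours E v - Y))"
    using finN by (simp add: I_def card_cartesian_product card_Pow)
  also have "\<dots> = card (compatible_pairs k p Y) * 2 ^ (card (neighbours E u - Y) + card (neighbours E v - Y))"
    by (simp add: power_add)
  also have "\<dots> \<le> card (compatible_pairs k p Y) * 2 ^ (2 * r)"
    using r by (intro mult_le_mono2 power_increasing) auto
  finally show "card ((\<lambda>A. A \<inter> ({u, v} \<times> UNIV)) ` ?X) \<le> card (compatible_pairs k p Y) * 2 ^ (2 * r)" .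
qed

text \<open>A pair of disjoint subsets amounts to a colouring of Y with three colours.\<close>

lemma card_compatible_pairs_1:
  assumes "finite Y" shows "card (compatible_pairs 1 p Y) \<le> 3 ^ card Y"
proof -
  define h where "h = (\<lambda>(P, Q). restrict (\<lambda>y. if y \<in> P then 0 else if y \<in> Q then 1 else 2 :: nat) Y)"
  have "card (compatible_pairs 1 p Y) \<le> card (PiE Y (\<lambda>_. {0, 1, 2::nat}))"
  proof (rule card_inj_on_le[where f = h])
    show "finite (PiE Y (\<lambda>_. {0, 1, 2::nat}))" using assms by (intro finite_PiE) auto
    show "h ` compatible_pairs 1 p Y \<subseteq> PiE Y (\<lambda>_. {0, 1, 2::nat})"
      by (rule image_subsetI) (simp add: h_def split: prod.split)
    have eq: "P = {y\<in>Y. h (P, Q) y = 0}" "Q = {y\<in>Y. h (P, Q) y = 1}" if "(P, Q) \<in> compatible_pairs 1 p Y" for P Q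
      using that by (auto simp: h_def compatible_pairs_def)
    show "inj_on h (compatible_pairs 1 p Y)"
    proof (rule inj_onI, clarify)
      fix P Q P' Q' assume *: "(P, Q) \<in> compatible_pairs 1 p Y" "(P', Q') \<in> compatible_pairs 1 p Y" "h (P, Q) = h (P', Q')"
      show "P = P' \<and> Q = Q'" using eq[OF *(1)] eq[OF *(2)] unfolding *(3) by simp
    qed
  qed
  also have "\<dots> = 3 ^ card Y" using assms by (simp add: card_PiE numeral_3_eq_3)
  finally show ?thesis .
qed

lemma card_compatible_pairs_neq_1:
  assumes "finite Y" "k \<noteq> 1"
  shows "card (compatible_pairs k p Y) \<le> 2 * (card {T. T \<subseteq> Y \<and> card T \<le> 2 * p} * 2 ^ card Y)"
proof -
  let ?S = "{T. T \<subseteq> Y \<and> card T \<le> 2 * p}"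
  have "compatible_pairs k p Y \<subseteq> ?S \<times> Pow Y \<union> Pow Y \<times> ?S"
    using assms(2) by (auto simp: compatible_pairs_def)
  then have "card (compatible_pairs k p Y) \<le> card (?S \<times> Pow Y \<union> Pow Y \<times> ?S)"
    using assms(1) by (intro card_mono) auto
  also have "\<dots> \<le> card (?S \<times> Pow Y) + card (Pow Y \<times> ?S)" by (rule card_Un_le)
  also have "\<dots> = 2 * (card ?S * 2 ^ card Y)"
    using assms(1) by (simp add: card_cartesian_product card_Pow)
  finally show ?thesis .
qed

section \<open>The deletion step\<close>

text \<open>Cross-multiplied form, over the naturals, of the statement that deleting S at least
  doubles the ratio of the number of free orientations to 2^F(n).\<close>

definition reducible :: "nat \<Rightarrow> nat \<Rightarrow> 'a set \<Rightarrow> 'a set set \<Rightarrow> bool" where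
  "reducible L J V E \<longleftrightarrow> (\<exists>S\<subseteq>V. S \<noteq> {} \<and> card S \<le> J \<and>
     2 * card (free_orients L E) * 2 ^ ((card V - card S)\<^sup>2 div 4) \<le>
       2 ^ ((card V)\<^sup>2 div 4) * card (free_orients L (del E S)))"

lemma reducible_mono: "reducible L J V E \<Longrightarrow> J \<le> J' \<Longrightarrow> reducible L J' V E"
  unfolding reducible_def by (meson le_trans)

text \<open>This and the next two lemmas give the deletion budgets: floor(n/2) bits for one vertex,
  n - 1 bits for two, and at least 2m(n - 4m) bits for the 4m vertices of a gadget.\<close>

lemma square_div_4_diff_1: "n \<ge> 1 \<Longrightarrow> n\<^sup>2 div 4 = (n - 1)\<^sup>2 div 4 + n div (2::nat)"
proof -
  assume "n \<ge> 1"
  then obtain l where n: "n = Suc l" by (cases n) auto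
  show ?thesis
  proof (cases "even l")
    case True
    then obtain j where "l = 2 * j" by blast
    then have "n\<^sup>2 = 1 + 4 * (j * j + j)" "(n - 1)\<^sup>2 = 4 * (j * j)" "n = 2 * j + 1"
      using n by (auto simp: power2_eq_square algebra_simps)
    then show ?thesis by simp
  next
    case False
    then obtain j where "l = 2 * j + 1" by (elim oddE)
    then have "n\<^sup>2 = 4 * (j * j + 2 * j + 1)" "(n - 1)\<^sup>2 = 1 + 4 * (j * j + j)" "n = 2 * j + 2"
      using n by (auto simp: power2_eq_square algebra_simps)
    then show ?thesis by simp
  qed
qed

lemma square_div_4_diff_2: "n \<ge> 2 \<Longrightarrow> n\<^sup>2 div 4 = (n - 2)\<^sup>2 div 4 + (n - (1::nat))"
proof -
  assume n: "n \<ge> 2"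
  have "n\<^sup>2 div 4 = (n - 1)\<^sup>2 div 4 + n div 2" using n by (intro square_div_4_diff_1) auto
  moreover have "(n - 1)\<^sup>2 div 4 = (n - 1 - 1)\<^sup>2 div 4 + (n - 1) div 2" using n by (intro square_div_4_diff_1) auto
  moreover have "n div 2 + (n - 1) div 2 = n - 1" using n by linarith
  moreover have "n - 1 - 1 = n - 2" by simp
  ultimately show ?thesis by simp
qed

lemma square_div_4_diff_gadget:
  assumes "4 * m \<le> (n::nat)"
  shows "2 * m * (n - 4 * m) + (n - 4 * m)\<^sup>2 div 4 \<le> n\<^sup>2 div 4"
proof -
  obtain l where l: "n = l + 4 * m" using assms by (metis add.commute le_add_diff_inverse)
  have "n\<^sup>2 = l\<^sup>2 + 4 * (2 * m * l + 4 * m * m)" using l by (simp add: power2_eq_square algebra_simps)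
  then have "n\<^sup>2 div 4 = l\<^sup>2 div 4 + (2 * m * l + 4 * m * m)" by simp
  then show ?thesis using l by simp
qed

lemma reducible_if_small_degree:
  assumes V: "finite V" "simple_graph V E" "v \<in> V" and deg: "card (neighbours E v) < card V div 2"
  shows "reducible L 1 V E"
  unfolding reducible_def
proof (intro exI conjI)
  let ?n = "card V" and ?d = "card (neighbours E v)"
  show "{v} \<subseteq> V" "{v} \<noteq> {}" "card {v} \<le> 1" using V by auto
  have finN: "finite (neighbours E v)" using neighbours_subset[OF V(2)] V(1) by (meson finite_Diff finite_subset)
  have "card (free_orients L E) \<le> 2 ^ ?d * card (free_orients L (del E {v}))"
  proof (rule card_le_by_deletion[OF V(1,2) order_refl])
    fix \<tau>
    let ?X = "{A\<in>free_orients L E. A \<inter> ((- {v}) \<times> - {v}) = \<tau>}"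
    have "(\<lambda>A. out_nbrs A v UNIV) ` ?X \<subseteq> Pow (neighbours E v)"
    proof (rule image_subsetI)
      fix A assume "A \<in> ?X"
      then have "A \<in> orients E" by (simp add: free_orients_def)
      then show "out_nbrs A v UNIV \<in> Pow (neighbours E v)" using out_nbrs_subset[of A E v UNIV] by simp
    qed
    from card_mono[OF _ this] have "card ((\<lambda>A. out_nbrs A v UNIV) ` ?X) \<le> 2 ^ ?d"
      using finN by (simp add: card_Pow)
    then show "card ((\<lambda>A. A \<inter> ({v} \<times> UNIV)) ` ?X) \<le> 2 ^ ?d" by (simp add: card_arcs_image)
  qed
  then have "2 * card (free_orients L E) * 2 ^ ((?n - 1)\<^sup>2 div 4) \<le>
     2 * (2 ^ ?d * card (free_orients L (del E {v}))) * 2 ^ ((?n - 1)\<^sup>2 div 4)" by simp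
  also have "\<dots> = 2 ^ (?d + 1 + (?n - 1)\<^sup>2 div 4) * card (free_orients L (del E {v}))"
    by (simp add: power_add)
  also have "\<dots> \<le> 2 ^ (?n\<^sup>2 div 4) * card (free_orients L (del E {v}))"
  proof -
    have "?n \<ge> 1" using V by (metis card_0_eq empty_iff less_one not_le)
    then have "?d + 1 + (?n - 1)\<^sup>2 div 4 \<le> ?n\<^sup>2 div 4" using square_div_4_diff_1[of ?n] deg by linarith
    then show ?thesis by (intro mult_le_mono1 power_increasing) auto
  qed
  finally show "2 * card (free_orients L E) * 2 ^ ((?n - card {v})\<^sup>2 div 4) \<le>
       2 ^ (?n\<^sup>2 div 4) * card (free_orients L (del E {v}))" by simp
qed

text \<open>Pigeonhole: at least half of the free orientations contain a gadget, and there are at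
  most n^(4m) positions for it.\<close>

lemma obtain_popular_gadget:
  assumes V: "finite V" "card V = n" "simple_graph V E" and m: "m > 0" and n: "n > 0"
    and few: "2 * card {A\<in>orients E. \<nexists>P. gadget m P A} \<le> card (free_orients L E)"
    and pos: "card (free_orients L E) > 0"
  obtains P where "support P \<subseteq> V" "gadget_orients L m P E \<noteq> {}"
    "card (free_orients L E) \<le> 2 * n ^ (4 * m) * card (gadget_orients L m P E)"
proof (rule ccontr)
  note found = that
  assume no: "\<not> thesis"
  define I where "I = PiE {..<4::nat} (\<lambda>_. {T. T \<subseteq> V \<and> card T = m})"
  let ?d = "card (free_orients L E)"
  have finI: "finite I" unfolding I_def using V(1) by (intro finite_PiE) auto
  have "card I = (n choose m) ^ 4" unfolding I_def using V n_subsets[OF V(1)] by (simp add: card_PiE)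
  also have "\<dots> \<le> (n ^ m) ^ 4" by (intro power_mono) (cases "m \<le> n"; auto simp: binomial_le_pow binomial_eq_0)+
  finally have cardI: "card I \<le> n ^ (4 * m)" by (simp add: power_mult[symmetric] mult.commute)
  have rare: "2 * n ^ (4 * m) * card (gadget_orients L m P E) \<le> ?d - 1" if "P \<in> I" for P
  proof (rule ccontr)
    assume neg: "\<not> ?thesis"
    have "support P \<subseteq> V" using that unfolding I_def by (auto simp: PiE_iff)
    moreover have "gadget_orients L m P E \<noteq> {}" using neg by auto
    moreover have "?d \<le> 2 * n ^ (4 * m) * card (gadget_orients L m P E)" using neg by linarith
    ultimately show False using found[of P] no by blast
  qed
  have cover: "free_orients L E \<subseteq> {A\<in>orients E. \<nexists>P. gadget m P A} \<union> (\<Union>P\<in>I. gadget_orients L m P E)"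
  proof
    fix A assume A: "A \<in> free_orients L E"
    then have orient: "A \<in> orients E" by (simp add: free_orients_def)
    show "A \<in> {A\<in>orients E. \<nexists>P. gadget m P A} \<union> (\<Union>P\<in>I. gadget_orients L m P E)"
    proof (cases "\<exists>P. gadget m P A")
      case True
      then obtain P where P: "gadget m P A" by blast
      \<comment> \<open>Values beyond 3 are fixed by restriction, so that the positions form the
        finite set I.\<close>
      define P' where "P' = restrict P {..<4::nat}"
      have P'i: "P' i = P i" if "i < 4" for i using that by (simp add: P'_def)
      have "gadget m P' A" using P unfolding gadget_def by (simp add: P'i)
      moreover have "P' \<in> I"
        unfolding I_def
      proof (rule PiE_I)
        fix i :: nat assume i: "i \<in> {..<4}"
        then have *: "P i \<times> P (Suc i mod 4) \<subseteq> A" "card (P i) = m" "card (P (Suc i mod 4)) = m"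
          using P by (auto simp: gadget_def)
        \<comment> \<open>Since the next part is nonempty, every vertex of \<open>P i\<close> is the
          tail of an arc and hence lies in V.\<close>
        then have "P (Suc i mod 4) \<noteq> {}" using m by auto
        then have "P i \<subseteq> V" using * orients_subset_Times[OF orient V(3)] by blast
        then show "P' i \<in> {T. T \<subseteq> V \<and> card T = m}" using * P'i i by simp
      qed (simp add: P'_def)
      ultimately show ?thesis using A by (auto simp: gadget_orients_def)
    next
      case False
      then show ?thesis using orient by blast
    qed
  qed
  have fin: "finite {A\<in>orients E. \<nexists>P. gadget m P A}" "finite (\<Union>P\<in>I. gadget_orients L m P E)"
    using finite_orients[OF V(1,3)] finite_free_orients[OF V(1,3)] finI by (auto simp: gadget_orients_def)
  have "?d \<le> card {A\<in>orients E. \<nexists>P. gadget m P A} + card (\<Union>P\<in>I. gadget_orients L m P E)"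
    using card_mono[OF _ cover] card_Un_le fin by (meson finite_UnI le_trans)
  moreover have "card (\<Union>P\<in>I. gadget_orients L m P E) \<le> (\<Sum>P\<in>I. card (gadget_orients L m P E))"
    by (rule card_UN_le[OF finI])
  moreover have "2 * (\<Sum>P\<in>I. card (gadget_orients L m P E)) \<le> ?d - 1"
  proof -
    have "n ^ (4 * m) * (2 * (\<Sum>P\<in>I. card (gadget_orients L m P E))) =
        (\<Sum>P\<in>I. 2 * n ^ (4 * m) * card (gadget_orients L m P E))"
      by (simp add: sum_distrib_left algebra_simps)
    also have "\<dots> \<le> (\<Sum>P\<in>I. ?d - 1)" using rare by (rule sum_mono)
    also have "\<dots> \<le> n ^ (4 * m) * (?d - 1)" using cardI by simp
    finally show ?thesis using n by simp
  qed
  ultimately show False using few pos by linarith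
qed

text \<open>The left side of hypothesis \<open>q\<close> collects all losses: 2 for the required
  doubling, 2 n^(4m) for fixing a popular gadget, and 2^(16 m^2) for the arcs inside it. The gain
  from q bad blocks has to outweigh them.\<close>

lemma reducible_if_many_bad_blocks:
  assumes V: "finite V" "card V = n" "simple_graph V E" and k: "k \<ge> 1" "k \<le> m" "m \<ge> 7"
    and P: "support P \<subseteq> V" "gadget m P A\<^sub>0"
      "card (free_orients (2 * k + 1) E) \<le> 2 * n ^ (4 * m) * card (gadget_orients (2 * k + 1) m P E)"
    and bad: "\<And>B. B \<in> \<B> \<Longrightarrow> bad_block V E P B" "disjoint \<B>" "q \<le> card \<B>"
    and q: "4 * real n ^ (4 * m) * 2 ^ (16 * m * m) * (1 - 1 / 2 ^ (4 * m)) ^ q \<le> 1"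
  shows "reducible (2 * k + 1) (4 * m) V E"
  unfolding reducible_def
proof (intro exI conjI)
  let ?S = "support P"
  have S: "finite ?S" "card ?S = 4 * m" using card_support[OF P(2)] by auto
  show "?S \<subseteq> V" "card ?S \<le> 4 * m" using P S by auto
  show "?S \<noteq> {}" using S k by (metis card.empty mult_eq_0_iff not_numeral_le_zero zero_neq_numeral)
  have "4 * m \<le> n" using card_mono[OF V(1) P(1)] S V by simp
  define d where "d = real (card (free_orients (2 * k + 1) E))"
  define d' where "d' = real (card (free_orients (2 * k + 1) (del E ?S)))"
  define Q :: real where "Q = (1 - 1 / 2 ^ (4 * m)) ^ q"
  define a where "a = 2 * m * (n - 4 * m)"
  have base: "0 \<le> 1 - 1 / (2::real) ^ (4 * m)" "1 - 1 / (2::real) ^ (4 * m) \<le> 1" by simp_all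
  have "d \<le> 2 * real n ^ (4 * m) * real (card (gadget_orients (2 * k + 1) m P E))"
    using of_nat_mono[OF P(3), where 'a = real] by (simp add: d_def)
  also have "\<dots> \<le> 2 * real n ^ (4 * m) * (2 ^ (16 * m * m) * 2 ^ a * (1 - 1 / 2 ^ (4 * m)) ^ card \<B> * d')"
    using card_gadget_orients_le[OF V(1,3) P(2,1) k bad(1,2)] V(2)
    by (intro mult_left_mono) (auto simp: d'_def a_def)
  also have "\<dots> \<le> 2 * real n ^ (4 * m) * (2 ^ (16 * m * m) * 2 ^ a * Q * d')"
    unfolding Q_def using base bad(3)
    by (intro mult_left_mono mult_right_mono power_decreasing) (auto simp: d'_def)
  finally have "2 * d \<le> (4 * real n ^ (4 * m) * 2 ^ (16 * m * m) * Q) * (2 ^ a * d')" by (simp add: algebra_simps)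
  also have "\<dots> \<le> 1 * (2 ^ a * d')"
    using q by (intro mult_right_mono) (auto simp: Q_def d'_def)
  finally have "2 * d * 2 ^ ((n - 4 * m)\<^sup>2 div 4) \<le> 2 ^ a * d' * 2 ^ ((n - 4 * m)\<^sup>2 div 4)"
    by (intro mult_right_mono) auto
  also have "\<dots> = 2 ^ (a + (n - 4 * m)\<^sup>2 div 4) * d'" by (simp add: power_add)
  also have "\<dots> \<le> 2 ^ (n\<^sup>2 div 4) * d'"
    using square_div_4_diff_gadget[OF \<open>4 * m \<le> n\<close>]
    by (intro mult_right_mono power_increasing) (auto simp: a_def d'_def)
  finally have "real (2 * card (free_orients (2 * k + 1) E) * 2 ^ ((n - 4 * m)\<^sup>2 div 4)) \<le>
      real (2 ^ (n\<^sup>2 div 4) * card (free_orients (2 * k + 1) (del E ?S)))"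
    by (simp add: d_def d'_def)
  then show "2 * card (free_orients (2 * k + 1) E) * 2 ^ ((card V - card ?S)\<^sup>2 div 4) \<le>
       2 ^ ((card V)\<^sup>2 div 4) * card (free_orients (2 * k + 1) (del E ?S))"
    using V(2) S(2) by (metis of_nat_le_iff)
qed

section \<open>Near bipartitions\<close>

definition near_bipartition :: "'a set \<Rightarrow> 'a set set \<Rightarrow> 'a set \<Rightarrow> 'a set \<Rightarrow> 'a set \<Rightarrow> bool" where
  "near_bipartition V E X Y Z \<longleftrightarrow> V = X \<union> Y \<union> Z \<and> X \<inter> Y = {} \<and> X \<inter> Z = {} \<and> Y \<inter> Z = {} \<and>
     (\<forall>e\<in>E. \<not> e \<subseteq> X \<and> \<not> e \<subseteq> Y)"

text \<open>Z consists of the gadget and a maximal disjoint family of bad blocks. By maximality no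
  bad block avoids Z: every remaining vertex is attached to exactly one side, which decides between
  X and Y, and no edge joins two vertices attached to the same side.\<close>

lemma obtain_near_bipartition:
  assumes V: "finite V" "simple_graph V E" and P: "support P \<subseteq> V" "gadget m P A\<^sub>0" and m: "m > 0"
    and few: "\<And>\<B>. (\<And>B. B \<in> \<B> \<Longrightarrow> bad_block V E P B) \<Longrightarrow> disjoint \<B> \<Longrightarrow> card \<B> \<le> q"
  obtains X Y Z where "near_bipartition V E X Y Z" "card Z \<le> 4 * m + 2 * q"
proof -
  define \<FF> where "\<FF> = {\<B>. \<B> \<subseteq> Pow V \<and> (\<forall>B\<in>\<B>. bad_block V E P B) \<and> disjoint \<B>}"
  have "\<FF> \<subseteq> Pow (Pow V)" by (auto simp: \<FF>_def)
  then have fin: "finite \<FF>" using V(1) by (meson finite_Pow_iff finite_subset)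
  have "{} \<in> \<FF>" by (simp add: \<FF>_def)
  then have "\<FF> \<noteq> {}" by blast
  from finite_has_maximal[OF fin this] obtain \<B> where
    B: "\<B> \<in> \<FF>" "\<And>\<B>'. \<B>' \<in> \<FF> \<Longrightarrow> \<B> \<subseteq> \<B>' \<Longrightarrow> \<B> = \<B>'" by auto
  have sub: "\<B> \<subseteq> Pow V" and bad: "\<And>B. B \<in> \<B> \<Longrightarrow> bad_block V E P B" and disj: "disjoint \<B>"
    using B(1) by (auto simp: \<FF>_def)
  have finB: "finite \<B>" using sub V(1) by (meson finite_Pow_iff finite_subset)
  have S: "finite (support P)" "card (support P) = 4 * m" using card_support[OF P(2)] by auto
  define Z where "Z = support P \<union> \<Union>\<B>"
  have "card Z \<le> card (support P) + card (\<Union>\<B>)" unfolding Z_def by (rule card_Un_le)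
  also have "card (\<Union>\<B>) \<le> (\<Sum>B\<in>\<B>. card B)" by (rule card_Union_le_sum_card)
  also have "\<dots> \<le> (\<Sum>B\<in>\<B>. 2)" using card_bad_block[OF bad] by (intro sum_mono) fastforce
  also have "\<dots> \<le> 2 * q" using few[OF bad disj] by simp
  finally have cardZ: "card Z \<le> 4 * m + 2 * q" using S by simp
  have ZV: "Z \<subseteq> V" unfolding Z_def using P(1) sub by blast
  have no_bad: "\<not> bad_block V E P B" if "B \<inter> Z = {}" "B \<noteq> {}" for B
  proof
    assume bB: "bad_block V E P B"
    then have "B \<subseteq> V" by (auto simp: bad_block_def)
    moreover have "B \<inter> C = {}" if "C \<in> \<B>" for C using that \<open>B \<inter> Z = {}\<close> by (auto simp: Z_def)
    ultimately have "insert B \<B> \<in> \<FF>"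
      using bB bad sub disj unfolding \<FF>_def by (auto simp: disjoint_def)
    then have "B \<in> \<B>" using B(2)[of "insert B \<B>"] by blast
    then show False using that by (auto simp: Z_def)
  qed
  define N where "N w = neighbours E w \<inter> support P" for w
  define X where "X = {w\<in>V - Z. N w = P 0 \<union> P 2}"
  define Y where "Y = {w\<in>V - Z. N w = P 1 \<union> P 3}"
  have side: "N w \<in> sides P" if "w \<in> V - Z" for w
  proof (rule ccontr)
    assume "N w \<notin> sides P"
    then have "bad_block V E P {w}" using that by (auto simp: bad_block_def N_def Z_def)
    then show False using no_bad[of "{w}"] that by auto
  qed
  have "P 0 \<noteq> {}" "P 0 \<inter> P 1 = {}" "P 0 \<inter> P 3 = {}"
    using gadget_parts[OF P(2)] m by (metis card.empty less_numeral_extra(3) zero_less_numeral) (use gadget_parts(3)[OF P(2)] in auto)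
  then have XY: "X \<inter> Y = {}" unfolding X_def Y_def by blast
  have indep: "\<not> e \<subseteq> W" if e: "e \<in> E" and W: "W \<subseteq> V - Z" "\<And>w. w \<in> W \<Longrightarrow> N w = M" for e W M
  proof
    assume "e \<subseteq> W"
    obtain x y where xy: "e = {x, y}" "x \<noteq> y" by (rule simple_graph_edgeE[OF V(2) e])
    have "x \<in> W" "y \<in> W" using xy \<open>e \<subseteq> W\<close> by auto
    then have "N x \<in> sides P" "N y = N x" using side[of x] W by auto
    moreover have "e \<subseteq> V - support P" using \<open>e \<subseteq> W\<close> W(1) by (auto simp: Z_def)
    ultimately have "bad_block V E P e"
      unfolding bad_block_def N_def using e xy by metis
    moreover have "e \<inter> Z = {}" "e \<noteq> {}" using xy \<open>e \<subseteq> W\<close> W by auto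
    ultimately show False using no_bad by blast
  qed
  have "near_bipartition V E X Y Z"
    unfolding near_bipartition_def
  proof (intro conjI ballI)
    show "V = X \<union> Y \<union> Z" using side ZV unfolding X_def Y_def sides_def by blast
    show "X \<inter> Z = {}" "Y \<inter> Z = {}" by (auto simp: X_def Y_def)
    fix e assume e: "e \<in> E"
    show "\<not> e \<subseteq> X" by (rule indep[OF e, of X "P 0 \<union> P 2"]) (auto simp: X_def)
    show "\<not> e \<subseteq> Y" by (rule indep[OF e, of Y "P 1 \<union> P 3"]) (auto simp: Y_def)
  qed (rule XY)
  then show ?thesis using that cardZ by blast
qed

lemma near_bipartition_commute: "near_bipartition V E X Y Z \<Longrightarrow> near_bipartition V E Y X Z"
  unfolding near_bipartition_def by blast

lemma neighbours_near_bipartition: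
  assumes "near_bipartition V E X Y Z" "simple_graph V E" "x \<in> X"
  shows "neighbours E x \<subseteq> Y \<union> Z"
proof
  fix y assume "y \<in> neighbours E x"
  then have E: "{x, y} \<in> E" by (simp add: neighbours_def)
  then have "y \<in> V" using simple_graph_edgeD[OF assms(2)] by blast
  moreover have "y \<notin> X" using assms(1,3) E by (auto simp: near_bipartition_def)
  ultimately show "y \<in> Y \<union> Z" using assms(1) by (auto simp: near_bipartition_def)
qed

lemma near_bipartition_finite:
  "near_bipartition V E X Y Z \<Longrightarrow> finite V \<Longrightarrow> finite X \<and> finite Y \<and> finite Z"
  by (simp add: near_bipartition_def)

lemma card_near_bipartition:
  assumes nb: "near_bipartition V E X Y Z" and "finite V"
  shows "card X + card Y + card Z = card V"
proof -
  have "finite X" "finite Y" "finite Z" using near_bipartition_finite[OF assms] by auto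
  then have "card (X \<union> Y \<union> Z) = card X + card Y + card Z"
    using nb unfolding near_bipartition_def by (subst card_Un_disjoint; auto simp: card_Un_disjoint)
  then show ?thesis using nb by (simp add: near_bipartition_def)
qed

text \<open>The neighbours of any vertex of X lie in Y or Z, so the minimum degree bounds their
  total size. If X is empty, then Y and Z exhaust V.\<close>

lemma near_bipartition_side_large:
  assumes V: "finite V" "simple_graph V E" and nb: "near_bipartition V E X Y Z"
    and deg: "\<And>v. v \<in> V \<Longrightarrow> card V div 2 \<le> card (neighbours E v)" and Z: "card Z < card V div 2"
  shows "card V div 2 \<le> card Y + card Z"
proof -
  have fin: "finite X" "finite Y" "finite Z" using near_bipartition_finite[OF nb V(1)] by auto
  have deg_le: "card V div 2 \<le> card W' + card Z" if "near_bipartition V E W W' Z" "w \<in> W" for W W' w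
  proof -
    have fW: "finite W'" using near_bipartition_finite[OF that(1) V(1)] by auto
    have "w \<in> V" using that by (auto simp: near_bipartition_def)
    then have "card V div 2 \<le> card (neighbours E w)" by (rule deg)
    also have "\<dots> \<le> card (W' \<union> Z)"
      using neighbours_near_bipartition[OF that(1) V(2) that(2)] fW fin(3) by (intro card_mono) auto
    also have "\<dots> \<le> card W' + card Z" by (rule card_Un_le)
    finally show ?thesis .
  qed
  show ?thesis
  proof (cases "X = {}")
    case False
    then show ?thesis using deg_le[OF nb] by blast
  next
    case True
    then have "card Y + card Z = card V" using card_near_bipartition[OF nb V(1)] by simp
    then show ?thesis by linarith
  qed
qed

text \<open>Applied to the other side, the size bound gives |Y| \<le> n - floor(n/2), while x has at
  least floor(n/2) - |Z| neighbours in Y. The summand 1 is the rounding for odd n.\<close>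

lemma card_non_neighbours_le:
  assumes V: "finite V" "simple_graph V E" and nb: "near_bipartition V E X Y Z"
    and deg: "\<And>v. v \<in> V \<Longrightarrow> card V div 2 \<le> card (neighbours E v)" and Z: "card Z < card V div 2" and x: "x \<in> X"
  shows "card (Y - neighbours E x) \<le> 1 + card Z"
proof -
  have fin: "finite X" "finite Y" "finite Z" using near_bipartition_finite[OF nb V(1)] by auto
  have "x \<in> V" using x nb by (auto simp: near_bipartition_def)
  then have "card V div 2 \<le> card (neighbours E x)" by (rule deg)
  also have "\<dots> \<le> card ((Y \<inter> neighbours E x) \<union> Z)"
    using neighbours_near_bipartition[OF nb V(2) x] fin by (intro card_mono) auto
  also have "\<dots> \<le> card (Y \<inter> neighbours E x) + card Z" by (rule card_Un_le)
  finally have 1: "card V div 2 \<le> card (Y \<inter> neighbours E x) + card Z" .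
  have 2: "card Y = card (Y \<inter> neighbours E x) + card (Y - neighbours E x)"
    using fin by (metis card_Diff_subset_Int card_mono finite_Int inf_le1 le_add_diff_inverse)
  have 3: "card V div 2 \<le> card X + card Z"
    by (rule near_bipartition_side_large[OF V near_bipartition_commute[OF nb] deg Z])
  show ?thesis using 1 2 3 card_near_bipartition[OF nb V(1)] by linarith
qed

lemma mult_le_square_div_4:
  fixes a b n :: nat
  assumes "a + b \<le> n" shows "a * b \<le> n\<^sup>2 div 4"
proof -
  have "4 * (a * b) \<le> (a + b)\<^sup>2"
  proof (cases "a \<le> b")
    case True
    then obtain c where "b = a + c" by (auto simp: le_iff_add)
    then show ?thesis by (simp add: power2_eq_square algebra_simps)
  next
    case False
    then have "b \<le> a" by simp
    then obtain c where "a = b + c" by (auto simp: le_iff_add)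
    then show ?thesis by (simp add: power2_eq_square algebra_simps)
  qed
  also have "\<dots> \<le> n\<^sup>2" using assms by (intro power_mono) auto
  finally show ?thesis by linarith
qed

lemma card_edges_near_bipartition:
  assumes V: "finite V" "simple_graph V E" and nb: "near_bipartition V E X Y Z"
  shows "card E \<le> (card V)\<^sup>2 div 4 + card V * card Z"
proof -
  have fin: "finite X" "finite Y" "finite Z" using near_bipartition_finite[OF nb V(1)] by auto
  let ?I = "X \<times> Y \<union> Z \<times> V"
  have "E \<subseteq> (\<lambda>(u, v). {u, v}) ` ?I"
  proof
    fix e assume e: "e \<in> E"
    obtain u v where uv: "e = {u, v}" "u \<in> V" "v \<in> V" by (rule simple_graph_edgeE[OF V(2) e])
    have "\<not> (u \<in> X \<and> v \<in> X)" "\<not> (u \<in> Y \<and> v \<in> Y)" using nb e uv(1) by (auto simp: near_bipartition_def)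
    then have "(u, v) \<in> ?I \<or> (v, u) \<in> ?I" using nb uv(2,3) unfolding near_bipartition_def by blast
    then show "e \<in> (\<lambda>(u, v). {u, v}) ` ?I" using uv(1) by (metis (no_types, lifting) case_prod_conv image_eqI insert_commute)
  qed
  then have "card E \<le> card ?I" using fin V(1) by (intro surj_card_le) auto
  also have "\<dots> \<le> card (X \<times> Y) + card (Z \<times> V)" by (rule card_Un_le)
  also have "\<dots> = card X * card Y + card V * card Z" by (simp add: card_cartesian_product)
  also have "card X * card Y \<le> (card V)\<^sup>2 div 4"
    using card_near_bipartition[OF nb V(1)] by (intro mult_le_square_div_4) auto
  finally show ?thesis by simp
qed

text \<open>The number of edges exceeds F(n) by at most n |Z|, and the union bound adds at most n +
  2 bits, including one for halving. Each of the two is at most p^2/4, while an atypical pair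
  removes p (p - 1 - |Z|) \<ge> p^2/2 bits because 4 |Z| \<le> p.\<close>

lemma free_orients_mostly_typical:
  fixes V :: "'a::linorder set"
  assumes V: "finite V" "simple_graph V E" "card V = n" and nb: "near_bipartition V E X Y Z"
    and deg: "\<And>v. v \<in> V \<Longrightarrow> n div 2 \<le> card (neighbours E v)"
    and p: "8 \<le> p" "2000 * p \<le> n" "4 * (n + 2) \<le> p * p" "4 * n * card Z \<le> p * p"
    and many: "2 ^ (n\<^sup>2 div 4) < card (free_orients L E)"
  shows "card (free_orients L E) \<le> 2 * card {A\<in>free_orients L E. typical p X Y A}"
proof -
  define z where "z = card Z"
  have "p * p \<le> n * p" using p(2) by (intro mult_le_mono1) linarith
  then have "4 * n * z \<le> n * p" using p(4) unfolding z_def by (rule le_trans[rotated])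
  then have "n * (4 * z) \<le> n * p" by (simp only: ac_simps)
  then have z: "4 * z \<le> p" using p(1,2) by simp
  have Z: "card Z < card V div 2" using z p V(3) unfolding z_def by linarith
  have sub: "X \<subseteq> V" "Y \<subseteq> V" "X \<inter> Y = {}" using nb by (auto simp: near_bipartition_def)
  have sum: "card X + card Y + z = n" using card_near_bipartition[OF nb V(1)] V(3) by (simp add: z_def)
  define x where "x = p * (p - (1 + z))"
  have "2 * (p - (1 + z)) \<ge> p" using z p by linarith
  then have "p * p \<le> p * (2 * (p - (1 + z)))" by (rule mult_le_mono2)
  then have x: "p * p \<le> 2 * x" by (simp add: x_def)
  have E: "card E \<le> n\<^sup>2 div 4 + n * z" using card_edges_near_bipartition[OF V(1,2) nb] V(3) by (simp add: z_def)
  have "n \<ge> 16000" using p by linarith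
  then have "16000 * n \<le> n * n" by (rule mult_le_mono1)
  \<comment> \<open>Needed for the truncated subtraction: if \<open>card E\<close> is below x, the
    remaining n + 2 bits must still fit into F(n).\<close>
  then have F: "n + 2 \<le> n\<^sup>2 div 4" using \<open>n \<ge> 16000\<close> unfolding power2_eq_square by linarith
  have "4 * (n * z) \<le> p * p" using p(4) by (simp add: z_def mult.assoc)
  moreover have "b + c \<le> x" if "4 * b \<le> P" "P \<le> 2 * x" "4 * c \<le> P" for b c x P :: nat
    using that by linarith
  ultimately have nz: "n * z + (n + 2) \<le> x" using x p(3) by blast
  have arith: "a + (e - x) \<le> f" if "e \<le> f + b" "b + c \<le> x" "a \<le> c" "c \<le> f" for a b c e f x :: nat
    using that by linarith
  have expo: "card X + card Y + 2 + (card E - x) \<le> n\<^sup>2 div 4"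
    by (rule arith[OF E nz _ F]) (use sum in linarith)
  have "card {A\<in>orients E. \<not> typical p X Y A} \<le> 2 ^ (card X + card Y + 1) * 2 ^ (card E - x)"
    unfolding x_def z_def
    by (rule card_atypical_le[OF V(1,2) sub]) (use card_non_neighbours_le[OF V(1,2) nb _ Z] deg V(3) in auto)
  then have "2 * card {A\<in>orients E. \<not> typical p X Y A} \<le> 2 ^ (card X + card Y + 2 + (card E - x))"
    by (simp add: power_add)
  also have "\<dots> \<le> 2 ^ (n\<^sup>2 div 4)" using expo by (intro power_increasing) auto
  finally have atyp: "2 * card {A\<in>orients E. \<not> typical p X Y A} \<le> 2 ^ (n\<^sup>2 div 4)" .
  have "card (free_orients L E) \<le> card ({A\<in>free_orients L E. typical p X Y A} \<union> {A\<in>orients E. \<not> typical p X Y A})"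
    using finite_orients[OF V(1,2)] finite_free_orients[OF V(1,2)] free_orients_subset[of L E] by (intro card_mono) auto
  also have "\<dots> \<le> card {A\<in>free_orients L E. typical p X Y A} + card {A\<in>orients E. \<not> typical p X Y A}" by (rule card_Un_le)
  finally show ?thesis using atyp many by linarith
qed

text \<open>The budget is floor(n/2) bits, while two small subsets and the edges to Z cost at most
  n/16 + |Z| bits. The factor 8 is composed of 2 for the required doubling, 2 for the passage to
  typical orientations and 2 for the alternatives at w.\<close>

lemma reducible_if_balanced_vertex:
  assumes V: "finite V" "simple_graph V E" "card V = n" and nb: "near_bipartition V E X Y Z" and k: "k \<ge> 1"
    and typ_many: "card (free_orients (2 * k + 1) E) \<le> 2 * card {A\<in>free_orients (2 * k + 1) E. typical p X Y A}"
    and p: "2000 * p \<le> n" "n \<ge> 100" "4 * card Z \<le> p"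
    and big: "2 * p * (2 * k + 1) + 2 \<le> card X" "2 * p * (2 * k + 1) + 2 \<le> card Y"
    and w: "w \<in> Z" "2 * p \<le> card (neighbours E w \<inter> X)" "2 * p \<le> card (neighbours E w \<inter> Y)"
  shows "reducible (2 * k + 1) 2 V E"
  unfolding reducible_def
proof (intro exI conjI)
  let ?L = "2 * k + 1"
  show "{w} \<subseteq> V" "{w} \<noteq> {}" "card {w} \<le> 2" using w(1) nb by (auto simp: near_bipartition_def)
  have fin: "finite X" "finite Y" "finite Z" using near_bipartition_finite[OF nb V(1)] by auto
  have XYZ: "V = X \<union> Y \<union> Z" "X \<inter> Y = {}" "w \<notin> X" "w \<notin> Y" using nb w(1) by (auto simp: near_bipartition_def)
  have cards: "card X \<le> n" "card Y \<le> n" using card_near_bipartition[OF nb V(1)] V(3) by auto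
  define s where "s W = card {T. T \<subseteq> W \<and> card T \<le> p}" for W :: "'a set"
  define d' where "d' = card (free_orients ?L (del E {w}))"
  have "1000 * p \<le> n" using p by simp
  then have s: "real (s X) \<le> 2 powr (real n / 32)" "real (s Y) \<le> 2 powr (real n / 32)"
    unfolding s_def using card_small_subsets_le[OF fin(1) cards(1)] card_small_subsets_le[OF fin(2) cards(2)] by auto
  have "real (8 * (s X * s Y * 2 ^ card Z)) = 8 * (real (s X) * real (s Y) * 2 ^ card Z)" by simp
  also have "\<dots> \<le> 8 * (2 powr (real n / 32) * 2 powr (real n / 32) * 2 ^ card Z)"
    using s by (intro mult_left_mono mult_right_mono mult_mono) auto
  also have "\<dots> = 2 powr (3 + real n / 16 + real (card Z))"
  proof -
    have "3 + real n / 16 + real (card Z) = 3 + (real n / 32 + real n / 32) + real (card Z)" by simp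
    then show ?thesis by (simp only: powr_add powr_realpow zero_less_numeral) (simp add: powr_numeral)
  qed
  also have "\<dots> \<le> 2 powr (real (n div 2))"
  proof (rule powr_mono)
    have "real n \<le> 2 * real (n div 2) + 1" "8000 * real (card Z) \<le> real n" "real n \<ge> 100" using p by linarith+
    then show "3 + real n / 16 + real (card Z) \<le> real (n div 2)" by linarith
  qed simp
  also have "\<dots> = real (2 ^ (n div 2))" by (simp add: powr_realpow)
  finally have num: "8 * (s X * s Y * 2 ^ card Z) \<le> 2 ^ (n div 2)" by (simp only: of_nat_le_iff)
  have "card {A\<in>free_orients ?L E. typical p X Y A} \<le> 2 * (s X * s Y * 2 ^ card Z) * d'"
    unfolding s_def d'_def by (rule card_typical_le_delete_vertex[OF V(1,2) XYZ(1) k XYZ(2-4) big w(2,3)])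
  then have "2 * card (free_orients ?L E) \<le> 8 * (s X * s Y * 2 ^ card Z) * d'" using typ_many by linarith
  also have "\<dots> \<le> 2 ^ (n div 2) * d'" using num by (rule mult_le_mono1)
  finally have "2 * card (free_orients ?L E) * 2 ^ ((n - 1)\<^sup>2 div 4) \<le> 2 ^ (n div 2) * d' * 2 ^ ((n - 1)\<^sup>2 div 4)"
    by (rule mult_le_mono1)
  also have "\<dots> = 2 ^ ((n - 1)\<^sup>2 div 4 + n div 2) * d'" by (simp add: power_add)
  also have "\<dots> = 2 ^ (n\<^sup>2 div 4) * d'" using square_div_4_diff_1[of n] p by simp
  finally show "2 * card (free_orients ?L E) * 2 ^ ((card V - card {w})\<^sup>2 div 4) \<le> 2 ^ ((card V)\<^sup>2 div 4) * card (free_orients ?L (del E {w}))"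
    using V(3) by (simp add: d'_def)
qed

text \<open>Without the restriction there would be 4^|Y| pairs, about 2^n. For k = 1 the inequality
  3^5 \<le> 2^8 gives 3^|Y| \<le> 2^(8|Y|/5), about 2^(4n/5); otherwise one set is small and about
  n/2 + n/32 bits suffice. The common bound 9n/10 leaves a linear margin below n - 1.\<close>

lemma card_compatible_pairs_le:
  assumes "finite Y" "2 * card Y \<le> n + 1" "2000 * p \<le> n" "n \<ge> 100"
  shows "real (card (compatible_pairs k p Y)) \<le> 2 powr (9 / 10 * real n)"
proof (cases "k = 1")
  case True
  have "(3::real) ^ 5 \<le> 2 ^ 8" by simp
  then have "((3::real) ^ 5) powr (1/5) \<le> (2 ^ 8) powr (1/5)" by (intro powr_mono2) auto
  moreover have "((3::real) ^ 5) powr (1/5) = 3" by (simp only: powr_realpow[symmetric] powr_powr) simp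
  moreover have "((2::real) ^ 8) powr (1/5) = 2 powr (8/5)" by (simp only: powr_realpow[symmetric] powr_powr) simp
  ultimately have 3: "(3::real) \<le> 2 powr (8/5)" by simp
  have "real (card (compatible_pairs k p Y)) \<le> real (3 ^ card Y)"
    using card_compatible_pairs_1[OF assms(1)] True by (intro of_nat_mono) simp
  also have "\<dots> = 3 ^ card Y" by simp
  also have "\<dots> \<le> (2 powr (8/5)) ^ card Y" using 3 by (rule power_mono) simp
  also have "\<dots> = 2 powr (8/5 * real (card Y))" by (simp add: powr_power mult.commute)
  also have "\<dots> \<le> 2 powr (9 / 10 * real n)"
  proof (rule powr_mono)
    have "2 * real (card Y) \<le> real n + 1" "real n \<ge> 100" using assms by linarith+
    then show "8/5 * real (card Y) \<le> 9 / 10 * real n" by linarith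
  qed simp
  finally show ?thesis .
next
  case False
  have "card Y \<le> n" using assms by linarith
  then have s: "real (card {T. T \<subseteq> Y \<and> card T \<le> 2 * p}) \<le> 2 powr (real n / 32)"
    using assms by (intro card_small_subsets_le) auto
  have "real (card (compatible_pairs k p Y)) \<le> real (2 * (card {T. T \<subseteq> Y \<and> card T \<le> 2 * p} * 2 ^ card Y))"
    using card_compatible_pairs_neq_1[OF assms(1) False] by (rule of_nat_mono)
  also have "\<dots> = 2 * (real (card {T. T \<subseteq> Y \<and> card T \<le> 2 * p}) * 2 ^ card Y)" by simp
  also have "\<dots> \<le> 2 * (2 powr (real n / 32) * 2 ^ card Y)" using s by (intro mult_left_mono mult_right_mono) auto
  also have "\<dots> = 2 powr (1 + real n / 32 + real (card Y))"
    by (simp add: powr_add powr_realpow)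
  also have "\<dots> \<le> 2 powr (9 / 10 * real n)"
  proof (rule powr_mono)
    have "2 * real (card Y) \<le> real n + 1" "real n \<ge> 100" using assms by linarith+
    then show "1 + real n / 32 + real (card Y) \<le> 9 / 10 * real n" by linarith
  qed simp
  finally show ?thesis .
qed

text \<open>The budget for two vertices is n - 1 bits; compatible pairs cost at most 9n/10 and the
  neighbours outside Y at most 2 (2p + |Z|). The factor 8 is composed of 2 for the required
  doubling, 2 for the passage to typical orientations and 2 for the direction of the edge.\<close>

lemma reducible_if_inner_edge:
  assumes V: "finite V" "simple_graph V E" "card V = n" and nb: "near_bipartition V E X Y Z" and k: "k \<ge> 1"
    and typ_many: "card (free_orients (2 * k + 1) E) \<le> 2 * card {A\<in>free_orients (2 * k + 1) E. typical p X Y A}"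
    and p: "2000 * p \<le> n" "n \<ge> 100" "4 * card Z \<le> p" "2 * card Y \<le> n + 1"
    and big: "2 * p * (2 * k + 1) + 2 \<le> card X" "2 * p * (2 * k + 1) + 2 \<le> card Y"
    and uv: "{u, v} \<in> E" "u \<notin> Y" "v \<notin> Y"
    and r: "card (neighbours E u - Y) \<le> 2 * p + card Z" "card (neighbours E v - Y) \<le> 2 * p + card Z"
  shows "reducible (2 * k + 1) 2 V E"
  unfolding reducible_def
proof (intro exI conjI)
  let ?L = "2 * k + 1"
  have uvV: "u \<in> V" "v \<in> V" "u \<noteq> v" using simple_graph_edgeD[OF V(2) uv(1)] by auto
  then show "{u, v} \<subseteq> V" "{u, v} \<noteq> {}" "card {u, v} \<le> 2" by auto
  have card2: "card {u, v} = 2" using uvV by simp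
  have fin: "finite X" "finite Y" "finite Z" using near_bipartition_finite[OF nb V(1)] by auto
  have sub: "X \<subseteq> V" "Y \<subseteq> V" "X \<inter> Y = {}" using nb by (auto simp: near_bipartition_def)
  define d' where "d' = card (free_orients ?L (del E {u, v}))"
  define c where "c = card (compatible_pairs k p Y) * 2 ^ (2 * (2 * p + card Z))"
  let ?T = "\<lambda>x y. {A\<in>free_orients ?L E. typical p X Y A \<and> (x, y) \<in> A}"
  have 1: "card (?T u v) \<le> c * d'"
    unfolding c_def d'_def by (rule card_typical_le_delete_edge[OF V(1,2) sub(1,2) k sub(3) uv(2,3) uvV(3) big r])
  have "card (?T v u) \<le> c * card (free_orients ?L (del E {v, u}))"
    unfolding c_def by (rule card_typical_le_delete_edge[OF V(1,2) sub(1,2) k sub(3) uv(3,2) uvV(3)[symmetric] big r(2,1)])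
  then have 2: "card (?T v u) \<le> c * d'" by (simp add: d'_def insert_commute)
  have cover: "{A\<in>free_orients ?L E. typical p X Y A} \<subseteq> ?T u v \<union> ?T v u"
  proof
    fix A assume A: "A \<in> {A\<in>free_orients ?L E. typical p X Y A}"
    then have "A \<in> orients E" by (simp add: free_orients_def)
    then show "A \<in> ?T u v \<union> ?T v u" using orients_iff[OF _ uv(1)] A by blast
  qed
  have "finite (?T u v \<union> ?T v u)" using finite_free_orients[OF V(1,2)] by simp
  then have "card {A\<in>free_orients ?L E. typical p X Y A} \<le> card (?T u v \<union> ?T v u)" using cover by (rule card_mono)
  also have "\<dots> \<le> card (?T u v) + card (?T v u)" by (rule card_Un_le)
  finally have "2 * card (free_orients ?L E) \<le> 8 * c * d'" using 1 2 typ_many by linarith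
  also have "\<dots> \<le> 2 ^ (n - 1) * d'"
  proof (rule mult_le_mono1)
    have "real (8 * c) = 8 * (real (card (compatible_pairs k p Y)) * 2 ^ (2 * (2 * p + card Z)))" by (simp add: c_def)
    also have "\<dots> \<le> 8 * (2 powr (9 / 10 * real n) * 2 ^ (2 * (2 * p + card Z)))"
      using card_compatible_pairs_le[OF fin(2) p(4,1,2)] by (intro mult_left_mono mult_right_mono) auto
    also have "\<dots> = 2 powr (3 + 9 / 10 * real n + real (2 * (2 * p + card Z)))"
      by (simp only: powr_add powr_realpow zero_less_numeral) (simp add: powr_numeral)
    also have "\<dots> \<le> 2 powr (real (n - 1))"
    proof (rule powr_mono)
      have "2000 * real p \<le> real n" "4 * real (card Z) \<le> real p" "real n \<ge> 100" "real (n - 1) = real n - 1" using p by linarith+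
      then show "3 + 9 / 10 * real n + real (2 * (2 * p + card Z)) \<le> real (n - 1)" by simp
    qed simp
    also have "\<dots> = real (2 ^ (n - 1))" by (simp add: powr_realpow)
    finally show "8 * c \<le> 2 ^ (n - 1)" by (simp only: of_nat_le_iff)
  qed
  finally have "2 * card (free_orients ?L E) * 2 ^ ((n - 2)\<^sup>2 div 4) \<le> 2 ^ (n - 1) * d' * 2 ^ ((n - 2)\<^sup>2 div 4)"
    by (rule mult_le_mono1)
  also have "\<dots> = 2 ^ ((n - 2)\<^sup>2 div 4 + (n - 1)) * d'" by (simp add: power_add)
  also have "\<dots> = 2 ^ (n\<^sup>2 div 4) * d'" using square_div_4_diff_2[of n] p by simp
  finally show "2 * card (free_orients ?L E) * 2 ^ ((card V - card {u, v})\<^sup>2 div 4) \<le> 2 ^ ((card V)\<^sup>2 div 4) * card (free_orients ?L (del E {u, v}))"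
    using V(3) card2 by (simp add: d'_def)
qed

lemma card_edges_bipartite:
  assumes V: "finite V" "simple_graph V E" "V = X \<union> Y" "X \<inter> Y = {}" and "\<And>e. e \<in> E \<Longrightarrow> \<not> e \<subseteq> X \<and> \<not> e \<subseteq> Y"
  shows "card E \<le> (card V)\<^sup>2 div 4"
  using card_edges_near_bipartition[OF V(1,2), of X Y "{}"] assms by (simp add: near_bipartition_def)

text \<open>If every vertex of Z has fewer than 2p neighbours on some side, it can be placed on that
  side. If the resulting bipartition had no inner edge, there would be at most F(n) edges,
  contradicting \<open>many\<close>. An inner edge has ends with few neighbours outside the opposite
  part, as its deletion requires.\<close>

lemma reducible_near_bipartition:
  fixes V :: "'a::linorder set"
  assumes V: "finite V" "simple_graph V E" "card V = n" and nb: "near_bipartition V E X Y Z" and k: "k \<ge> 1"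
    and deg: "\<And>v. v \<in> V \<Longrightarrow> n div 2 \<le> card (neighbours E v)"
    and p: "8 \<le> p" "2000 * (2 * k + 1) * p \<le> n" "4 * (n + 2) \<le> p * p" "4 * n * card Z \<le> p * p"
    and many: "2 ^ (n\<^sup>2 div 4) < card (free_orients (2 * k + 1) E)"
  shows "reducible (2 * k + 1) 2 V E"
proof -
  let ?L = "2 * k + 1"
  have "2000 * p \<le> 2000 * (2 * k + 1) * p" by simp
  then have p2000: "2000 * p \<le> n" using p(2) by linarith
  have n: "n \<ge> 100" using p2000 p(1) by linarith
  have "p * p \<le> n * p" using p2000 by (intro mult_le_mono1) linarith
  then have "4 * n * card Z \<le> n * p" using p(4) by (rule le_trans[rotated])
  then have "n * (4 * card Z) \<le> n * p" by (simp only: ac_simps)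
  then have z: "4 * card Z \<le> p" using n by simp
  have Z: "card Z < card V div 2" using z p2000 p(1) V(3) by linarith
  have sum: "card X + card Y + card Z = n" using card_near_bipartition[OF nb V(1)] V(3) by simp
  note nb' = near_bipartition_commute[OF nb]
  have side: "n div 2 \<le> card Y + card Z" "n div 2 \<le> card X + card Z"
    using near_bipartition_side_large[OF V(1,2) nb _ Z] near_bipartition_side_large[OF V(1,2) nb' _ Z] deg V(3) by auto
  have half: "2 * card Y \<le> n + 1" "2 * card X \<le> n + 1" using side sum by linarith+
  have "1000 * (2 * p * (2 * k + 1)) \<le> n" using p(2) by (simp add: algebra_simps)
  then have big: "2 * p * (2 * k + 1) + 2 \<le> card X" "2 * p * (2 * k + 1) + 2 \<le> card Y"
    using side z n p2000 by linarith+
  have t1: "card (free_orients ?L E) \<le> 2 * card {A\<in>free_orients ?L E. typical p X Y A}"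
    by (rule free_orients_mostly_typical[OF V nb deg p(1) p2000 p(3,4) many])
  then have t2: "card (free_orients ?L E) \<le> 2 * card {A\<in>free_orients ?L E. typical p Y X A}"
    by (simp add: typical_commute[of p X Y])
  have fin: "finite X" "finite Y" "finite Z" using near_bipartition_finite[OF nb V(1)] by auto
  show ?thesis
  proof (cases "\<exists>w\<in>Z. 2 * p \<le> card (neighbours E w \<inter> X) \<and> 2 * p \<le> card (neighbours E w \<inter> Y)")
    case True
    then show ?thesis using reducible_if_balanced_vertex[OF V nb k t1 p2000 n z big] by blast
  next
    case False
    define X' where "X' = X \<union> {w\<in>Z. card (neighbours E w \<inter> X) < 2 * p}"
    define Y' where "Y' = V - X'"
    have XYZ: "V = X \<union> Y \<union> Z" "X \<inter> Y = {}" "X \<inter> Z = {}" "Y \<inter> Z = {}" using nb by (auto simp: near_bipartition_def)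
    have Y': "Y' \<subseteq> Y \<union> {w\<in>Z. card (neighbours E w \<inter> Y) < 2 * p}" using False XYZ by (auto simp: Y'_def X'_def not_less)
    have r: "card (neighbours E u - T) \<le> 2 * p + card Z"
      if ST: "near_bipartition V E S T Z" "finite S" and u: "u \<in> S \<or> card (neighbours E u \<inter> S) < 2 * p" for S T u
    proof -
      have "neighbours E u - T \<subseteq> (neighbours E u \<inter> S) \<union> Z"
        using neighbours_subset[OF V(2), of u] ST(1) unfolding near_bipartition_def by blast
      then have "card (neighbours E u - T) \<le> card ((neighbours E u \<inter> S) \<union> Z)" using ST(2) fin(3) by (intro card_mono) auto
      also have "\<dots> \<le> card (neighbours E u \<inter> S) + card Z" by (rule card_Un_le)
      also have "card (neighbours E u \<inter> S) \<le> 2 * p"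
      proof (cases "u \<in> S")
        case True
        have "neighbours E u \<inter> S = {}"
          using neighbours_near_bipartition[OF ST(1) V(2) True] ST(1) unfolding near_bipartition_def by blast
        then show ?thesis by simp
      qed (use u in auto)
      finally show ?thesis by simp
    qed
    have "\<exists>e\<in>E. e \<subseteq> X' \<or> e \<subseteq> Y'"
    proof (rule ccontr)
      assume no: "\<not> ?thesis"
      have "card E \<le> (card V)\<^sup>2 div 4"
      proof (rule card_edges_bipartite[OF V(1,2), of X' Y'])
        show "V = X' \<union> Y'" using XYZ(1) by (auto simp: X'_def Y'_def)
        show "X' \<inter> Y' = {}" by (auto simp: Y'_def)
        show "\<And>e. e \<in> E \<Longrightarrow> \<not> e \<subseteq> X' \<and> \<not> e \<subseteq> Y'" using no by blast
      qed
      then have "(2::nat) ^ card E \<le> 2 ^ (n\<^sup>2 div 4)" using V(3) by (intro power_increasing) auto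
      moreover have "card (free_orients ?L E) \<le> 2 ^ card E"
        using card_mono[OF finite_orients[OF V(1,2)] free_orients_subset] card_orients[OF V(1,2)] by metis
      ultimately show False using many by linarith
    qed
    then obtain e where e: "e \<in> E" "e \<subseteq> X' \<or> e \<subseteq> Y'" by blast
    obtain u v where uv: "e = {u, v}" by (rule simple_graph_edgeE[OF V(2) e(1)])
    from e(2) show ?thesis
    proof
      assume "e \<subseteq> X'"
      then have in_X': "u \<in> X'" "v \<in> X'" using uv by auto
      then have "u \<notin> Y" "v \<notin> Y" using XYZ by (auto simp: X'_def)
      moreover have "card (neighbours E x - Y) \<le> 2 * p + card Z" if "x \<in> X'" for x
        using that by (intro r[OF nb fin(1)]) (auto simp: X'_def)
      ultimately show ?thesis
        using reducible_if_inner_edge[OF V nb k t1 p2000 n z half(1) big] e(1) uv in_X' by blast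
    next
      assume "e \<subseteq> Y'"
      then have in_Y': "u \<in> Y'" "v \<in> Y'" using uv by auto
      then have "u \<notin> X" "v \<notin> X" using XYZ by (auto simp: Y'_def X'_def)
      moreover have "card (neighbours E x - X) \<le> 2 * p + card Z" if "x \<in> Y'" for x
        using that Y' by (intro r[OF nb' fin(2)]) auto
      ultimately show ?thesis
        using reducible_if_inner_edge[OF V nb' k t2 p2000 n z half(2) big(2,1)] e(1) uv in_Y' by blast
    qed
  qed
qed

section \<open>Descent\<close>

lemma polynomial_times_geometric_tendsto_0:
  fixes r :: real
  assumes "0 \<le> r" "r < 1" "a > 0"
  shows "(\<lambda>q. real q ^ a * r ^ q) \<longlonglongrightarrow> 0"
proof -
  \<comment> \<open>With s the a-th root of r, the sequence is the a-th power of q s^q.\<close>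
  define s where "s = root a r"
  have s: "0 \<le> s" "s < 1" "s ^ a = r" using assms by (auto simp: s_def)
  have "(\<lambda>q. real q * s ^ q) \<longlonglongrightarrow> 0" using s by (intro powser_times_n_limit_0) auto
  then have "(\<lambda>q. (real q * s ^ q) ^ a) \<longlonglongrightarrow> 0 ^ a" by (rule tendsto_power)
  moreover have "(real q * s ^ q) ^ a = real q ^ a * r ^ q" for q
    using s(3) by (simp add: power_mult_distrib power_mult[symmetric] mult.commute[of q]) (simp add: power_mult)
  ultimately show ?thesis using assms(3) by (simp add: zero_power)
qed

lemma eventually_gain_large:
  assumes "m > 0" "Q > 0"
  shows "\<forall>\<^sub>F n in at_top. 4 * real n ^ (4 * m) * 2 ^ (16 * m * m) * (1 - 1 / 2 ^ (4 * m)) ^ (n div Q) \<le> 1"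
proof -
  define r :: real where "r = 1 - 1 / 2 ^ (4 * m)"
  have r: "0 \<le> r" "r < 1" by (auto simp: r_def)
  define C :: real where "C = 4 * real (2 * Q) ^ (4 * m) * 2 ^ (16 * m * m)"
  have C: "C > 0" using assms by (simp add: C_def)
  have "(\<lambda>q. real q ^ (4 * m) * r ^ q) \<longlonglongrightarrow> 0" using r assms by (intro polynomial_times_geometric_tendsto_0) auto
  then have "\<forall>\<^sub>F q in at_top. real q ^ (4 * m) * r ^ q < 1 / C" using C by (intro order_tendstoD) auto
  then have "\<forall>\<^sub>F q in at_top. real q ^ (4 * m) * r ^ q < 1 / C \<and> q \<ge> 1"
    using eventually_ge_at_top[of "1::nat"] by eventually_elim auto
  then have "\<forall>\<^sub>F n in at_top. real (n div Q) ^ (4 * m) * r ^ (n div Q) < 1 / C \<and> n div Q \<ge> 1"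
    using filterlim_at_top_div_const_nat[OF assms(2)] by (rule eventually_compose_filterlim)
  then show ?thesis
  proof eventually_elim
    fix n assume *: "real (n div Q) ^ (4 * m) * r ^ (n div Q) < 1 / C \<and> n div Q \<ge> 1"
    have "n < Q * (n div Q + 1)" using assms(2) by (metis Suc_eq_plus1 dividend_less_times_div mult_Suc_right add.commute)
    also have "\<dots> \<le> Q * (2 * (n div Q))" using * by (intro mult_le_mono2) auto
    finally have "real n \<le> real (2 * Q) * real (n div Q)" by (simp flip: of_nat_mult)
    then have "real n ^ (4 * m) \<le> (real (2 * Q) * real (n div Q)) ^ (4 * m)" by (intro power_mono) auto
    then have "4 * real n ^ (4 * m) * 2 ^ (16 * m * m) * r ^ (n div Q) \<le>
      4 * (real (2 * Q) * real (n div Q)) ^ (4 * m) * 2 ^ (16 * m * m) * r ^ (n div Q)"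
      using r by (intro mult_right_mono mult_left_mono) auto
    also have "\<dots> = C * (real (n div Q) ^ (4 * m) * r ^ (n div Q))" by (simp add: C_def power_mult_distrib)
    also have "\<dots> \<le> 1" using * C by (simp add: field_simps)
    finally show "4 * real n ^ (4 * m) * 2 ^ (16 * m * m) * (1 - 1 / 2 ^ (4 * m)) ^ (n div Q) \<le> 1" by (simp add: r_def)
  qed
qed

text \<open>With j = n div K one has (j choose t) \<ge> (j/t)^t and n \<le> 2Kj, so the right side
  grows like n^(t+1), one degree more than the left.\<close>

lemma eventually_biclique_threshold:
  assumes "t > 0" "K > 0"
  shows "\<forall>\<^sub>F n in at_top. t * n ^ t < (n div K) * ((n div K) choose t)"
proof -
  define M where "M = t * (2 * K * t) ^ t"
  have "\<forall>\<^sub>F j in at_top. j \<ge> t \<and> j > M" for t M :: nat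
    using eventually_ge_at_top[of t] eventually_gt_at_top[of M] by eventually_elim auto
  then have "\<forall>\<^sub>F n in at_top. n div K \<ge> t \<and> n div K > M"
    using filterlim_at_top_div_const_nat[OF assms(2)] by (rule eventually_compose_filterlim)
  then show ?thesis
  proof eventually_elim
    fix n assume *: "n div K \<ge> t \<and> n div K > M"
    define j where "j = n div K"
    have j: "j \<ge> t" "j > M" using * by (auto simp: j_def)
    have "n < K * (j + 1)" unfolding j_def using assms(2) by (metis Suc_eq_plus1 dividend_less_times_div mult_Suc_right add.commute)
    also have "\<dots> \<le> K * (2 * j)" using j assms by (intro mult_le_mono2) auto
    finally have "real n \<le> real (K * (2 * j))" by (simp only: of_nat_le_iff less_imp_le)
    then have n: "real n \<le> real (2 * K * t) * (real j / real t)" using assms by simp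
    have "real (t * n ^ t) \<le> real t * (real (2 * K * t) * (real j / real t)) ^ t"
      using n by (simp add: mult_left_mono power_mono)
    also have "\<dots> = real M * (real j / real t) ^ t" unfolding power_mult_distrib by (simp add: M_def)
    also have "\<dots> < real j * (real j / real t) ^ t" using j assms by (intro mult_strict_right_mono) auto
    also have "\<dots> \<le> real j * real (j choose t)"
      using binomial_ge_n_over_k_pow_k[OF j(1), where 'a = real] by (intro mult_left_mono) auto
    finally show "t * n ^ t < (n div K) * ((n div K) choose t)" unfolding j_def[symmetric] by (simp flip: of_nat_mult)
  qed
qed

lemma eventually_reducible:
  assumes k: "k \<ge> 1"
  shows "\<exists>J N. J > 0 \<and> (\<forall>V::'a::linorder set. \<forall>E. finite V \<longrightarrow> simple_graph V E \<longrightarrow> card V \<ge> N \<longrightarrow>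
    2 ^ ((card V)\<^sup>2 div 4) < card (free_orients (2 * k + 1) E) \<longrightarrow> reducible (2 * k + 1) J V E)"
proof -
  \<comment> \<open>This choice ensures \<open>k \<le> m\<close>, so that 4m vertices allow the
    required paths, and \<open>m \<ge> 7\<close>, so that m + 6 < 2m.\<close>
  define m where "m = k + 7"
  define K where "K = 2000 * (2 * k + 1)"
  \<comment> \<open>Chosen so that 32 K q \<le> p for p = n div K and q = n div Q: with |Z| \<le> 4m
    + 2q and n \<le> 2Kp, the term 16 K q p in the bound for 4 n |Z| takes at most half of p^2. The
    other half is left for 32 m K p.\<close>
  define Q where "Q = 64 * K * K"
  have pos: "m > 0" "K > 0" "Q > 0" "2 * m > 0" by (auto simp: m_def K_def Q_def)
  have threshold: "\<forall>\<^sub>F n in at_top. 2 * m * n ^ (2 * m) < (n div 2000) * ((n div 2000) choose (2 * m))"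
    by (rule eventually_biclique_threshold) (use pos in auto)
  have "\<forall>\<^sub>F n in at_top. n div K \<ge> 64 * m * K + 16 * K + 16"
    by (rule eventually_compose_filterlim[OF eventually_ge_at_top filterlim_at_top_div_const_nat[OF pos(2)]])
  then have "\<forall>\<^sub>F n in at_top. n div K \<ge> 64 * m * K + 16 * K + 16 \<and>
     2 * m * n ^ (2 * m) < (n div 2000) * ((n div 2000) choose (2 * m)) \<and>
     4 * real n ^ (4 * m) * 2 ^ (16 * m * m) * (1 - 1 / 2 ^ (4 * m)) ^ (n div Q) \<le> 1"
    using threshold eventually_gain_large[OF pos(1,3)] by eventually_elim auto
  then obtain N where N: "\<And>n. n \<ge> N \<Longrightarrow> n div K \<ge> 64 * m * K + 16 * K + 16 \<and>
     2 * m * n ^ (2 * m) < (n div 2000) * ((n div 2000) choose (2 * m)) \<and>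
     4 * real n ^ (4 * m) * 2 ^ (16 * m * m) * (1 - 1 / 2 ^ (4 * m)) ^ (n div Q) \<le> 1"
    unfolding eventually_at_top_linorder by blast
  have "reducible (2 * k + 1) (4 * m) V E"
    if V: "finite V" "simple_graph V E" "card V \<ge> N" and many: "2 ^ ((card V)\<^sup>2 div 4) < card (free_orients (2 * k + 1) E)"
    for V :: "'a set" and E
  proof -
    let ?L = "2 * k + 1"
    define n where "n = card V"
    define p where "p = n div K"
    define q where "q = n div Q"
    have c1: "p \<ge> 64 * m * K + 16 * K + 16"
      and c2: "2 * m * n ^ (2 * m) < (n div 2000) * ((n div 2000) choose (2 * m))"
      and c3: "4 * real n ^ (4 * m) * 2 ^ (16 * m * m) * (1 - 1 / 2 ^ (4 * m)) ^ q \<le> 1"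
      using N[of n] V(3) by (auto simp: n_def p_def q_def)
    have pn: "K * p \<le> n" by (simp add: p_def)
    have np: "n \<le> 2 * K * p"
    proof -
      have "n < K * (p + 1)" unfolding p_def using pos(2) by (metis Suc_eq_plus1 dividend_less_times_div mult_Suc_right add.commute)
      also have "\<dots> \<le> K * (2 * p)" using c1 by (intro mult_le_mono2) auto
      finally show ?thesis by simp
    qed
    have qn: "Q * q \<le> n" by (simp add: q_def)
    have "p \<le> K * p" using pos by simp
    then have n16: "n \<ge> 16" using pn c1 by linarith
    have many': "2 ^ (n\<^sup>2 div 4) < card (free_orients ?L E)" using many by (simp add: n_def)
    show ?thesis
    proof (cases "\<exists>v\<in>V. card (neighbours E v) < n div 2")
      case True
      then have "reducible ?L 1 V E" using reducible_if_small_degree[OF V(1,2)] by (auto simp: n_def)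
      then show ?thesis using pos(1) by (auto intro: reducible_mono)
    next
      case False
      then have deg: "\<And>v. v \<in> V \<Longrightarrow> n div 2 \<le> card (neighbours E v)" by (meson not_le)
      have few: "2 * card {A\<in>orients E. \<nexists>P. gadget m P A} \<le> card (free_orients ?L E)"
      proof -
        have "real (card {A\<in>orients E. \<nexists>P. gadget m P A}) \<le> 2 powr (real (n ^ 2) / 32)"
          using n16 c2 by (intro card_orients_without_gadget_le[OF V(1) _ V(2), where j = "n div 2000"]) (auto simp: n_def)
        then have "real (2 * card {A\<in>orients E. \<nexists>P. gadget m P A}) \<le> 2 * 2 powr (real (n ^ 2) / 32)" by simp
        also have "\<dots> = 2 powr (1 + real (n ^ 2) / 32)" by (simp add: powr_add)
        also have "\<dots> \<le> 2 powr (real (n\<^sup>2 div 4))"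
        proof (rule powr_mono)
          have "n \<le> n ^ 2" by (simp add: power2_eq_square)
          then have "n ^ 2 \<ge> 16" using n16 by linarith
          then have "32 + n ^ 2 \<le> 32 * (n ^ 2 div 4)" by linarith
          then have "32 + real (n ^ 2) \<le> 32 * real (n ^ 2 div 4)" by (simp flip: of_nat_le_iff[where 'a = real])
          then show "1 + real (n ^ 2) / 32 \<le> real (n\<^sup>2 div 4)" by simp
        qed simp
        also have "\<dots> = real (2 ^ (n\<^sup>2 div 4))" by (simp add: powr_realpow)
        finally show ?thesis using many' by (simp only: of_nat_le_iff)
      qed
      have dpos: "card (free_orients ?L E) > 0" and n0: "n > 0" using many' n16 by auto
      obtain P where P: "support P \<subseteq> V" "gadget_orients ?L m P E \<noteq> {}"
        "card (free_orients ?L E) \<le> 2 * n ^ (4 * m) * card (gadget_orients ?L m P E)"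
        by (rule obtain_popular_gadget[OF V(1) n_def[symmetric] V(2) pos(1) n0 few dpos])
      then obtain A0 where A0: "gadget m P A0" by (auto simp: gadget_orients_def)
      have km: "k \<le> m" "m \<ge> 7" by (auto simp: m_def)
      show ?thesis
      proof (cases "\<exists>\<B>. (\<forall>B\<in>\<B>. bad_block V E P B) \<and> disjoint \<B> \<and> q \<le> card \<B>")
        case True
        then obtain \<B> where "\<And>B. B \<in> \<B> \<Longrightarrow> bad_block V E P B" "disjoint \<B>" "q \<le> card \<B>" by blast
        then show ?thesis
          using reducible_if_many_bad_blocks[OF V(1) n_def[symmetric] V(2) k km P(1) A0 P(3) _ _ _ c3] by blast
      next
        case False
        then have fewB: "card \<B> \<le> q" if "\<And>B. B \<in> \<B> \<Longrightarrow> bad_block V E P B" "disjoint \<B>" for \<B>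
          using that by (meson nle_le)
        obtain X Y Z where nb: "near_bipartition V E X Y Z" "card Z \<le> 4 * m + 2 * q"
          by (rule obtain_near_bipartition[OF V(1,2) P(1) A0 pos(1) fewB])
        have "reducible ?L 2 V E"
        proof (rule reducible_near_bipartition[OF V(1,2) n_def[symmetric] nb(1) k deg _ _ _ _ many'])
          show "8 \<le> p" using c1 by linarith
          show "2000 * (2 * k + 1) * p \<le> n" using pn by (simp add: K_def)
          have "8 * K + 8 \<le> p" using c1 by linarith
          then have "(8 * K + 8) * p \<le> p * p" by (rule mult_le_mono1)
          moreover have "8 \<le> 8 * p" using c1 by linarith
          ultimately show "4 * (n + 2) \<le> p * p" using np by (simp add: algebra_simps)
          have "32 * K * q \<le> p"
          proof -
            have "2 * K * (32 * K * q) = Q * q" by (simp add: Q_def)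
            then have "2 * K * (32 * K * q) \<le> 2 * K * p" using qn np by linarith
            then show ?thesis using pos(2) by simp
          qed
          then have a: "32 * K * q * p \<le> p * p" by (rule mult_le_mono1)
          have "64 * m * K \<le> p" using c1 by linarith
          then have b: "64 * m * K * p \<le> p * p" by (rule mult_le_mono1)
          have "4 * n * card Z \<le> 4 * (2 * K * p) * (4 * m + 2 * q)" using np nb(2) by (intro mult_le_mono) auto
          also have "\<dots> = 32 * m * K * p + 16 * K * q * p" by (simp add: algebra_simps)
          also have "\<dots> \<le> p * p" using a b by linarith
          finally show "4 * n * card Z \<le> p * p" .
        qed
        then show ?thesis using km by (auto intro: reducible_mono)
      qed
    qed
  qed
  then show ?thesis using pos(1) by (intro exI[of _ "4 * m"] exI[of _ N]) auto
qed

lemma card_free_orients_le_power: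
  fixes V :: "'a::linorder set"
  assumes "finite V" "simple_graph V E"
  shows "card (free_orients L E) \<le> 2 ^ (card V)\<^sup>2"
proof -
  have "card E \<le> (\<Sum>v\<in>V. card (neighbours E v))" by (rule card_edges_le_sum_degrees[OF assms])
  also have "\<dots> \<le> (\<Sum>v\<in>V. card V)"
    using assms(1) neighbours_subset[OF assms(2)] by (intro sum_mono) (metis Diff_subset card_mono subset_trans)
  finally have "card E \<le> (card V)\<^sup>2" by (simp add: power2_eq_square)
  then have "(2::nat) ^ card E \<le> 2 ^ (card V)\<^sup>2" by (intro power_increasing) auto
  moreover have "card (free_orients L E) \<le> 2 ^ card E"
    using card_mono[OF finite_orients[OF assms] free_orients_subset] card_orients[OF assms] by metis
  ultimately show ?thesis by linarith
qed

text \<open>The ratio to 2^F(n) only grows along the descent, so a graph above the bound never leads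
  to one within it. As each doubling costs at most J vertices, there are at least (n - N) div J
  doublings before fewer than N vertices remain, where 2^(N^2) is a trivial bound.\<close>

lemma card_free_orients_le_descent:
  fixes V :: "'a::linorder set"
  assumes J: "J > 0" and red: "\<And>(V::'a set) E. finite V \<Longrightarrow> simple_graph V E \<Longrightarrow> card V \<ge> N \<Longrightarrow>
      2 ^ ((card V)\<^sup>2 div 4) < card (free_orients L E) \<Longrightarrow> reducible L J V E"
    and V: "finite V" "simple_graph V E"
  shows "card (free_orients L E) \<le> 2 ^ ((card V)\<^sup>2 div 4) \<or>
    card (free_orients L E) * 2 ^ ((card V - N) div J) \<le> 2 ^ N\<^sup>2 * 2 ^ ((card V)\<^sup>2 div 4)"
  using V
proof (induction "card V" arbitrary: V E rule: less_induct)
  case less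
  note V = less.prems
  define n where "n = card V"
  define d where "d = card (free_orients L E)"
  show ?case
  proof (cases "n < N")
    case True
    have "d \<le> 2 ^ n\<^sup>2" unfolding d_def n_def by (rule card_free_orients_le_power[OF V])
    also have "\<dots> \<le> 2 ^ N\<^sup>2" using True by (intro power_increasing power_mono) auto
    also have "(2::nat) ^ N\<^sup>2 \<le> 2 ^ N\<^sup>2 * 2 ^ (n\<^sup>2 div 4)" by simp
    finally show ?thesis using True by (simp add: d_def n_def)
  next
    case nN: False
    show ?thesis
    proof (cases "2 ^ (n\<^sup>2 div 4) < d")
      case False
      then show ?thesis by (simp add: d_def n_def)
    next
      case big: True
      then have "reducible L J V E" using red[OF V] nN by (simp add: d_def n_def)
      then obtain S where S: "S \<subseteq> V" "S \<noteq> {}" "card S \<le> J"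
        "2 * d * 2 ^ ((n - card S)\<^sup>2 div 4) \<le> 2 ^ (n\<^sup>2 div 4) * card (free_orients L (del E S))"
        unfolding reducible_def d_def n_def by blast
      have finS: "finite S" using S V finite_subset by metis
      define d' where "d' = card (free_orients L (del E S))"
      define f where "f = (n - card S)\<^sup>2 div 4"
      have cardVS: "card (V - S) = n - card S" using S finS by (simp add: card_Diff_subset n_def)
      have "card S > 0" "card S \<le> n" using S finS V(1) by (auto simp: card_gt_0_iff n_def intro: card_mono)
      then have "card (V - S) < card V" using cardVS by (simp add: n_def)
      from less.hyps[OF this _ simple_graph_del[OF V(2)]] V(1)
      have IH: "d' \<le> 2 ^ f \<or> d' * 2 ^ ((n - card S - N) div J) \<le> 2 ^ N\<^sup>2 * 2 ^ f"
        by (simp add: cardVS d'_def f_def)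
      have S4: "2 * d * 2 ^ f \<le> 2 ^ (n\<^sup>2 div 4) * d'" using S(4) by (simp add: d'_def f_def)
      from IH show ?thesis
      proof
        assume "d' \<le> 2 ^ f"
        then have "2 ^ (n\<^sup>2 div 4) * d' \<le> 2 ^ (n\<^sup>2 div 4) * 2 ^ f" by (rule mult_le_mono2)
        then have "2 * d * 2 ^ f \<le> 2 ^ (n\<^sup>2 div 4) * 2 ^ f" using S4 by linarith
        then have "2 * d \<le> 2 ^ (n\<^sup>2 div 4)" by simp
        then show ?thesis using big by linarith
      next
        assume h: "d' * 2 ^ ((n - card S - N) div J) \<le> 2 ^ N\<^sup>2 * 2 ^ f"
        let ?a = "(n - card S - N) div J"
        have "(n - N) div J \<le> (n - card S - N + J) div J" using S(3) by (intro div_le_mono) linarith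
        also have "\<dots> = ?a + 1" using J by simp
        finally have "(2::nat) ^ ((n - N) div J) \<le> 2 ^ (?a + 1)" by (intro power_increasing) auto
        then have "d * 2 ^ ((n - N) div J) * 2 ^ f \<le> d * 2 ^ (?a + 1) * 2 ^ f" by simp
        also have "\<dots> = (2 * d * 2 ^ f) * 2 ^ ?a" by (simp add: algebra_simps)
        also have "\<dots> \<le> (2 ^ (n\<^sup>2 div 4) * d') * 2 ^ ?a" using S4 by (rule mult_le_mono1)
        also have "\<dots> = 2 ^ (n\<^sup>2 div 4) * (d' * 2 ^ ?a)" by (simp add: mult.assoc)
        also have "\<dots> \<le> 2 ^ (n\<^sup>2 div 4) * (2 ^ N\<^sup>2 * 2 ^ f)" using h by (rule mult_le_mono2)
        also have "\<dots> = (2 ^ N\<^sup>2 * 2 ^ (n\<^sup>2 div 4)) * 2 ^ f" by (simp add: algebra_simps)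
        finally have "d * 2 ^ ((n - N) div J) \<le> 2 ^ N\<^sup>2 * 2 ^ (n\<^sup>2 div 4)" by simp
        then show ?thesis by (simp add: d_def n_def)
      qed
    qed
  qed
qed

text \<open>From N + J N^2 vertices on, the descent doubles at least N^2 times, which cancels the
  factor 2^(N^2).\<close>

lemma card_free_orients_le:
  assumes k: "k \<ge> 1"
  shows "\<exists>n\<^sub>0. \<forall>V::'a::linorder set. \<forall>E. finite V \<longrightarrow> simple_graph V E \<longrightarrow> card V \<ge> n\<^sub>0 \<longrightarrow>
    card (free_orients (2 * k + 1) E) \<le> 2 ^ ((card V)\<^sup>2 div 4)"
proof -
  let ?L = "2 * k + 1"
  obtain J N where JN: "J > 0" "\<And>(V::'a set) E. finite V \<Longrightarrow> simple_graph V E \<Longrightarrow> card V \<ge> N \<Longrightarrow>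
      2 ^ ((card V)\<^sup>2 div 4) < card (free_orients ?L E) \<Longrightarrow> reducible ?L J V E"
    using eventually_reducible[OF k, where 'a = 'a] by metis
  have "card (free_orients ?L E) \<le> 2 ^ ((card V)\<^sup>2 div 4)"
    if V: "finite V" "simple_graph V E" "card V \<ge> N + J * N\<^sup>2" for V :: "'a set" and E
  proof -
    let ?d = "card (free_orients ?L E)" and ?b = "(2::nat) ^ ((card V)\<^sup>2 div 4)"
    have "?d \<le> ?b" if h: "?d * 2 ^ ((card V - N) div J) \<le> 2 ^ N\<^sup>2 * ?b"
    proof -
      have "J * N\<^sup>2 div J \<le> (card V - N) div J" using V(3) by (intro div_le_mono) linarith
      then have "(2::nat) ^ N\<^sup>2 \<le> 2 ^ ((card V - N) div J)" using JN(1) by (intro power_increasing) auto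
      then have "?d * 2 ^ N\<^sup>2 \<le> ?d * 2 ^ ((card V - N) div J)" by (rule mult_le_mono2)
      then have "?d * 2 ^ N\<^sup>2 \<le> 2 ^ N\<^sup>2 * ?b" using h by (rule le_trans)
      then have "2 ^ N\<^sup>2 * ?d \<le> 2 ^ N\<^sup>2 * ?b" by (simp only: mult.commute)
      then show ?thesis by simp
    qed
    then show ?thesis using card_free_orients_le_descent[OF JN V(1,2)] by blast
  qed
  then show ?thesis by blast
qed

section \<open>Passage between arc sets and the definitions of the statement\<close>

lemma bij_betw_iff_orients:
  assumes "simple_graph V E"
  shows "bij_betw (\<lambda>(u, v). {u, v}) A E \<longleftrightarrow> A \<in> orients E"
proof
  assume bij: "bij_betw (\<lambda>(u, v). {u, v}) A E"
  have arc: "{u, v} \<in> E" if "(u, v) \<in> A" for u v using bij_betwE[OF bij] that by fastforce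
  moreover have "(u, v) \<in> A \<longleftrightarrow> (v, u) \<notin> A" if uv: "{u, v} \<in> E" for u v
  proof -
    have "u \<noteq> v" using simple_graph_edgeD[OF assms uv] by blast
    obtain a b where ab: "(a, b) \<in> A" "{a, b} = {u, v}" using bij uv by (force simp: bij_betw_def)
    have "(u, v) \<in> A \<or> (v, u) \<in> A" using ab by (auto simp: doubleton_eq_iff)
    moreover have "\<not> ((u, v) \<in> A \<and> (v, u) \<in> A)"
    proof
      assume "(u, v) \<in> A \<and> (v, u) \<in> A"
      then have "(u, v) = (v, u)"
        using bij_betw_imp_inj_on[OF bij] by (elim inj_onD) (auto simp: insert_commute)
      then show False using \<open>u \<noteq> v\<close> by simp
    qed
    ultimately show ?thesis by blast
  qed
  ultimately show "A \<in> orients E" by (simp add: orients_def)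
next
  assume A: "A \<in> orients E"
  show "bij_betw (\<lambda>(u, v). {u, v}) A E"
    unfolding bij_betw_def
  proof (intro conjI equalityI subsetI)
    show "inj_on (\<lambda>(u, v). {u, v}) A"
    proof (rule inj_onI, clarify)
      fix a b c d assume *: "(a, b) \<in> A" "(c, d) \<in> A" "{a, b} = {c, d}"
      then have "a = c \<and> b = d \<or> a = d \<and> b = c" by (auto simp: doubleton_eq_iff)
      then show "a = c \<and> b = d" using * orients_asym[OF A, of a b] by blast
    qed
    fix e
    show "e \<in> E" if "e \<in> (\<lambda>(u, v). {u, v}) ` A" using that orients_edge[OF A] by auto
    assume e: "e \<in> E"
    obtain u v where uv: "e = {u, v}" by (rule simple_graph_edgeE[OF assms e])
    then have "(u, v) \<in> A \<or> (v, u) \<in> A" using orients_iff[OF A, of u v] e by blast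
    then show "e \<in> (\<lambda>(u, v). {u, v}) ` A" using uv by (force simp: insert_commute)
  qed
qed

lemma contains_copy_directed_cycle_iff:
  assumes "parcs G \<subseteq> pverts G \<times> pverts G"
  shows "contains_copy G (directed_cycle L) \<longleftrightarrow> has_cycle L (parcs G)"
proof
  assume "contains_copy G (directed_cycle L)"
  then show "has_cycle L (parcs G)"
    unfolding contains_copy_def has_cycle_def directed_cycle_def by auto
next
  assume "has_cycle L (parcs G)"
  then obtain f where f: "inj_on f {..<L}" "\<And>i. i < L \<Longrightarrow> (f i, f (Suc i mod L)) \<in> parcs G"
    by (auto simp: has_cycle_def)
  have "f ` {..<L} \<subseteq> pverts G" using f(2) assms by auto
  then show "contains_copy G (directed_cycle L)"
    unfolding contains_copy_def directed_cycle_def using f by (intro exI[of _ f]) auto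
qed

lemma card_free_orientations:
  assumes "simple_graph V E"
  shows "card (free_orientations V E (directed_cycle L)) = card (free_orients L E)"
proof (rule bij_betw_same_card)
  have G: "G \<in> free_orientations V E (directed_cycle L) \<longleftrightarrow> pverts G = V \<and> parcs G \<in> free_orients L E" for G
  proof -
    have "parcs G \<subseteq> V \<times> V" if "parcs G \<in> orients E" using orients_subset_Times[OF that assms] .
    then show ?thesis
      using contains_copy_directed_cycle_iff[of G L] bij_betw_iff_orients[OF assms, of "parcs G"]
      by (auto simp: free_orientations_def orientation_def free_orients_def)
  qed
  show "bij_betw parcs (free_orientations V E (directed_cycle L)) (free_orients L E)"
    unfolding bij_betw_def
  proof (intro conjI equalityI subsetI)
    show "inj_on parcs (free_orientations V E (directed_cycle L))"
      by (rule inj_onI) (auto simp: G intro: pair_pre_digraph.equality)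
    fix A
    show "A \<in> free_orients L E" if "A \<in> parcs ` free_orientations V E (directed_cycle L)" using that G by auto
    assume "A \<in> free_orients L E"
    then have "\<lparr>pverts = V, parcs = A\<rparr> \<in> free_orientations V E (directed_cycle L)" by (simp add: G)
    then show "A \<in> parcs ` free_orientations V E (directed_cycle L)" by (metis image_eqI pair_pre_digraph.select_convs(2))
  qed
qed

section \<open>The lower bound from the balanced complete bipartite graph\<close>

lemma bipartite_has_no_odd_cycle:
  assumes A: "\<And>u v. (u, v) \<in> A \<Longrightarrow> u \<in> X \<longleftrightarrow> v \<notin> X"
  shows "\<not> has_cycle (2 * k + 1) A"
proof
  assume "has_cycle (2 * k + 1) A"
  then obtain f where f: "\<And>i. i < 2 * k + 1 \<Longrightarrow> (f i, f (Suc i mod (2 * k + 1))) \<in> A" by (auto simp: has_cycle_def)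
  have alt: "f i \<in> X \<longleftrightarrow> (even i \<longleftrightarrow> f 0 \<in> X)" if "i < 2 * k + 1" for i
    using that
  proof (induction i)
    case (Suc i)
    then have "f i \<in> X \<longleftrightarrow> f (Suc i) \<notin> X" using A[OF f[of i]] by simp
    then show ?case using Suc by auto
  qed simp
  \<comment> \<open>The closing arc leads from the even index 2k back to 0, although both ends lie
    on the same side.\<close>
  show False using alt[of "2 * k"] A[OF f[of "2 * k"]] by simp
qed

lemma free_orients_complete_bipartite:
  "\<exists>E. simple_graph {..<n} E \<and> card (free_orients (2 * k + 1) E) = 2 ^ (n\<^sup>2 div 4)"
proof -
  define X where "X = {..<n div 2}"
  define Y where "Y = {n div 2..<n}"
  define E where "E = (\<lambda>(u, v). {u, v}) ` (X \<times> Y)"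
  have s: "simple_graph {..<n} E"
    unfolding simple_graph_def E_def X_def Y_def by auto
  have "inj_on (\<lambda>(u, v). {u, v}) (X \<times> Y)"
    by (auto simp: inj_on_def doubleton_eq_iff X_def Y_def)
  then have "card E = (n div 2) * (n - n div 2)" by (simp add: E_def card_image card_cartesian_product X_def Y_def)
  also have "\<dots> = n\<^sup>2 div 4"
  proof (cases "even n")
    case True
    then obtain j where "n = 2 * j" by blast
    then show ?thesis by (simp add: power2_eq_square)
  next
    case False
    then obtain j where j: "n = 2 * j + 1" by (elim oddE)
    then have "n\<^sup>2 = 1 + 4 * (j * j + j)" by (simp add: power2_eq_square algebra_simps)
    then show ?thesis using j by simp
  qed
  finally have cE: "card E = n\<^sup>2 div 4" .
  have "\<not> has_cycle (2 * k + 1) A" if A: "A \<in> orients E" for A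
  proof (rule bipartite_has_no_odd_cycle[where X = X])
    fix u v assume "(u, v) \<in> A"
    then have "{u, v} \<in> E" by (rule orients_edge[OF A])
    then show "u \<in> X \<longleftrightarrow> v \<notin> X" by (auto simp: E_def doubleton_eq_iff X_def Y_def)
  qed
  then have "free_orients (2 * k + 1) E = orients E" by (auto simp: free_orients_def)
  then show ?thesis using card_orients[OF _ s] cE s by auto
qed

theorem theorem1p1:
  fixes k :: nat
  assumes "k \<ge> 1"
  shows "\<exists>n\<^sub>0. \<forall>n\<ge>n\<^sub>0.
    max_free_orientations n (directed_cycle (2 * k + 1)) = 2 ^ nat \<lfloor>(real n)\<^sup>2 / 4\<rfloor>"
proof -
  obtain n\<^sub>0 where n0: "\<And>(V::nat set) E. finite V \<Longrightarrow> simple_graph V E \<Longrightarrow> card V \<ge> n\<^sub>0 \<Longrightarrow>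
      card (free_orients (2 * k + 1) E) \<le> 2 ^ ((card V)\<^sup>2 div 4)"
    using card_free_orients_le[OF assms, where 'a = nat] by metis
  have "max_free_orientations n (directed_cycle (2 * k + 1)) = 2 ^ nat \<lfloor>(real n)\<^sup>2 / 4\<rfloor>" if "n \<ge> n\<^sub>0" for n
  proof -
    have "\<lfloor>(real n)\<^sup>2 / 4\<rfloor> = int (n\<^sup>2 div 4)"
      using floor_divide_of_nat_eq[where 'a = real, of "n\<^sup>2" 4] by simp
    then have exponent: "nat \<lfloor>(real n)\<^sup>2 / 4\<rfloor> = n\<^sup>2 div 4" by simp
    let ?M = "{card (free_orientations {..<n} E (directed_cycle (2 * k + 1))) | E. simple_graph {..<n} E}"
    have "Max ?M = 2 ^ (n\<^sup>2 div 4)"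
    proof (rule Max_eqI)
      show "finite ?M" by (rule max_free_orientations_set(1))
      show "y \<le> 2 ^ (n\<^sup>2 div 4)" if "y \<in> ?M" for y
        using that n0[of "{..<n}"] \<open>n \<ge> n\<^sub>0\<close> by (auto simp: card_free_orientations)
      obtain E where "simple_graph {..<n} E" "card (free_orients (2 * k + 1) E) = 2 ^ (n\<^sup>2 div 4)"
        using free_orients_complete_bipartite by blast
      then show "2 ^ (n\<^sup>2 div 4) \<in> ?M"
        using card_free_orientations[of "{..<n}" E "2 * k + 1"] by (intro CollectI exI[of _ E]) simp
    qed
    then show ?thesis unfolding max_free_orientations_def exponent .
  qed
  then show ?thesis by blast
qed

end
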